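(* Let $\Gamma$ be a finite cubic vertex-transitive graph admitting a partition of its edge set into a $2$-factor $\mathcal{C}$ and a $1$-factor such that $\Gamma$ is of bialternating cycle quotient type with respect to $\mathcal{C}$. Let $m=|\mathcal{C}|$ and let $n$ be the (common) length of the cycles in $\mathcal{C}$. Then $\mathrm{Aut}(\Gamma)$ has a vertex-transitive subgroup $G$ preserving $\mathcal{C}$ if and only if $4\mid n$ and one of the following holds: (i) $n=4$ and $\Gamma$ is isomorphic to the Möbius ladder of order $4m$ or to the prism graph of order $4m$; (ii) $n=8$ and one of the following holds: - $3\mid m$ and $\Gamma\cong\mathcal{X}_b^1(m)$ or $\Gamma\cong\mathcal{X}_b^2(m)$; - $m$ is odd and $\Gamma\cong\mathcal{X}_b(m,8,5,4,\ell)$ for some $\ell\in\{3,7\}$; - $m$ is even and $\Gamma\cong\mathcal{X}_b(m,8,a,4,\ell)$ for some $a\in\{1,5\}$ and $\ell\in\{2,6\}$; (iii) $n\ge 12$ and $\Gamma\cong\mathcal{X}_b(m,n,a,b,\ell)$ for some admissible parameters such that one of the following holds: - $m$ and $\ell$ are both odd, and $b=n-4$ and $a=2\ell-1$ hold in $\mathbb{Z}_n$; - $m$ is odd, $\ell$ is even, $a=1$, $b=4$, $n=4n_0$ for an odd integer $n_0\ge 3$, and $\ell=2n_0+2m-2$ holds in $\mathbb{Z}_n$; - $m$ and $\ell$ are both even, and $(\ell+2)(b_0-1)=0$ and $2(\ell+2)=2m(b_0+1)$ both hold in $\mathbb{Z}_n$, where $b=4b_0$. Here, in (ii) and (iii),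 $\cong$ means that there is a graph isomorphism under which the cycles of $\mathcal{C}$ correspond to the cycles of the natural $2$-factor of the listed graph. Moreover, whenever such a group $G$ exists, $\Gamma$ has girth at most $10$, the group $G$ acts regularly on $V(\Gamma)$, and $\Gamma$ is a Cayley graph of $G$ with respect to a connection set consisting of three involutions.
   Context: All graphs are finite and simple. A $2$-factor is identified with its set $\mathcal{C}$ of cycles; a group $G\le\mathrm{Aut}(\Gamma)$ preserves $\mathcal{C}$ if each element of $G$ permutes the cycles in $\mathcal{C}$. Cycle quotient type. Let $\Gamma$ be cubic with edge set partitioned into a $2$-factor $\mathcal{C}$ and a $1$-factor. The quotient graph $\Gamma_{\mathcal{C}}$ has vertex set $\mathcal{C}$, with distinct $C,C'\in\mathcal{C}$ adjacent when some vertex of $C$ is adjacent in $\Gamma$ to some vertex of $C'$. $\Gamma$ is of cycle quotient type with respect to $\mathcal{C}$ if $|\mathcal{C}|\ge 3$ and $\Gamma_{\mathcal{C}}$ is a cycle; then all cycles in $\mathcal{C}$ have a common length $n$ and each vertex $v$ has a unique neighbor $v^*$ (its outside neighbor) lying on a cycle of $\mathcal{C}$ different from the one containing $v$. It is of bialternating cycle quotient type if, in addition, for each vertex $v$ precisely one of the two neighbors $w$ of $v$ on its cycle of $\mathcal{C}$ has the property that $w^*$ lies on the same member of $\mathcal{C}$ as $v^*$. The prism graph of order $4m$ is the Cartesian product of a $2m$-cycle with $K_2$. The Möbius ladder of order $4m$ is the circulant graph on $\mathbb{Z}_{4m}$ with connection set $\{1,-1,2m\}$. Graphs $\mathcal{X}_b(m,n,a,b,\ell)$.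 Let $m\ge 3$ and $n=4n_0$ with $n_0\ge 2$ an integer. Let $a,b,\ell\in\mathbb{Z}_n$ be such that (admissibility): $b=4b_0$ for some integer $b_0$ with $1\le b_0<n_0$ and $\gcd(n_0,b_0)=1$; $a=4a_0+1$ for some integer $a_0$ with $0\le a_0<n_0$; $bb_0\equiv 4\pmod n$; $ba_0+a\equiv 1\pmod n$; and one of $\ell-2$, $\ell-3$ is divisible by $4$. Put $\varepsilon=1$ if $\ell$ is even and $\varepsilon=-1$ if $\ell$ is odd. The graph $\mathcal{X}_b(m,n,a,b,\ell)$ has vertex set $\{u_{i,j}: i\in\mathbb{Z}_m, j\in\mathbb{Z}_n\}$ and edges: $u_{i,j}\sim u_{i,j\pm1}$ for all $i,j$; $u_{i,2i+4j_0+\delta}\sim u_{i+1,2i+bj_0+\delta a}$ for all $0\le i\le m-2$, $0\le j_0<n_0$, $\delta\in\{0,1\}$; and $u_{m-1,2(m-1)+4j_0+\delta}\sim u_{0,\ell+\varepsilon(bj_0+\delta a)}$ for all $0\le j_0<n_0$, $\delta\in\{0,1\}$. Graphs $\mathcal{X}_b^1(m)$ and $\mathcal{X}_b^2(m)$, for $m\ge 3$ with $3\mid m$. Both have vertex set $\{u_{i,j}: i\in\mathbb{Z}_m, j\in\mathbb{Z}_8\}$ and $u_{i,j}\sim u_{i,j+1}$ for all $i,j$. In addition, for $\delta\in\{0,1\}$: - in $\mathcal{X}_b^1(m)$: $u_{i,2i+\delta}\sim u_{i+1,2i+4\delta}$ and $u_{i,2i+4+\delta}\sim u_{i+1,2i+1+4\delta}$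 for $0\le i\le m-2$; $u_{m-1,2(m-1)+\delta}\sim u_{0,6+4\delta}$ and $u_{m-1,2(m-1)+4+\delta}\sim u_{0,7+4\delta}$; - in $\mathcal{X}_b^2(m)$: $u_{i,2i+\delta}\sim u_{i+1,2i+\delta}$ and $u_{i,2i+4+\delta}\sim u_{i+1,2i+5-\delta}$ for $0\le i\le m-2$; $u_{m-1,2(m-1)+\delta}\sim u_{0,6+\delta}$ and $u_{m-1,2(m-1)+4+\delta}\sim u_{0,3-\delta}$. In each of these graphs the natural $2$-factor consists of the cycles induced on the sets $V_i=\{u_{i,j}: j\in\mathbb{Z}_n\}$, $i\in\mathbb{Z}_m$ (with $n=8$ for $\mathcal{X}_b^1(m)$, $\mathcal{X}_b^2(m)$). *)

theory Defs
  imports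
    "Graph_Theory.Graph_Theory"
    "HOL-Algebra.Group_Action"
    "HOL-Number_Theory.Cong"
    "HOL-Library.Extended_Nat"
begin

text \<open>
  A finite simple graph is a \<^locale>\<open>pair_graph\<close>: an undirected edge is represented
  by its two opposite arcs.
\<close>

section \<open>Isomorphisms, automorphisms, girth\<close>

definition graph_isomorphism ::
    "('a \<Rightarrow> 'b) \<Rightarrow> 'a pair_pre_digraph \<Rightarrow> 'b pair_pre_digraph \<Rightarrow> bool" where
  "graph_isomorphism f \<Gamma> \<Delta> \<longleftrightarrow>
     bij_betw f (pverts \<Gamma>) (pverts \<Delta>) \<and>
     (\<forall>u\<in>pverts \<Gamma>. \<forall>v\<in>pverts \<Gamma>. (u, v) \<in> parcs \<Gamma> \<longleftrightarrow> (f u, f v) \<in> parcs \<Delta>)"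

definition graph_isomorphic :: "'a pair_pre_digraph \<Rightarrow> 'b pair_pre_digraph \<Rightarrow> bool" where
  "graph_isomorphic \<Gamma> \<Delta> \<longleftrightarrow> (\<exists>f. graph_isomorphism f \<Gamma> \<Delta>)"

definition graph_image :: "('a \<Rightarrow> 'b) \<Rightarrow> 'a pair_pre_digraph \<Rightarrow> 'b pair_pre_digraph" where
  "graph_image f \<Gamma> = \<lparr> pverts = f ` pverts \<Gamma>, parcs = map_prod f f ` parcs \<Gamma> \<rparr>"

text \<open>Automorphisms are extensional functions, as required by \<^const>\<open>BijGroup\<close>.\<close>

definition aut_group :: "'a pair_pre_digraph \<Rightarrow> ('a \<Rightarrow> 'a) monoid" where
  "aut_group \<Gamma> =
     BijGroup (pverts \<Gamma>) \<lparr>carrier := {f \<in> Bij (pverts \<Gamma>). graph_isomorphism f \<Gamma> \<Gamma>}\<rparr>"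

text \<open>In the next two definitions \<open>G\<close> is meant to be a subgroup of \<open>aut_group \<Gamma>\<close>.\<close>

definition transitive_on_vertices :: "'a pair_pre_digraph \<Rightarrow> ('a \<Rightarrow> 'a) set \<Rightarrow> bool" where
  "transitive_on_vertices \<Gamma> G \<longleftrightarrow>
     transitive_action (aut_group \<Gamma> \<lparr>carrier := G\<rparr>) (pverts \<Gamma>) (\<lambda>g. g)"

definition regular_on_vertices :: "'a pair_pre_digraph \<Rightarrow> ('a \<Rightarrow> 'a) set \<Rightarrow> bool" where
  "regular_on_vertices \<Gamma> G \<longleftrightarrow>
     transitive_on_vertices \<Gamma> G \<and>
     (\<forall>v\<in>pverts \<Gamma>. stabilizer (aut_group \<Gamma> \<lparr>carrier := G\<rparr>) (\<lambda>g. g) v = {\<one>\<^bsub>aut_group \<Gamma>\<^esub>})"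

definition vertex_transitive :: "'a pair_pre_digraph \<Rightarrow> bool" where
  "vertex_transitive \<Gamma> \<longleftrightarrow> transitive_on_vertices \<Gamma> (carrier (aut_group \<Gamma>))"

definition cubic :: "'a pair_pre_digraph \<Rightarrow> bool" where
  "cubic \<Gamma> \<longleftrightarrow> (\<forall>v\<in>pverts \<Gamma>. out_degree (with_proj \<Gamma>) v = 3)"

text \<open>
  The bound \<open>3 \<le> length p\<close> is needed because \<^const>\<open>pre_digraph.cycle\<close> also covers the
  closed walks of length 2 that run along an undirected edge and back.
\<close>

definition girth :: "'a pair_pre_digraph \<Rightarrow> enat" where
  "girth \<Gamma> = (INF p\<in>{p. pre_digraph.cycle (with_proj \<Gamma>) p \<and> 3 \<le> length p}. enat (length p))"

text \<open>
  For \<open>S\<close> closed under inverses and not containing the identity this is the usual undirected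
  simple Cayley graph.
\<close>

definition cayley_graph :: "('g, 'x) monoid_scheme \<Rightarrow> 'g set \<Rightarrow> 'g pair_pre_digraph" where
  "cayley_graph G S =
     \<lparr> pverts = carrier G, parcs = {(g, g \<otimes>\<^bsub>G\<^esub> s) | g s. g \<in> carrier G \<and> s \<in> S} \<rparr>"

definition involution :: "('g, 'x) monoid_scheme \<Rightarrow> 'g \<Rightarrow> bool" where
  "involution G s \<longleftrightarrow> s \<in> carrier G \<and> s \<noteq> \<one>\<^bsub>G\<^esub> \<and> s \<otimes>\<^bsub>G\<^esub> s = \<one>\<^bsub>G\<^esub>"


section \<open>Cycles, prisms, Moebius ladders\<close>

text \<open>\<open>\<int>\<^sub>k\<close> is represented by \<open>{0..<k}\<close>.\<close>

definition circulant :: "int \<Rightarrow> int set \<Rightarrow> int pair_pre_digraph" where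
  "circulant k S =
     \<lparr> pverts = {0..<k},
       parcs = {(x, y). x \<in> {0..<k} \<and> y \<in> {0..<k} \<and> (\<exists>s\<in>S. [y - x = s] (mod k))} \<rparr>"

definition cycle_graph :: "int \<Rightarrow> int pair_pre_digraph" where
  "cycle_graph k = circulant k {1, - 1}"

definition is_cycle_graph :: "'a pair_pre_digraph \<Rightarrow> bool" where
  "is_cycle_graph C \<longleftrightarrow> (\<exists>k\<ge>3. graph_isomorphic C (cycle_graph k))"

definition cartesian_product ::
    "'a pair_pre_digraph \<Rightarrow> 'b pair_pre_digraph \<Rightarrow> ('a \<times> 'b) pair_pre_digraph" where
  "cartesian_product \<Gamma> \<Delta> =
     \<lparr> pverts = pverts \<Gamma> \<times> pverts \<Delta>,
       parcs = {((x, y), (x', y')). x \<in> pverts \<Gamma> \<and> x' \<in> pverts \<Gamma> \<and> y \<in> pverts \<Delta> \<and> y' \<in> pverts \<Delta> \<and>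
                  ((x = x' \<and> (y, y') \<in> parcs \<Delta>) \<or> (y = y' \<and> (x, x') \<in> parcs \<Gamma>))} \<rparr>"

definition K2 :: "bool pair_pre_digraph" where
  "K2 = \<lparr> pverts = UNIV, parcs = {(x, y). x \<noteq> y} \<rparr>"

text \<open>The parameter \<open>m\<close> yields the graphs of order \<open>4 * m\<close>.\<close>

definition prism :: "int \<Rightarrow> (int \<times> bool) pair_pre_digraph" where
  "prism m = cartesian_product (cycle_graph (2 * m)) K2"

definition moebius_ladder :: "int \<Rightarrow> int pair_pre_digraph" where
  "moebius_ladder m = circulant (4 * m) {1, - 1, 2 * m}"


section \<open>2-factors and cycle quotient type\<close>

text \<open>
  A 2-factor is identified with its set of cycles, which are subgraphs (not merely vertex sets).
\<close>

definition two_factor :: "'a pair_pre_digraph \<Rightarrow> 'a pair_pre_digraph set \<Rightarrow> bool" where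
  "two_factor \<Gamma> \<C> \<longleftrightarrow>
     (\<forall>C\<in>\<C>. subgraph (with_proj C) (with_proj \<Gamma>) \<and> is_cycle_graph C) \<and>
     (\<forall>C\<in>\<C>. \<forall>C'\<in>\<C>. C \<noteq> C' \<longrightarrow> pverts C \<inter> pverts C' = {}) \<and>
     (\<Union>C\<in>\<C>. pverts C) = pverts \<Gamma>"

definition one_factor :: "'a pair_pre_digraph \<Rightarrow> 'a rel \<Rightarrow> bool" where
  "one_factor \<Gamma> F \<longleftrightarrow> F \<subseteq> parcs \<Gamma> \<and> sym F \<and> (\<forall>v\<in>pverts \<Gamma>. \<exists>!w. (v, w) \<in> F)"

definition factor_partition :: "'a pair_pre_digraph \<Rightarrow> 'a pair_pre_digraph set \<Rightarrow> bool" where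
  "factor_partition \<Gamma> \<C> \<longleftrightarrow>
     two_factor \<Gamma> \<C> \<and>
     (\<exists>F. one_factor \<Gamma> F \<and> (\<Union>C\<in>\<C>. parcs C) \<union> F = parcs \<Gamma> \<and> (\<Union>C\<in>\<C>. parcs C) \<inter> F = {})"

definition preserves :: "('a \<Rightarrow> 'a) set \<Rightarrow> 'a pair_pre_digraph set \<Rightarrow> bool" where
  "preserves G \<C> \<longleftrightarrow> (\<forall>g\<in>G. bij_betw (graph_image g) \<C> \<C>)"

definition quotient_graph ::
    "'a pair_pre_digraph \<Rightarrow> 'a pair_pre_digraph set \<Rightarrow> 'a pair_pre_digraph pair_pre_digraph" where
  "quotient_graph \<Gamma> \<C> =
     \<lparr> pverts = \<C>,
       parcs = {(C, C'). C \<in> \<C> \<and> C' \<in> \<C> \<and> C \<noteq> C' \<and>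
                  (\<exists>u\<in>pverts C. \<exists>v\<in>pverts C'. (u, v) \<in> parcs \<Gamma>)} \<rparr>"

definition cycle_quotient_type :: "'a pair_pre_digraph \<Rightarrow> 'a pair_pre_digraph set \<Rightarrow> bool" where
  "cycle_quotient_type \<Gamma> \<C> \<longleftrightarrow>
     cubic \<Gamma> \<and> factor_partition \<Gamma> \<C> \<and> 3 \<le> card \<C> \<and> is_cycle_graph (quotient_graph \<Gamma> \<C>)"

text \<open>
  \<open>outside_nbr \<Gamma> \<C> v w\<close> says \<open>w = v\<^sup>*\<close>. If \<open>\<Gamma>\<close> is cubic with 2-factor \<open>\<C>\<close>, there is at most
  one such \<open>w\<close> for each \<open>v\<close>. Its existence for every vertex is enforced by
  \<open>bialternating\<close>, through the existential quantifier over \<open>v'\<close>.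
\<close>

definition outside_nbr ::
    "'a pair_pre_digraph \<Rightarrow> 'a pair_pre_digraph set \<Rightarrow> 'a \<Rightarrow> 'a \<Rightarrow> bool" where
  "outside_nbr \<Gamma> \<C> v w \<longleftrightarrow>
     (v, w) \<in> parcs \<Gamma> \<and> (\<exists>C\<in>\<C>. \<exists>C'\<in>\<C>. C \<noteq> C' \<and> v \<in> pverts C \<and> w \<in> pverts C')"

definition bialternating :: "'a pair_pre_digraph \<Rightarrow> 'a pair_pre_digraph set \<Rightarrow> bool" where
  "bialternating \<Gamma> \<C> \<longleftrightarrow>
     cycle_quotient_type \<Gamma> \<C> \<and>
     (\<forall>C\<in>\<C>. \<forall>v\<in>pverts C.
        \<exists>!w. (v, w) \<in> parcs C \<and>
          (\<exists>v' w'. outside_nbr \<Gamma> \<C> v v' \<and> outside_nbr \<Gamma> \<C> w w' \<and>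
             (\<exists>D\<in>\<C>. v' \<in> pverts D \<and> w' \<in> pverts D)))"


section \<open>The graphs \<open>\<X>\<^sub>b\<close>\<close>

text \<open>
  The vertex \<open>u\<^bsub>i,j\<^esub>\<close>, with indices in \<open>\<int>\<^sub>m\<close> and \<open>\<int>\<^sub>n\<close>, is represented by the pair of
  the least nonnegative residues.
\<close>

definition uv :: "int \<Rightarrow> int \<Rightarrow> int \<Rightarrow> int \<Rightarrow> int \<times> int" where
  "uv m n i j = (i mod m, j mod n)"

definition layered_graph ::
    "int \<Rightarrow> int \<Rightarrow> ((int \<times> int) \<times> (int \<times> int)) set \<Rightarrow> (int \<times> int) pair_pre_digraph" where
  "layered_graph m n R =
     (let E = {(uv m n i j, uv m n i (j + 1)) | i j. True} \<union> R
      in \<lparr> pverts = {0..<m} \<times> {0..<n}, parcs = E \<union> E\<inverse> \<rparr>)"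

definition natural_two_factor ::
    "int \<Rightarrow> int \<Rightarrow> (int \<times> int) pair_pre_digraph \<Rightarrow> (int \<times> int) pair_pre_digraph set" where
  "natural_two_factor m n X =
     (\<lambda>i. let V = {i} \<times> {0..<n} in \<lparr> pverts = V, parcs = parcs X \<inter> V \<times> V \<rparr>) ` {0..<m}"

text \<open>
  The parameters \<open>a\<close>, \<open>b\<close>, \<open>\<ell>\<close> in \<open>\<int>\<^sub>n\<close> are given by their representatives in \<open>{0..<n}\<close>.
\<close>

definition admissible :: "int \<Rightarrow> int \<Rightarrow> int \<Rightarrow> int \<Rightarrow> int \<Rightarrow> bool" where
  "admissible m n a b l \<longleftrightarrow>
     3 \<le> m \<and> a \<in> {0..<n} \<and> b \<in> {0..<n} \<and> l \<in> {0..<n} \<and>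
     (\<exists>n0 a0 b0. 2 \<le> n0 \<and> n = 4 * n0 \<and>
        b = 4 * b0 \<and> 1 \<le> b0 \<and> b0 < n0 \<and> coprime n0 b0 \<and>
        a = 4 * a0 + 1 \<and> 0 \<le> a0 \<and> a0 < n0 \<and>
        [b * b0 = 4] (mod n) \<and> [b * a0 + a = 1] (mod n)) \<and>
     (4 dvd l - 2 \<or> 4 dvd l - 3)"

definition Xb :: "int \<Rightarrow> int \<Rightarrow> int \<Rightarrow> int \<Rightarrow> int \<Rightarrow> (int \<times> int) pair_pre_digraph" where
  "Xb m n a b l =
     (let u = uv m n; n0 = n div 4; \<epsilon> = (if even l then 1 else - 1)
      in layered_graph m n
        ({(u i (2 * i + 4 * j0 + \<delta>), u (i + 1) (2 * i + b * j0 + \<delta> * a)) | i j0 \<delta>.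
            0 \<le> i \<and> i \<le> m - 2 \<and> 0 \<le> j0 \<and> j0 < n0 \<and> \<delta> \<in> {0, 1}} \<union>
         {(u (m - 1) (2 * (m - 1) + 4 * j0 + \<delta>), u 0 (l + \<epsilon> * (b * j0 + \<delta> * a))) | j0 \<delta>.
            0 \<le> j0 \<and> j0 < n0 \<and> \<delta> \<in> {0, 1}}))"

definition Xb1 :: "int \<Rightarrow> (int \<times> int) pair_pre_digraph" where
  "Xb1 m =
     (let u = uv m 8
      in layered_graph m 8
        ({(u i (2 * i + \<delta>), u (i + 1) (2 * i + 4 * \<delta>)) | i \<delta>.
            0 \<le> i \<and> i \<le> m - 2 \<and> \<delta> \<in> {0, 1}} \<union>
         {(u i (2 * i + 4 + \<delta>), u (i + 1) (2 * i + 1 + 4 * \<delta>)) | i \<delta>.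
            0 \<le> i \<and> i \<le> m - 2 \<and> \<delta> \<in> {0, 1}} \<union>
         {(u (m - 1) (2 * (m - 1) + \<delta>), u 0 (6 + 4 * \<delta>)) | \<delta>. \<delta> \<in> {0, 1}} \<union>
         {(u (m - 1) (2 * (m - 1) + 4 + \<delta>), u 0 (7 + 4 * \<delta>)) | \<delta>. \<delta> \<in> {0, 1}}))"

definition Xb2 :: "int \<Rightarrow> (int \<times> int) pair_pre_digraph" where
  "Xb2 m =
     (let u = uv m 8
      in layered_graph m 8
        ({(u i (2 * i + \<delta>), u (i + 1) (2 * i + \<delta>)) | i \<delta>.
            0 \<le> i \<and> i \<le> m - 2 \<and> \<delta> \<in> {0, 1}} \<union>
         {(u i (2 * i + 4 + \<delta>), u (i + 1) (2 * i + 5 - \<delta>)) | i \<delta>.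
            0 \<le> i \<and> i \<le> m - 2 \<and> \<delta> \<in> {0, 1}} \<union>
         {(u (m - 1) (2 * (m - 1) + \<delta>), u 0 (6 + \<delta>)) | \<delta>. \<delta> \<in> {0, 1}} \<union>
         {(u (m - 1) (2 * (m - 1) + 4 + \<delta>), u 0 (3 - \<delta>)) | \<delta>. \<delta> \<in> {0, 1}}))"

text \<open>
  Isomorphism of \<open>(\<Gamma>, \<C>)\<close> with \<open>X\<close> and its natural 2-factor.
\<close>

definition iso_with_factor ::
    "'a pair_pre_digraph \<Rightarrow> 'a pair_pre_digraph set \<Rightarrow>
     int \<Rightarrow> int \<Rightarrow> (int \<times> int) pair_pre_digraph \<Rightarrow> bool" where
  "iso_with_factor \<Gamma> \<C> m n X \<longleftrightarrow>
     (\<exists>f. graph_isomorphism f \<Gamma> X \<and> graph_image f ` \<C> = natural_two_factor m n X)"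

end

theory Submission
  imports Defs
begin

text \<open>
  \<open>Three edge colours.\<close> Let \<open>\<Gamma>\<close> be of bialternating cycle quotient type with respect to \<open>\<C>\<close>.
  The three neighbours of a vertex \<open>v\<close> can be told apart: \<open>out v\<close> is its outside neighbour,
  \<open>mate v\<close> is the neighbour on its cycle whose outside neighbour lies on the same cycle as
  \<open>out v\<close>, and \<open>flip v\<close> is the other neighbour on its cycle. The three maps are involutions,
  and every automorphism that permutes the cycles commutes with them. As \<open>\<Gamma>\<close> is connected, such
  an automorphism is determined by the image of one vertex. Hence a transitive group of such
  automorphisms is regular, and \<open>\<Gamma>\<close> is its Cayley graph with respect to the three elements that
  move a base vertex to its neighbours. These elements are involutions because the three maps are.
  
  \<open>Coordinates.\<close> Going around a cycle means applying \<open>mate\<close> and \<open>flip\<close> alternately. Two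
  involutions generate a dihedral group, so the vertices of a cycle are the elements of a dihedral
  group, written below as integers modulo \<open>n\<close> with the multiplication \<open>\<star>\<close>. The positions whose
  outside neighbours lie on one and the same neighbouring cycle form a subgroup of index two,
  namely the integers congruent to 0 or 1 modulo 4 (\<open>same_type\<close>); in particular 4 divides \<open>n\<close>.
  If a group is transitive, then \<open>out\<close> takes the vertex at position \<open>p\<close> of this subgroup, counted
  from \<open>v\<close>, to the vertex at position \<open>\<pi> p\<close>, counted from \<open>out v\<close>, where \<open>\<pi>\<close> does not depend on
  \<open>v\<close>. Therefore \<open>\<pi>\<close> is an automorphism of the subgroup with \<open>\<pi> (\<pi> p) = p\<close>. Let \<open>y\<close> be the position
  reached after one turn through all \<open>m\<close> cycles. Then \<open>\<Gamma>\<close> is the graph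
  \<open>twisted_graph m n \<pi> y\<close> (theorem \<open>labelling\<close>), and transitivity yields the relations between
  \<open>\<pi>\<close> and \<open>y\<close> collected in the locale \<open>cayley_twist\<close>
  (\<open>homogeneous_system.exists_cayley_twist\<close>). Conversely, these relations are what is needed to
  define automorphisms that move the base vertex to the next cycle, to its mate and to its flip
  (\<open>rotation_aut\<close>, \<open>swap_aut\<close>, \<open>reversal_aut\<close>), and these generate a transitive group.
  
  \<open>Solving the relations.\<close> The multiples of 4 form a cyclic subgroup of order \<open>n0 = n / 4\<close>, the
  rotations; the other elements of type \<open>same_type\<close> are reflections. If \<open>n \<ge> 12\<close>, every
  automorphism preserves the rotations, so that \<open>\<pi> (4 x) = 4 b0 x\<close> and
  \<open>\<pi> (4 x + 1) = 4 (b0 x + a0) + 1\<close>. The relations become congruences modulo \<open>n0\<close> between \<open>b0\<close>,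
  \<open>a0\<close>, \<open>m\<close> and \<open>y\<close>, whose solutions are the three families of parameters of the graphs
  \<open>Xb m n a b l\<close> (\<open>cayley_twist_iff\<close>, \<open>twist_params_cases\<close>). If \<open>n = 8\<close>, the group is Klein's four-group
  and \<open>\<pi>\<close> is the identity or exchanges two of its three involutions. The identity and the exchange
  of 1 and 5 are of the form just described; the exchanges of 1 and 4 and of 4 and 5 give
  \<open>Xb1 m\<close> and \<open>Xb2 m\<close>, and the relations then say \<open>3 dvd m\<close> and fix \<open>y\<close>. If \<open>n = 4\<close>, then \<open>\<pi>\<close> is
  the identity, all relations hold, and \<open>out\<close> and \<open>flip\<close> alternately trace one side of a ladder
  that closes up with or without a twist (\<open>ladder\<close>).
  
  \<open>Girth.\<close> If \<open>\<pi> 1\<close> is odd, as it is for \<open>n \<ge> 12\<close>, then \<open>out\<close>, \<open>mate\<close>, \<open>out\<close>, \<open>mate\<close>, \<open>flip\<close> leads to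
  a position that is a reflection. Doing this twice is a closed walk of length 10 without
  backtracking. If \<open>n \<le> 8\<close>, the cycles of \<open>\<C>\<close> are short enough.
\<close>
section \<open>The infinite dihedral group on the integers\<close>

definition parity_sign :: "int \<Rightarrow> int" where
  "parity_sign k = (if even k then 1 else - 1)"

text \<open>
  The product of the maps \<open>x \<mapsto> k + parity_sign k * x\<close>: even \<open>k\<close> are translations and odd \<open>k\<close> are
  point reflections. Right multiplication by \<open>1\<close> or by \<open>- 1\<close> moves every integer to one of its two
  neighbours, in a way that alternates with the parity. So the positions on an alternately
  coloured path form this group, and colour-preserving maps act on it by left multiplication.
\<close>
definition dih_mult :: "int \<Rightarrow> int \<Rightarrow> int" (infixl \<open>\<star>\<close> 70) where
  "k \<star> p = k + parity_sign k * p"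

definition dih_inv :: "int \<Rightarrow> int" where
  "dih_inv k = - parity_sign k * k"

lemma dih_assoc: "a \<star> b \<star> c = a \<star> (b \<star> c)"
  by (auto simp: dih_mult_def parity_sign_def)

lemma dih_0 [simp]: "0 \<star> a = a" "a \<star> 0 = a"
  by (auto simp: dih_mult_def parity_sign_def)

lemma dih_inv_left [simp]: "dih_inv a \<star> a = 0" "dih_inv a \<star> (a \<star> b) = b"
  by (auto simp: dih_mult_def parity_sign_def dih_inv_def)

lemma dih_inv_right [simp]: "a \<star> dih_inv a = 0" "a \<star> (dih_inv a \<star> b) = b"
  by (auto simp: dih_mult_def parity_sign_def dih_inv_def)

text \<open>
  For even \<open>n\<close> the multiples of \<open>n\<close> are a normal subgroup, so that one may calculate modulo \<open>n\<close>.
\<close>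
lemma dih_mult_cong:
  assumes "even n" "[a = a'] (mod n)" "[b = b'] (mod n)"
  shows "[a \<star> b = a' \<star> b'] (mod n)"
proof -
  have "even a \<longleftrightarrow> even a'"
    using assms(1,2) by (metis cong_dvd_iff cong_dvd_modulus)
  then show ?thesis
    using assms(2,3) by (auto simp: dih_mult_def parity_sign_def cong_add cong_diff)
qed

lemma dih_mult_cancel:
  assumes "[a \<star> b = a \<star> c] (mod n)"
  shows "[b = c] (mod n)"
proof -
  have "n dvd parity_sign a * (b - c)"
    using assms by (simp add: dih_mult_def cong_iff_dvd_diff algebra_simps)
  then have "n dvd b - c"
    by (auto simp: parity_sign_def dvd_diff_commute split: if_splits)
  then show ?thesis by (simp add: cong_iff_dvd_diff)
qed

text \<open>
  Along a bialternating cycle the direction of the outside neighbours has the pattern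
  \<open>+ + - -\<close>. These are the positions with the same direction as position 0, provided that 0 and 1
  are mates. They form a subgroup of index two (\<open>same_type_mult\<close>).
\<close>
definition same_type :: "int \<Rightarrow> bool" where
  "same_type p \<longleftrightarrow> p mod 4 = 0 \<or> p mod 4 = 1"

lemma same_type_0 [simp]: "same_type 0" and same_type_1 [simp]: "same_type 1"
  by (auto simp: same_type_def)

lemma same_type_iff: "same_type p \<longleftrightarrow> 4 dvd p \<or> 4 dvd p - 1"
  unfolding same_type_def by presburger

lemma same_type_cases:
  assumes "same_type p"
  obtains x where "p = 4 * x" | x where "p = 4 * x + 1"
proof -
  consider x where "p = 4 * x" | x where "p - 1 = 4 * x"
    using assms unfolding same_type_iff dvd_def by blast
  then show ?thesis
  proof cases
    case 1
    then show ?thesis by (rule that(1))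
  next
    case (2 x)
    then have "p = 4 * x + 1" by simp
    then show ?thesis by (rule that(2))
  qed
qed

lemma same_type_simps [simp]: "same_type (4 * x)" "same_type (4 * x + 1)" "same_type (1 + 4 * x)"
  by (auto simp: same_type_iff)

lemma same_type_mult:
  assumes "same_type a"
  shows "same_type (a \<star> b) \<longleftrightarrow> same_type b"
proof (cases rule: same_type_cases[OF assms])
  case (1 x)
  then have "a \<star> b = b + x * 4" by (simp add: dih_mult_def parity_sign_def)
  then show ?thesis by (simp add: same_type_def)
next
  case (2 x)
  then have "a \<star> b = (1 - b) + x * 4" by (simp add: dih_mult_def parity_sign_def)
  moreover have "same_type (1 - b) \<longleftrightarrow> same_type b" unfolding same_type_def by presburger
  ultimately show ?thesis by (simp add: same_type_def)
qed

lemma same_type_inv: "same_type a \<Longrightarrow> same_type (dih_inv a)"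
  using same_type_mult[of a "dih_inv a"] by simp

lemma same_type_conj2:
  assumes "same_type a"
  shows "same_type (- 2 \<star> a \<star> 2)"
proof (cases rule: same_type_cases[OF assms])
  case (1 x)
  then have "- 2 \<star> a \<star> 2 = 4 * x" by (simp add: dih_mult_def parity_sign_def)
  then show ?thesis by simp
next
  case (2 x)
  then have "- 2 \<star> a \<star> 2 = 4 * (x - 1) + 1" by (simp add: dih_mult_def parity_sign_def)
  then show ?thesis by (simp only: same_type_simps)
qed

lemma same_type_reflect:
  assumes "same_type a"
  shows "same_type (- 1 \<star> a \<star> 2)"
proof (cases rule: same_type_cases[OF assms])
  case (1 x)
  then have "- 1 \<star> a \<star> 2 = 4 * (- 1 - x) + 1" by (simp add: dih_mult_def parity_sign_def)
  then show ?thesis by (simp only: same_type_simps)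
next
  case (2 x)
  then have "- 1 \<star> a \<star> 2 = 4 * (- x)" by (simp add: dih_mult_def parity_sign_def)
  then show ?thesis by (simp only: same_type_simps)
qed

section \<open>Automorphisms that permute a set of cycles\<close>

text \<open>
  The largest subgroup of the automorphism group that permutes \<open>\<C>\<close>.
\<close>
definition factor_auts ::
    "'a pair_pre_digraph \<Rightarrow> 'a pair_pre_digraph set \<Rightarrow> ('a \<Rightarrow> 'a) set" where
  "factor_auts \<Gamma> \<C> = {g \<in> carrier (aut_group \<Gamma>). bij_betw (graph_image g) \<C> \<C>}"

lemma carrier_aut_group: "carrier (aut_group \<Gamma>) = {f \<in> Bij (pverts \<Gamma>). graph_isomorphism f \<Gamma> \<Gamma>}"
  by (simp add: aut_group_def)

lemma one_aut_group: "\<one>\<^bsub>aut_group \<Gamma>\<^esub> = (\<lambda>x\<in>pverts \<Gamma>. x)"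
  by (simp add: aut_group_def BijGroup_def)

lemma mult_aut_group:
  "f \<in> Bij (pverts \<Gamma>) \<Longrightarrow> g \<in> Bij (pverts \<Gamma>) \<Longrightarrow> f \<otimes>\<^bsub>aut_group \<Gamma>\<^esub> g = compose (pverts \<Gamma>) f g"
  by (simp add: aut_group_def BijGroup_def)

lemma graph_isomorphism_compose:
  assumes "graph_isomorphism f \<Gamma> \<Delta>" "graph_isomorphism g \<Delta> \<Lambda>"
  shows "graph_isomorphism (\<lambda>x. g (f x)) \<Gamma> \<Lambda>"
proof -
  have "f v \<in> pverts \<Delta>" if "v \<in> pverts \<Gamma>" for v
    using assms(1) that by (auto simp: graph_isomorphism_def bij_betw_def)
  moreover have "bij_betw (g \<circ> f) (pverts \<Gamma>) (pverts \<Lambda>)"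
    using assms by (auto simp: graph_isomorphism_def intro: bij_betw_trans)
  ultimately show ?thesis using assms by (simp add: graph_isomorphism_def comp_def)
qed

lemma graph_isomorphism_inv:
  assumes "graph_isomorphism f \<Gamma> \<Delta>"
  shows "graph_isomorphism (inv_into (pverts \<Gamma>) f) \<Delta> \<Gamma>"
proof -
  have b: "bij_betw f (pverts \<Gamma>) (pverts \<Delta>)" using assms by (simp add: graph_isomorphism_def)
  have 1: "inv_into (pverts \<Gamma>) f v \<in> pverts \<Gamma>" "f (inv_into (pverts \<Gamma>) f v) = v"
    if "v \<in> pverts \<Delta>" for v
    using b that by (auto simp: bij_betw_def inv_into_into f_inv_into_f)
  show ?thesis
    using assms 1 bij_betw_inv_into[OF b] by (simp add: graph_isomorphism_def)
qed

lemma graph_isomorphism_cong: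
  assumes "\<And>v. v \<in> pverts \<Gamma> \<Longrightarrow> f v = g v"
  shows "graph_isomorphism f \<Gamma> \<Delta> \<longleftrightarrow> graph_isomorphism g \<Gamma> \<Delta>"
  unfolding graph_isomorphism_def using bij_betw_cong[of "pverts \<Gamma>" f g "pverts \<Delta>"] assms by simp

text \<open>
  Elements of \<open>aut_group \<Gamma>\<close> are extensional. Under this condition the image of a member of \<open>\<C>\<close>
  depends only on the values at vertices of \<open>\<Gamma>\<close>, so that a map may be replaced by its restriction.
\<close>
definition inner_subgraphs :: "'a pair_pre_digraph \<Rightarrow> 'a pair_pre_digraph set \<Rightarrow> bool" where
  "inner_subgraphs \<Gamma> \<C> \<longleftrightarrow>
     (\<forall>C\<in>\<C>. pverts C \<subseteq> pverts \<Gamma> \<and> parcs C \<subseteq> pverts \<Gamma> \<times> pverts \<Gamma>)"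

lemma graph_image_cong:
  assumes "inner_subgraphs \<Gamma> \<C>" "C \<in> \<C>" "\<And>v. v \<in> pverts \<Gamma> \<Longrightarrow> f v = g v"
  shows "graph_image f C = graph_image g C"
proof -
  have sub: "pverts C \<subseteq> pverts \<Gamma>" "parcs C \<subseteq> pverts \<Gamma> \<times> pverts \<Gamma>"
    using assms(1,2) by (auto simp: inner_subgraphs_def)
  have "f ` pverts C = g ` pverts C"
    using assms(3) sub(1) by (intro image_cong) auto
  moreover have "map_prod f f ` parcs C = map_prod g g ` parcs C"
    using assms(3) sub(2) by (intro image_cong) auto
  ultimately show ?thesis by (simp add: graph_image_def)
qed

lemma graph_image_comp: "graph_image g (graph_image f C) = graph_image (\<lambda>x. g (f x)) C"
  by (simp add: graph_image_def image_image map_prod_def case_prod_unfold)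

lemma graph_image_id: "graph_image (\<lambda>x. x) C = C"
  by (simp add: graph_image_def map_prod_def)

lemma bij_betw_graph_image_cong:
  assumes "inner_subgraphs \<Gamma> \<C>" "\<And>v. v \<in> pverts \<Gamma> \<Longrightarrow> f v = g v"
  shows "bij_betw (graph_image f) \<C> \<D> \<longleftrightarrow> bij_betw (graph_image g) \<C> \<D>"
  by (rule bij_betw_cong) (rule graph_image_cong[OF assms(1) _ assms(2)])

lemma factor_autsI:
  assumes "inner_subgraphs \<Gamma> \<C>" "graph_isomorphism f \<Gamma> \<Gamma>" "bij_betw (graph_image f) \<C> \<C>"
  shows "restrict f (pverts \<Gamma>) \<in> factor_auts \<Gamma> \<C>"
proof -
  have "graph_isomorphism (restrict f (pverts \<Gamma>)) \<Gamma> \<Gamma>"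
    using assms(2) graph_isomorphism_cong[of \<Gamma> "restrict f (pverts \<Gamma>)" f \<Gamma>] by simp
  moreover have "bij_betw (graph_image (restrict f (pverts \<Gamma>))) \<C> \<C>"
    using assms(3) bij_betw_graph_image_cong[OF assms(1), of "restrict f (pverts \<Gamma>)" f] by simp
  moreover have "restrict f (pverts \<Gamma>) \<in> Bij (pverts \<Gamma>)"
    using calculation(1) by (simp add: Bij_def graph_isomorphism_def)
  ultimately show ?thesis by (simp add: factor_auts_def carrier_aut_group)
qed

lemma graph_image_inv:
  assumes "inner_subgraphs \<Gamma> \<C>" "bij_betw f (pverts \<Gamma>) V" "bij_betw (graph_image f) \<C> \<D>"
  shows "bij_betw (graph_image (inv_into (pverts \<Gamma>) f)) \<D> \<C>"
proof -
  let ?g = "inv_into (pverts \<Gamma>) f"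
  have 1: "graph_image ?g (graph_image f C) = C" if "C \<in> \<C>" for C
  proof -
    have "graph_image (\<lambda>x. ?g (f x)) C = graph_image (\<lambda>x. x) C"
      using assms(2) by (intro graph_image_cong[OF assms(1) that]) (auto simp: bij_betw_def)
    then show ?thesis by (simp add: graph_image_comp graph_image_id)
  qed
  have im: "graph_image f ` \<C> = \<D>" using assms(3) by (simp add: bij_betw_def)
  show ?thesis
  proof (rule bij_betw_imageI)
    show "inj_on (graph_image ?g) \<D>"
      unfolding im[symmetric] by (rule inj_on_inverseI[where g = "graph_image f"]) (use 1 in auto)
    show "graph_image ?g ` \<D> = \<C>"
      unfolding im[symmetric] using 1 by (auto simp: image_image)
  qed
qed

lemma factor_auts_comp:
  assumes "inner_subgraphs \<Gamma> \<C>" "f \<in> factor_auts \<Gamma> \<C>" "g \<in> factor_auts \<Gamma> \<C>"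
  shows "compose (pverts \<Gamma>) g f \<in> factor_auts \<Gamma> \<C>"
proof -
  have "bij_betw (graph_image (\<lambda>x. g (f x))) \<C> \<C>"
    using assms bij_betw_trans[of "graph_image f" \<C> \<C> "graph_image g" \<C>]
    by (simp add: factor_auts_def graph_image_comp comp_def)
  moreover have "graph_isomorphism (\<lambda>x. g (f x)) \<Gamma> \<Gamma>"
    using assms(2,3) by (intro graph_isomorphism_compose[of f \<Gamma> \<Gamma> g])
        (simp_all add: factor_auts_def carrier_aut_group)
  ultimately show ?thesis
    unfolding compose_def by (intro factor_autsI[OF assms(1)])
qed

lemma factor_auts_inv:
  assumes "inner_subgraphs \<Gamma> \<C>" "f \<in> factor_auts \<Gamma> \<C>"
  shows "restrict (inv_into (pverts \<Gamma>) f) (pverts \<Gamma>) \<in> factor_auts \<Gamma> \<C>"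
  using assms
  by (intro factor_autsI graph_isomorphism_inv graph_image_inv[where V="pverts \<Gamma>"])
     (auto simp: factor_auts_def carrier_aut_group Bij_def)

lemma subgroup_factor_auts:
  assumes "inner_subgraphs \<Gamma> \<C>"
  shows "subgroup (factor_auts \<Gamma> \<C>) (BijGroup (pverts \<Gamma>))"
proof (rule subgroup.intro)
  have B: "f \<in> Bij (pverts \<Gamma>)" if "f \<in> factor_auts \<Gamma> \<C>" for f
    using that by (simp add: factor_auts_def carrier_aut_group)
  then show "factor_auts \<Gamma> \<C> \<subseteq> carrier (BijGroup (pverts \<Gamma>))" by (auto simp: BijGroup_def)
  show "x \<otimes>\<^bsub>BijGroup (pverts \<Gamma>)\<^esub> y \<in> factor_auts \<Gamma> \<C>"
    if "x \<in> factor_auts \<Gamma> \<C>" "y \<in> factor_auts \<Gamma> \<C>" for x y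
    using factor_auts_comp[OF assms that(2,1)] B that by (simp add: BijGroup_def)
  have "(\<lambda>x\<in>pverts \<Gamma>. x) \<in> factor_auts \<Gamma> \<C>"
  proof (rule factor_autsI[OF assms])
    show "bij_betw (graph_image (\<lambda>x. x)) \<C> \<C>"
      by (simp add: graph_image_id bij_betw_def inj_on_def)
    show "graph_isomorphism (\<lambda>x. x) \<Gamma> \<Gamma>"
      by (simp add: graph_isomorphism_def bij_betw_def)
  qed
  then show "\<one>\<^bsub>BijGroup (pverts \<Gamma>)\<^esub> \<in> factor_auts \<Gamma> \<C>" by (simp add: BijGroup_def)
  show "inv\<^bsub>BijGroup (pverts \<Gamma>)\<^esub> x \<in> factor_auts \<Gamma> \<C>" if "x \<in> factor_auts \<Gamma> \<C>" for x
    using factor_auts_inv[OF assms that] B[OF that] by (simp add: inv_BijGroup)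
qed

text \<open>
  With no cycles to permute, \<open>factor_auts \<Gamma> {}\<close> is the whole automorphism group.
\<close>
lemma group_aut_group: "group (aut_group \<Gamma>)"
proof -
  have "factor_auts \<Gamma> {} = carrier (aut_group \<Gamma>)" by (simp add: factor_auts_def bij_betw_def)
  then have "subgroup (carrier (aut_group \<Gamma>)) (BijGroup (pverts \<Gamma>))"
    using subgroup_factor_auts[of \<Gamma> "{}"] by (simp add: inner_subgraphs_def)
  from subgroup.subgroup_is_group[OF this group_BijGroup]
  show ?thesis by (simp add: aut_group_def)
qed

lemma aut_group_carrier_update:
  "aut_group \<Gamma>\<lparr>carrier := G\<rparr> = BijGroup (pverts \<Gamma>)\<lparr>carrier := G\<rparr>"
  by (simp add: aut_group_def)

lemma transitive_on_verticesD:
  assumes "transitive_on_vertices \<Gamma> G" "u \<in> pverts \<Gamma>" "v \<in> pverts \<Gamma>"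
  shows "\<exists>g\<in>G. g u = v"
  using transitive_action.unique_orbit[OF assms(1)[unfolded transitive_on_vertices_def] assms(2,3)]
  by simp

text \<open>
  The classification only has to decide whether this largest cycle-permuting group is transitive.
\<close>

lemma factor_auts_group:
  assumes inn: "inner_subgraphs \<Gamma> \<C>"
    and tr: "\<And>u v. u \<in> pverts \<Gamma> \<Longrightarrow> v \<in> pverts \<Gamma> \<Longrightarrow> \<exists>g\<in>factor_auts \<Gamma> \<C>. g u = v"
  shows "subgroup (factor_auts \<Gamma> \<C>) (aut_group \<Gamma>) \<and>
    transitive_on_vertices \<Gamma> (factor_auts \<Gamma> \<C>) \<and> preserves (factor_auts \<Gamma> \<C>) \<C>"
proof (intro conjI)
  let ?B = "BijGroup (pverts \<Gamma>)" and ?G = "factor_auts \<Gamma> \<C>"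
  have sub: "subgroup ?G ?B" using subgroup_factor_auts[OF inn] .
  have le: "?G \<subseteq> carrier (aut_group \<Gamma>)" by (auto simp: factor_auts_def)
  have cs: "subgroup (carrier (aut_group \<Gamma>)) ?B"
    using subgroup_factor_auts[of \<Gamma> "{}"] by (simp add: inner_subgraphs_def factor_auts_def bij_betw_def)
  show "subgroup ?G (aut_group \<Gamma>)"
    using group.subgroup_incl[OF group_BijGroup sub cs le] by (simp add: aut_group_def)
  have "group (?B\<lparr>carrier := ?G\<rparr>)" by (rule subgroup.subgroup_is_group[OF sub group_BijGroup])
  moreover have "(\<lambda>g. g) \<in> hom (?B\<lparr>carrier := ?G\<rparr>) ?B"
    using sub by (auto simp: hom_def dest: subgroup.mem_carrier)
  ultimately have "group_action (?B\<lparr>carrier := ?G\<rparr>) (pverts \<Gamma>) (\<lambda>g. g)"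
    by (simp add: group_action_def group_hom_def group_hom_axioms_def group_BijGroup)
  then show "transitive_on_vertices \<Gamma> ?G"
    unfolding transitive_on_vertices_def aut_group_carrier_update
    using tr by (simp add: transitive_action_def transitive_action_axioms_def)
  show "preserves ?G \<C>" by (simp add: preserves_def factor_auts_def)
qed

text \<open>
  Conjugation with an isomorphism that matches the two sets of cycles: transitivity may be
  checked on a model of \<open>(\<Gamma>, \<C>)\<close>.
\<close>
lemma factor_auts_transport:
  assumes inn: "inner_subgraphs \<Gamma> \<C>"
    and iso: "graph_isomorphism f \<Gamma> X" and im: "graph_image f ` \<C> = \<D>"
    and tr: "\<And>u v. u \<in> pverts X \<Longrightarrow> v \<in> pverts X \<Longrightarrow> \<exists>g\<in>factor_auts X \<D>. g u = v"
    and uv: "u \<in> pverts \<Gamma>" "v \<in> pverts \<Gamma>"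
  shows "\<exists>g\<in>factor_auts \<Gamma> \<C>. g u = v"
proof -
  let ?V = "pverts \<Gamma>"
  let ?h = "inv_into ?V f"
  have b: "bij_betw f ?V (pverts X)" using iso by (simp add: graph_isomorphism_def)
  have "f u \<in> pverts X" "f v \<in> pverts X" using b uv by (auto simp: bij_betw_def)
  then obtain g where g: "g \<in> factor_auts X \<D>" "g (f u) = f v" using tr by blast
  have hf: "?h (f x) = x" if "x \<in> ?V" for x using b that by (simp add: bij_betw_def)
  have inj: "inj_on (graph_image f) \<C>"
  proof (rule inj_on_inverseI[where g = "graph_image ?h"])
    fix C assume "C \<in> \<C>"
    then have "graph_image (\<lambda>x. ?h (f x)) C = graph_image (\<lambda>x. x) C"
      using hf by (intro graph_image_cong[OF inn]) auto
    then show "graph_image ?h (graph_image f C) = C" by (simp add: graph_image_comp graph_image_id)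
  qed
  have bC: "bij_betw (graph_image f) \<C> \<D>" using inj im by (simp add: bij_betw_def)
  have g': "graph_isomorphism g X X" "bij_betw (graph_image g) \<D> \<D>"
    using g by (auto simp: factor_auts_def carrier_aut_group)
  have 1: "graph_isomorphism (\<lambda>x. ?h (g (f x))) \<Gamma> \<Gamma>"
    by (rule graph_isomorphism_compose[OF graph_isomorphism_compose[OF iso g'(1)]
          graph_isomorphism_inv[OF iso]])
  have 2: "bij_betw (graph_image (\<lambda>x. ?h (g (f x)))) \<C> \<C>"
    using bij_betw_trans[OF bij_betw_trans[OF bC g'(2)] graph_image_inv[OF inn b bC]]
    by (simp add: comp_def graph_image_comp)
  have "restrict (\<lambda>x. ?h (g (f x))) ?V \<in> factor_auts \<Gamma> \<C>" by (rule factor_autsI[OF inn 1 2])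
  moreover have "restrict (\<lambda>x. ?h (g (f x))) ?V u = v" using uv g(2) hf by simp
  ultimately show ?thesis by blast
qed

section \<open>Twisted layered graphs\<close>

text \<open>
  The vertex at position \<open>p\<close> of layer \<open>i\<close>. Positions are counted from \<open>2 * i\<close>, since a step to the
  next layer moves the base point forward by two. The value \<open>i = m\<close> stands for layer 0 after a
  full turn, where the base point is the vertex at position \<open>y\<close> of layer 0; with it, the step from
  layer \<open>i\<close> to layer \<open>i + 1\<close> has the same form for all \<open>i < m\<close>.
\<close>
definition layer_pos :: "int \<Rightarrow> int \<Rightarrow> int \<Rightarrow> int \<Rightarrow> int \<Rightarrow> int \<times> int" where
  "layer_pos m n y i p = (if i < m then (i, (2 * i + p) mod n) else (0, (y \<star> p) mod n))"

text \<open>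
  The base point of the next layer is reached from that of the present one by \<open>out\<close>, \<open>mate\<close>,
  \<open>flip\<close>. The last two steps are a translation by \<open>1 \<star> - 1 = 2\<close>, so that position \<open>k\<close> counted from
  the outside neighbour of the base point is position \<open>- 2 \<star> k\<close> counted from the next base point.
\<close>
definition twisted_graph :: "int \<Rightarrow> int \<Rightarrow> (int \<Rightarrow> int) \<Rightarrow> int \<Rightarrow> (int \<times> int) pair_pre_digraph" where
  "twisted_graph m n \<pi> y =
     (let u = layer_pos m n y;
          E = {(u i p, u i (p + 1)) | i p. 0 \<le> i \<and> i < m} \<union>
              {(u i p, u (i + 1) (- 2 \<star> \<pi> p)) | i p. 0 \<le> i \<and> i < m \<and> same_type p}
      in \<lparr> pverts = {0..<m} \<times> {0..<n}, parcs = E \<union> E\<inverse> \<rparr>)"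

text \<open>
  The effect on positions of stepping to the next layer by \<open>out\<close>, \<open>mate\<close>, \<open>flip\<close>: the vertex at
  a position \<open>p\<close> of type \<open>same_type\<close> goes to position \<open>conj_twist \<pi> p\<close> of the next layer, both counted from the base points.
\<close>
definition conj_twist :: "(int \<Rightarrow> int) \<Rightarrow> int \<Rightarrow> int" where
  "conj_twist \<pi> p = - 2 \<star> \<pi> p \<star> 2"

text \<open>
  The flip of a base point has its outside neighbour in the previous layer, so that the step
  \<open>out\<close>, \<open>mate\<close>, \<open>flip\<close> leads backwards from there. After \<open>i\<close> steps forwards, one \<open>flip\<close>, and \<open>i\<close> further steps, one is back in the layer of the
  start, at position \<open>- 1 \<star> reversal_shift \<pi> i\<close>.
\<close>
fun reversal_shift :: "(int \<Rightarrow> int) \<Rightarrow> nat \<Rightarrow> int" where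
  "reversal_shift \<pi> 0 = 0"
| "reversal_shift \<pi> (Suc i) = - 1 \<star> \<pi> 1 \<star> 2 \<star> conj_twist \<pi> (reversal_shift \<pi> i)"

text \<open>
  An automorphism of order at most two of the dihedral group of the positions of type
  \<open>same_type\<close> modulo \<open>n\<close>. In a regular group of colour-preserving automorphisms it is the
  conjugation with the element that moves the base vertex across its 1-factor edge.
\<close>
locale dihedral_involution =
  fixes n :: int and \<pi> :: "int \<Rightarrow> int"
  assumes n_pos: "0 < n" and n_dvd: "4 dvd n"
    and pi_cong: "[p = p'] (mod n) \<Longrightarrow> [\<pi> p = \<pi> p'] (mod n)"
    and pi_type: "same_type p \<Longrightarrow> same_type (\<pi> p)"
    and pi_hom: "same_type k \<Longrightarrow> same_type p \<Longrightarrow> [\<pi> (k \<star> p) = \<pi> k \<star> \<pi> p] (mod n)"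
    and pi_pi: "same_type p \<Longrightarrow> [\<pi> (\<pi> p) = p] (mod n)"

text \<open>
  A walk from the base point that steps \<open>m\<close> times to the next layer returns to layer 0 at position
  \<open>y\<close>. The relations say that the same walk ends at position \<open>y\<close> relative to its start if it is
  started from the base point of layer 1, from the mate, or from the flip of the base point. For the
  flip, the walk runs backwards, and its end is compared by means of \<open>reversal_shift\<close>.
\<close>
locale cayley_twist = dihedral_involution n \<pi> for n \<pi> +
  fixes m y :: int
  assumes m_pos: "0 < m"
    and y_type: "same_type y"
    and y_fixed: "[conj_twist \<pi> y = y] (mod n)"
    and y_conj: "[y \<star> ((conj_twist \<pi> ^^ nat m) 1) = 1 \<star> y] (mod n)"
    and y_reversal: "[y \<star> - 1 \<star> y = - 1 \<star> reversal_shift \<pi> (nat m)] (mod n)"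

context dihedral_involution
begin

lemma n_even: "even n" using n_dvd by auto

lemmas mult_cong = dih_mult_cong[OF n_even]

lemma pi_zero: "[\<pi> 0 = 0] (mod n)"
  using pi_hom[of 0 0] dih_mult_cancel[of "\<pi> 0" "\<pi> 0" 0 n] by (simp add: cong_sym_eq)

lemma conj_twist_type: "same_type p \<Longrightarrow> same_type (conj_twist \<pi> p)"
  using pi_type same_type_conj2 by (simp add: conj_twist_def)

lemma conj_twist_shift: "conj_twist \<pi> p \<star> - 2 = - 2 \<star> \<pi> p"
  by (simp add: conj_twist_def dih_assoc) (simp add: dih_mult_def parity_sign_def)

lemma conj_twist_cong: "[p = p'] (mod n) \<Longrightarrow> [conj_twist \<pi> p = conj_twist \<pi> p'] (mod n)"
  unfolding conj_twist_def by (intro mult_cong pi_cong cong_refl)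

lemma two_cancel: "2 \<star> (- 2 \<star> a) = a" "- 2 \<star> (2 \<star> a) = a"
  by (auto simp: dih_mult_def parity_sign_def)

lemma conj_twist_hom:
  assumes "same_type k" "same_type p"
  shows "[conj_twist \<pi> (k \<star> p) = conj_twist \<pi> k \<star> conj_twist \<pi> p] (mod n)"
proof -
  have "[- 2 \<star> \<pi> (k \<star> p) \<star> 2 = - 2 \<star> (\<pi> k \<star> \<pi> p) \<star> 2] (mod n)"
    by (intro mult_cong pi_hom assms cong_refl)
  then show ?thesis by (simp add: conj_twist_def dih_assoc two_cancel)
qed

lemma conj_twist_pi:
  assumes "same_type p"
  shows "[conj_twist \<pi> (\<pi> p) = - 2 \<star> p \<star> 2] (mod n)"
  unfolding conj_twist_def by (intro mult_cong pi_pi assms cong_refl)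

lemma reversal_shift_type: "same_type (reversal_shift \<pi> j)"
  by (induction j) (auto simp: same_type_mult[OF same_type_reflect[OF pi_type]] conj_twist_type)

end

subsection \<open>Maps acting on every layer by a left translation\<close>

lemma natural_two_factor_inner:
  assumes "pverts X = {0..<m} \<times> {0..<n}"
  shows "inner_subgraphs X (natural_two_factor m n X)"
  using assms by (auto simp: inner_subgraphs_def natural_two_factor_def Let_def)

lemma layer_preserving_iso_factor:
  assumes V: "pverts X = {0..<m} \<times> {0..<n}" and n: "0 < n"
    and iso: "graph_isomorphism F X X"
    and lay: "\<And>i j. (i, j) \<in> pverts X \<Longrightarrow> fst (F (i, j)) = \<phi> i"
  shows "bij_betw (graph_image F) (natural_two_factor m n X) (natural_two_factor m n X)"
proof -
  let ?C = "\<lambda>i. \<lparr> pverts = {i} \<times> {0..<n}, parcs = parcs X \<inter> ({i} \<times> {0..<n}) \<times> ({i} \<times> {0..<n}) \<rparr>"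
  let ?N = "natural_two_factor m n X"
  have N: "?N = ?C ` {0..<m}" by (simp add: natural_two_factor_def Let_def)
  have bij: "bij_betw F (pverts X) (pverts X)"
    and arc: "\<And>u v. u \<in> pverts X \<Longrightarrow> v \<in> pverts X \<Longrightarrow> (u, v) \<in> parcs X \<longleftrightarrow> (F u, F v) \<in> parcs X"
    using iso by (auto simp: graph_isomorphism_def)
  have inj: "inj_on F (pverts X)" using bij by (simp add: bij_betw_def)
  have FV: "F u \<in> pverts X" if "u \<in> pverts X" for u using bij that by (auto simp: bij_betw_def)
  have phi: "\<phi> i \<in> {0..<m}" and im: "F ` ({i} \<times> {0..<n}) = {\<phi> i} \<times> {0..<n}" if i: "i \<in> {0..<m}" for i
  proof -
    have sub: "{i} \<times> {0..<n} \<subseteq> pverts X" using i V by auto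
    have 1: "F (i, j) \<in> {\<phi> i} \<times> {0..<n} \<and> \<phi> i \<in> {0..<m}" if j: "j \<in> {0..<n}" for j
    proof -
      have ij: "(i, j) \<in> pverts X" using i j V by auto
      have "F (i, j) \<in> {0..<m} \<times> {0..<n}" using FV[OF ij] V by simp
      then show ?thesis using lay[OF ij] by (cases "F (i, j)") auto
    qed
    show "\<phi> i \<in> {0..<m}" using 1[of 0] n by simp
    have "F ` ({i} \<times> {0..<n}) \<subseteq> {\<phi> i} \<times> {0..<n}"
    proof
      fix b assume "b \<in> F ` ({i} \<times> {0..<n})"
      then obtain j where "j \<in> {0..<n}" "b = F (i, j)" by blast
      then show "b \<in> {\<phi> i} \<times> {0..<n}" using 1 by blast
    qed
    moreover have "card (F ` ({i} \<times> {0..<n})) = card ({\<phi> i} \<times> {0..<n})"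
      using card_image[OF inj_on_subset[OF inj sub]] by simp
    ultimately show "F ` ({i} \<times> {0..<n}) = {\<phi> i} \<times> {0..<n}"
      by (intro card_subset_eq) auto
  qed
  have img: "graph_image F (?C i) = ?C (\<phi> i)" if i: "i \<in> {0..<m}" for i
  proof -
    have sub: "{i} \<times> {0..<n} \<subseteq> pverts X" using i V by auto
    have "map_prod F F ` (parcs X \<inter> ({i} \<times> {0..<n}) \<times> ({i} \<times> {0..<n})) =
        parcs X \<inter> ({\<phi> i} \<times> {0..<n}) \<times> ({\<phi> i} \<times> {0..<n})" (is "?A = ?B")
    proof
      show "?A \<subseteq> ?B"
      proof
        fix e assume "e \<in> ?A"
        then obtain u v where uv: "e = (F u, F v)" "(u, v) \<in> parcs X"
          "u \<in> {i} \<times> {0..<n}" "v \<in> {i} \<times> {0..<n}" by auto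
        then have "(F u, F v) \<in> parcs X" using arc sub by blast
        moreover have "F u \<in> {\<phi> i} \<times> {0..<n}" "F v \<in> {\<phi> i} \<times> {0..<n}"
          unfolding im[OF i, symmetric] using imageI[OF uv(3), of F] imageI[OF uv(4), of F] by auto
        ultimately show "e \<in> ?B" unfolding uv(1) by (intro IntI SigmaI)
      qed
      show "?B \<subseteq> ?A"
      proof
        fix e assume e: "e \<in> ?B"
        then obtain a b where ab: "e = (a, b)" "(a, b) \<in> parcs X" "a \<in> F ` ({i} \<times> {0..<n})"
          "b \<in> F ` ({i} \<times> {0..<n})" unfolding im[OF i] by (cases e) blast
        then obtain u v where uv: "a = F u" "b = F v" "u \<in> {i} \<times> {0..<n}" "v \<in> {i} \<times> {0..<n}" by blast
        then have "(u, v) \<in> parcs X" using arc[of u v] ab(2) sub by blast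
        then show "e \<in> ?A" using uv ab(1) by (auto intro!: image_eqI[of _ _ "(u, v)"])
      qed
    qed
    then show ?thesis by (simp add: graph_image_def im[OF i])
  qed
  have "graph_image F ` ?N \<subseteq> ?N" using img phi by (auto simp: N)
  moreover have "inj_on (graph_image F) ?N"
  proof (rule inj_onI)
    fix A B assume "A \<in> ?N" "B \<in> ?N" and eq: "graph_image F A = graph_image F B"
    then obtain i j where ij: "A = ?C i" "B = ?C j" "i \<in> {0..<m}" "j \<in> {0..<m}" by (auto simp: N)
    then have "F ` ({i} \<times> {0..<n}) = F ` ({j} \<times> {0..<n})" using eq by (simp add: graph_image_def)
    moreover have sub: "{i} \<times> {0..<n} \<subseteq> pverts X" "{j} \<times> {0..<n} \<subseteq> pverts X"
      using ij(3,4) V by auto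
    ultimately have "{i} \<times> {0..<n} = {j} \<times> {0..<n}"
      using inj_on_image_eq_iff[OF inj sub] by simp
    then have "i = j" using n by (auto simp: times_eq_iff)
    then show "A = B" using ij by simp
  qed
  moreover have "finite ?N" by (simp add: N)
  ultimately show ?thesis by (simp add: bij_betw_def endo_inj_surj)
qed

text \<open>
  On a finite graph a surjection of the vertices is injective; if it maps arcs to arcs, it is
  injective on these as well, hence onto.
\<close>
lemma finite_graph_bijection_iso:
  assumes fin: "finite (pverts X)" and wf: "parcs X \<subseteq> pverts X \<times> pverts X"
    and surj: "F ` pverts X = pverts X"
    and arc: "\<And>u v. (u, v) \<in> parcs X \<Longrightarrow> (F u, F v) \<in> parcs X"
  shows "graph_isomorphism F X X"
proof -
  have inj: "inj_on F (pverts X)" using fin surj by (intro eq_card_imp_inj_on) auto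
  have injA: "inj_on (map_prod F F) (parcs X)"
    by (rule inj_on_subset[OF map_prod_inj_on[OF inj inj] wf])
  have finA: "finite (parcs X)" using finite_subset[OF wf] fin by simp
  have "map_prod F F ` parcs X \<subseteq> parcs X" using arc by auto
  then have imA: "map_prod F F ` parcs X = parcs X" using injA finA by (simp add: endo_inj_surj)
  have "(u, v) \<in> parcs X" if uv: "u \<in> pverts X" "v \<in> pverts X" "(F u, F v) \<in> parcs X" for u v
  proof -
    have "(F u, F v) \<in> map_prod F F ` parcs X" using uv(3) imA by simp
    then obtain a b where "(a, b) \<in> parcs X" "F u = F a" "F v = F b" by auto
    then show ?thesis using inj uv(1,2) wf by (metis inj_onD mem_Sigma_iff subsetD)
  qed
  then show ?thesis using inj surj arc by (auto simp: graph_isomorphism_def bij_betw_def)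
qed

context cayley_twist
begin

abbreviation "u \<equiv> layer_pos m n y"
abbreviation "X \<equiv> twisted_graph m n \<pi> y"

lemma pverts_X: "pverts X = {0..<m} \<times> {0..<n}"
  by (simp add: twisted_graph_def Let_def)

lemma u_cong: "[p = p'] (mod n) \<Longrightarrow> u i p = u i p'"
  using mult_cong[of y y p p'] cong_add[of "2 * i" "2 * i" n p p']
  by (auto simp: layer_pos_def cong_def)

lemma u_wrap: "u m p = u 0 (y \<star> p)"
  using m_pos by (simp add: layer_pos_def)

lemma u_mem: "0 \<le> i \<Longrightarrow> i \<le> m \<Longrightarrow> u i p \<in> pverts X"
  using m_pos n_pos by (simp add: layer_pos_def pverts_X)

lemma arc_sym: "(a, b) \<in> parcs X \<Longrightarrow> (b, a) \<in> parcs X"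
  by (auto simp: twisted_graph_def Let_def)

lemma arc_next: "0 \<le> i \<Longrightarrow> i < m \<Longrightarrow> (u i p, u i (p + 1)) \<in> parcs X"
  by (auto simp: twisted_graph_def Let_def)

lemma arc_out:
  "0 \<le> i \<Longrightarrow> i < m \<Longrightarrow> same_type p \<Longrightarrow> (u i p, u (i + 1) (- 2 \<star> \<pi> p)) \<in> parcs X"
  by (auto simp: twisted_graph_def Let_def)

text \<open>
  Left translations are automorphisms of the cycles: they preserve the orientation for even \<open>h\<close>
  and reverse it for odd \<open>h\<close>.
\<close>
lemma arc_step:
  assumes "0 \<le> i" "i \<le> m"
  shows "(u i (h \<star> p), u i (h \<star> (p + 1))) \<in> parcs X"
proof -
  have *: "(u i (h \<star> p), u i (h \<star> (p + 1))) \<in> parcs X" if "0 \<le> i" "i < m" for i h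
  proof (cases "even h")
    case True
    then show ?thesis using arc_next[OF that, of "h \<star> p"] by (simp add: dih_mult_def parity_sign_def algebra_simps)
  next
    case False
    then show ?thesis
      using arc_sym[OF arc_next[OF that, of "h \<star> (p + 1)"]] by (simp add: dih_mult_def parity_sign_def algebra_simps)
  qed
  show ?thesis
  proof (cases "i = m")
    case True
    then show ?thesis using *[of 0 "y \<star> h"] m_pos by (simp add: u_wrap dih_assoc)
  next
    case False
    then show ?thesis using * assms by simp
  qed
qed

lemma arcs_cases:
  assumes "(a, b) \<in> parcs X"
  obtains i p where "0 \<le> i" "i < m" "a = u i p" "b = u i (p + 1)"
  | i p where "0 \<le> i" "i < m" "same_type p" "a = u i p" "b = u (i + 1) (- 2 \<star> \<pi> p)"
  | i p where "0 \<le> i" "i < m" "b = u i p" "a = u i (p + 1)"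
  | i p where "0 \<le> i" "i < m" "same_type p" "b = u i p" "a = u (i + 1) (- 2 \<star> \<pi> p)"
  using assms by (auto simp: twisted_graph_def Let_def)

lemma wf_X: "parcs X \<subseteq> pverts X \<times> pverts X"
proof (rule subrelI)
  fix a b assume "(a, b) \<in> parcs X"
  then show "(a, b) \<in> pverts X \<times> pverts X" by (cases rule: arcs_cases) (auto intro: u_mem)
qed

lemma vertex_cases:
  assumes "a \<in> pverts X"
  obtains i p where "0 \<le> i" "i < m" "a = u i p"
proof -
  obtain i j where ij: "a = (i, j)" "0 \<le> i" "i < m" "0 \<le> j" "j < n"
    using assms by (auto simp: pverts_X)
  then have "a = u i (j - 2 * i)" by (simp add: layer_pos_def)
  then show ?thesis using that ij by blast
qed

text \<open>
  A map that permutes the layers and acts on each of them as a left translation respects the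
  cycles, so only the arcs between the layers must be checked. The arcs that leave the last layer
  are separate, because for them the next layer is written as layer 0.
\<close>
lemma layer_translation_aut:
  fixes \<phi> h :: "int \<Rightarrow> int"
  assumes phi: "\<And>i. 0 \<le> i \<Longrightarrow> i < m \<Longrightarrow> 0 \<le> \<phi> i \<and> \<phi> i \<le> m"
    and surj: "\<And>j. 0 \<le> j \<Longrightarrow> j < m \<Longrightarrow> \<exists>i. 0 \<le> i \<and> i < m \<and> (\<phi> i = j \<or> \<phi> i = m \<and> j = 0)"
    and out: "\<And>i p. 0 \<le> i \<Longrightarrow> i + 1 < m \<Longrightarrow> same_type p \<Longrightarrow>
       (u (\<phi> i) (h i \<star> p), u (\<phi> (i + 1)) (h (i + 1) \<star> (- 2 \<star> \<pi> p))) \<in> parcs X"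
    and wrap: "\<And>p. same_type p \<Longrightarrow>
       (u (\<phi> (m - 1)) (h (m - 1) \<star> p), u (\<phi> 0) (h 0 \<star> (y \<star> (- 2 \<star> \<pi> p)))) \<in> parcs X"
  shows "\<exists>g\<in>factor_auts X (natural_two_factor m n X).
    \<forall>i p. 0 \<le> i \<and> i < m \<longrightarrow> g (u i p) = u (\<phi> i) (h i \<star> p)"
proof -
  define F where "F = (\<lambda>(i, j). u (\<phi> i) (h i \<star> (j - 2 * i)))"
  have Fu: "F (u i p) = u (\<phi> i) (h i \<star> p)" if "0 \<le> i" "i < m" for i p
  proof -
    have "[(2 * i + p) mod n - 2 * i = 2 * i + p - 2 * i] (mod n)"
      by (intro cong_diff cong_refl) (simp add: cong_def)
    then have "[(2 * i + p) mod n - 2 * i = p] (mod n)" by simp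
    then show ?thesis
      using that mult_cong[OF cong_refl] u_cong by (simp add: F_def layer_pos_def[of m n y i p])
  qed
  have Fm: "F (u m p) = u (\<phi> 0) (h 0 \<star> (y \<star> p))" for p
    using Fu[of 0] m_pos by (simp add: u_wrap)
  have FV: "F ` pverts X = pverts X"
  proof
    show "F ` pverts X \<subseteq> pverts X"
    proof
      fix b assume "b \<in> F ` pverts X"
      then obtain a where "a \<in> pverts X" "b = F a" by blast
      then show "b \<in> pverts X" using Fu phi u_mem by (metis vertex_cases)
    qed
    show "pverts X \<subseteq> F ` pverts X"
    proof
      fix b assume "b \<in> pverts X"
      then obtain j p where j: "0 \<le> j" "j < m" "b = u j p" by (rule vertex_cases)
      obtain i where i: "0 \<le> i" "i < m" "\<phi> i = j \<or> \<phi> i = m \<and> j = 0" using surj[OF j(1,2)] by blast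
      have "\<exists>p'. b = u (\<phi> i) p'"
      proof (cases "\<phi> i = j")
        case False
        then have "b = u (\<phi> i) (dih_inv y \<star> p)" using i(3) j(3) by (auto simp: u_wrap)
        then show ?thesis by blast
      qed (use j in blast)
      then obtain p' where "b = u (\<phi> i) p'" by blast
      then have "b = F (u i (dih_inv (h i) \<star> p'))" using i by (simp add: Fu)
      then show "b \<in> F ` pverts X" using u_mem[of i] i by (metis imageI less_imp_le)
    qed
  qed
  have one: "(F (u i p), F (u i (p + 1))) \<in> parcs X" if "0 \<le> i" "i < m" for i p
    using phi that by (simp add: Fu arc_step)
  have two: "(F (u i p), F (u (i + 1) (- 2 \<star> \<pi> p))) \<in> parcs X" if "0 \<le> i" "i < m" "same_type p" for i p
  proof (cases "i + 1 = m")
    case True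
    then have "i = m - 1" by simp
    then show ?thesis using wrap[OF that(3)] m_pos by (simp add: Fu Fm)
  next
    case False
    then show ?thesis using out that by (simp add: Fu)
  qed
  have iso: "graph_isomorphism F X X"
  proof (rule finite_graph_bijection_iso[OF _ wf_X FV])
    show "finite (pverts X)" by (simp add: pverts_X)
    fix a b assume "(a, b) \<in> parcs X"
    then show "(F a, F b) \<in> parcs X" by (cases rule: arcs_cases) (auto intro: one two arc_sym)
  qed
  have "bij_betw (graph_image F) (natural_two_factor m n X) (natural_two_factor m n X)"
    by (rule layer_preserving_iso_factor[OF pverts_X n_pos iso, where \<phi>="\<lambda>i. if \<phi> i < m then \<phi> i else 0"])
       (simp add: F_def layer_pos_def)
  then have "restrict F (pverts X) \<in> factor_auts X (natural_two_factor m n X)"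
    by (rule factor_autsI[OF natural_two_factor_inner[OF pverts_X] iso])
  moreover have "restrict F (pverts X) (u i p) = u (\<phi> i) (h i \<star> p)" if "0 \<le> i \<and> i < m" for i p
    using that u_mem[of i p] by (simp add: Fu)
  ultimately show ?thesis by blast
qed

text \<open>
  Adding 1 to the number of the layer is compatible with the arcs by construction, except for the
  transition from layer \<open>m - 1\<close> to layer 0. There it means that \<open>y\<close> is a fixed point of
  \<open>conj_twist \<pi>\<close>.
\<close>
lemma rotation_aut:
  "\<exists>g\<in>factor_auts X (natural_two_factor m n X). \<forall>i p. 0 \<le> i \<and> i < m \<longrightarrow> g (u i p) = u (i + 1) p"
proof -
  have wrap: "(u m p, u 1 (y \<star> (- 2 \<star> \<pi> p))) \<in> parcs X" if p: "same_type p" for p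
  proof -
    have "[- 2 \<star> \<pi> (y \<star> p) = - 2 \<star> (\<pi> y \<star> \<pi> p)] (mod n)"
      by (intro mult_cong cong_refl pi_hom y_type p)
    also have "- 2 \<star> (\<pi> y \<star> \<pi> p) = conj_twist \<pi> y \<star> (- 2 \<star> \<pi> p)"
      by (simp add: conj_twist_def dih_assoc two_cancel)
    also have "[\<dots> = y \<star> (- 2 \<star> \<pi> p)] (mod n)"
      by (intro mult_cong cong_refl y_fixed)
    finally have "u 1 (- 2 \<star> \<pi> (y \<star> p)) = u 1 (y \<star> (- 2 \<star> \<pi> p))" by (rule u_cong)
    then show ?thesis
      using arc_out[of 0 "y \<star> p"] m_pos same_type_mult[OF y_type] p by (simp add: u_wrap)
  qed
  have "\<exists>g\<in>factor_auts X (natural_two_factor m n X).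
    \<forall>i p. 0 \<le> i \<and> i < m \<longrightarrow> g (u i p) = u (i + 1) (0 \<star> p)"
  proof (rule layer_translation_aut)
    show "0 \<le> i + 1 \<and> i + 1 \<le> m" if "0 \<le> i" "i < m" for i using that by simp
    show "\<exists>i\<ge>0. i < m \<and> (i + 1 = j \<or> i + 1 = m \<and> j = 0)" if "0 \<le> j" "j < m" for j
      using that m_pos by (intro exI[of _ "if j = 0 then m - 1 else j - 1"]) auto
    show "(u (i + 1) (0 \<star> p), u (i + 1 + 1) (0 \<star> (- 2 \<star> \<pi> p))) \<in> parcs X"
      if "0 \<le> i" "i + 1 < m" "same_type p" for i p
      using arc_out[of "i + 1" p] that by simp
  qed (use wrap in auto)
  then show ?thesis by simp
qed

text \<open>
  The translation by 1 in layer 0 forces the translation by \<open>(conj_twist \<pi> ^^ i) 1\<close> in layer \<open>i\<close>.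
  After \<open>m\<close> layers the relation \<open>y_conj\<close> brings it back to the translation by 1.
\<close>
lemma swap_aut:
  "\<exists>g\<in>factor_auts X (natural_two_factor m n X). \<forall>p. g (u 0 p) = u 0 (1 \<star> p)"
proof -
  define k where "k i = (conj_twist \<pi> ^^ nat i) 1" for i
  have kS: "k (i + 1) = conj_twist \<pi> (k i)" if "0 \<le> i" for i
    using that by (simp add: k_def nat_add_distrib)
  have kt: "same_type (k i)" for i
  proof -
    have "same_type ((conj_twist \<pi> ^^ j) 1)" for j by (induction j) (auto intro: conj_twist_type)
    then show ?thesis by (simp add: k_def)
  qed
  have step: "[k (i + 1) \<star> (- 2 \<star> \<pi> p) = - 2 \<star> \<pi> (k i \<star> p)] (mod n)" if "0 \<le> i" "same_type p" for i p
  proof -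
    have "[- 2 \<star> \<pi> (k i \<star> p) = - 2 \<star> (\<pi> (k i) \<star> \<pi> p)] (mod n)"
      by (intro mult_cong cong_refl pi_hom kt that)
    moreover have "- 2 \<star> (\<pi> (k i) \<star> \<pi> p) = k (i + 1) \<star> (- 2 \<star> \<pi> p)"
      by (simp add: kS that conj_twist_def dih_assoc two_cancel)
    ultimately show ?thesis by (simp add: cong_sym_eq)
  qed
  have "\<exists>g\<in>factor_auts X (natural_two_factor m n X).
    \<forall>i p. 0 \<le> i \<and> i < m \<longrightarrow> g (u i p) = u i (k i \<star> p)"
  proof (rule layer_translation_aut)
    show "0 \<le> i \<and> i \<le> m" if "0 \<le> i" "i < m" for i using that by simp
    show "\<exists>i\<ge>0. i < m \<and> (i = j \<or> i = m \<and> j = 0)" if "0 \<le> j" "j < m" for j using that by auto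
    show "(u i (k i \<star> p), u (i + 1) (k (i + 1) \<star> (- 2 \<star> \<pi> p))) \<in> parcs X"
      if "0 \<le> i" "i + 1 < m" "same_type p" for i p
      using arc_out[of i "k i \<star> p"] that same_type_mult[OF kt] u_cong[OF step] by simp
    show "(u (m - 1) (k (m - 1) \<star> p), u 0 (k 0 \<star> (y \<star> (- 2 \<star> \<pi> p)))) \<in> parcs X"
      if p: "same_type p" for p
    proof -
      have "[k 0 \<star> y = y \<star> k m] (mod n)" using cong_sym[OF y_conj] by (simp add: k_def)
      then have "[k 0 \<star> y \<star> (- 2 \<star> \<pi> p) = y \<star> k m \<star> (- 2 \<star> \<pi> p)] (mod n)"
        by (rule mult_cong) simp
      moreover have "[y \<star> (k m \<star> (- 2 \<star> \<pi> p)) = y \<star> (- 2 \<star> \<pi> (k (m - 1) \<star> p))] (mod n)"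
        by (rule mult_cong[OF cong_refl]) (use step[of "m - 1" p] m_pos p in simp)
      ultimately have "[k 0 \<star> (y \<star> (- 2 \<star> \<pi> p)) = y \<star> (- 2 \<star> \<pi> (k (m - 1) \<star> p))] (mod n)"
        by (metis cong_trans dih_assoc)
      then have "u 0 (k 0 \<star> (y \<star> (- 2 \<star> \<pi> p))) = u m (- 2 \<star> \<pi> (k (m - 1) \<star> p))"
        by (simp add: u_wrap u_cong)
      then show ?thesis using arc_out[of "m - 1" "k (m - 1) \<star> p"] m_pos p same_type_mult[OF kt] by simp
    qed
  qed
  then obtain g where "g \<in> factor_auts X (natural_two_factor m n X)"
    "\<forall>i p. 0 \<le> i \<and> i < m \<longrightarrow> g (u i p) = u i (k i \<star> p)" by blast
  then show ?thesis using m_pos by (intro bexI[of _ g]) (simp_all add: k_def)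
qed

text \<open>
  The translation by \<open>- 1\<close> exchanges the two types of positions. It therefore extends to an
  automorphism that exchanges layer \<open>i\<close> with layer \<open>m - i\<close>, with translations that are determined
  recursively by \<open>reversal_shift\<close> and fit together after \<open>m\<close> layers by \<open>y_reversal\<close>.
\<close>
lemma reversal_aut:
  "\<exists>g\<in>factor_auts X (natural_two_factor m n X). \<forall>p. g (u 0 p) = u 0 (- 1 \<star> p)"
proof -
  define e where "e i = reversal_shift \<pi> (nat i)" for i
  let ?y = "dih_inv y" and ?x = "\<pi> 1"
  \<comment> \<open>the factor \<open>dih_inv y\<close> is due to layer 0 being written as layer \<open>m\<close>\<close>
  define h where "h i = ?y \<star> (- 1 \<star> e i)" for i
  have eS: "e (i + 1) = - 1 \<star> ?x \<star> 2 \<star> conj_twist \<pi> (e i)" if "0 \<le> i" for i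
    using that by (simp add: e_def nat_add_distrib)
  have xt: "same_type ?x" by (intro pi_type) simp
  have et: "same_type (e i)" for i by (simp add: e_def reversal_shift_type)
  have m11: "- 1 \<star> (- 1 \<star> a) = a" for a by (simp add: dih_mult_def parity_sign_def)
  \<comment> \<open>\<open>B\<close> computes the image of the end in layer \<open>i + 1\<close> of an arc; by \<open>A\<close> its outside neighbour is the image of the other end\<close>
  have B: "[h (i + 1) \<star> (- 2 \<star> \<pi> p) = ?y \<star> (?x \<star> \<pi> (e i \<star> p))] (mod n)"
    if "0 \<le> i" "same_type p" for i p
  proof -
    have "h (i + 1) \<star> (- 2 \<star> \<pi> p) = ?y \<star> (?x \<star> (\<pi> (e i) \<star> \<pi> p))"
      by (simp add: h_def eS that conj_twist_def dih_assoc two_cancel m11)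
    moreover have "[?y \<star> (?x \<star> (\<pi> (e i) \<star> \<pi> p)) = ?y \<star> (?x \<star> \<pi> (e i \<star> p))] (mod n)"
      by (intro mult_cong cong_refl cong_sym[OF pi_hom] et that)
    ultimately show ?thesis by simp
  qed
  \<comment> \<open>the inverses of the relations for \<open>y\<close> and \<open>\<pi> 1\<close>\<close>
  have yfix: "[conj_twist \<pi> ?y = ?y] (mod n)"
  proof (rule dih_mult_cancel[of y])
    have "[y \<star> conj_twist \<pi> ?y = conj_twist \<pi> y \<star> conj_twist \<pi> ?y] (mod n)"
      by (intro mult_cong cong_refl cong_sym[OF y_fixed])
    also have "[conj_twist \<pi> y \<star> conj_twist \<pi> ?y = conj_twist \<pi> (y \<star> ?y)] (mod n)"
      by (intro cong_sym[OF conj_twist_hom] y_type same_type_inv)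
    also have "[conj_twist \<pi> (y \<star> ?y) = - 2 \<star> 0 \<star> 2] (mod n)"
      unfolding conj_twist_def by (intro mult_cong cong_refl) (simp add: pi_zero)
    also have "- 2 \<star> 0 \<star> 2 = 0" by (simp add: dih_mult_def parity_sign_def)
    finally show "[y \<star> conj_twist \<pi> ?y = y \<star> ?y] (mod n)" by simp
  qed
  have psix: "[conj_twist \<pi> ?x = - 2 \<star> (1 \<star> 2)] (mod n)"
  proof -
    have "[\<pi> ?x = 1] (mod n)" by (intro pi_pi) simp
    then have "[- 2 \<star> \<pi> ?x \<star> 2 = - 2 \<star> 1 \<star> 2] (mod n)" by (intro mult_cong cong_refl)
    then show ?thesis by (simp add: conj_twist_def dih_assoc)
  qed
  have A: "[- 2 \<star> \<pi> (?y \<star> (?x \<star> \<pi> (e i \<star> p))) = h i \<star> p] (mod n)"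
    if "same_type p" for i p
  proof -
    let ?z = "e i \<star> p"
    have zt: "same_type ?z" using same_type_mult[OF et] that by simp
    have "[conj_twist \<pi> (?y \<star> (?x \<star> \<pi> ?z)) = conj_twist \<pi> ?y \<star> conj_twist \<pi> (?x \<star> \<pi> ?z)] (mod n)"
      by (intro conj_twist_hom) (auto simp: same_type_inv y_type same_type_mult[OF xt] pi_type zt)
    also have "[conj_twist \<pi> ?y \<star> conj_twist \<pi> (?x \<star> \<pi> ?z) =
        ?y \<star> (conj_twist \<pi> ?x \<star> conj_twist \<pi> (\<pi> ?z))] (mod n)"
      by (intro mult_cong yfix conj_twist_hom xt pi_type zt)
    also have "[?y \<star> (conj_twist \<pi> ?x \<star> conj_twist \<pi> (\<pi> ?z)) =
        ?y \<star> ((- 2 \<star> (1 \<star> 2)) \<star> (- 2 \<star> ?z \<star> 2))] (mod n)"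
      by (intro mult_cong cong_refl psix conj_twist_pi zt)
    finally have "[conj_twist \<pi> (?y \<star> (?x \<star> \<pi> ?z)) \<star> - 2 =
       ?y \<star> ((- 2 \<star> (1 \<star> 2)) \<star> (- 2 \<star> ?z \<star> 2)) \<star> - 2] (mod n)"
      by (intro mult_cong cong_refl)
    moreover have "?y \<star> ((- 2 \<star> (1 \<star> 2)) \<star> (- 2 \<star> ?z \<star> 2)) \<star> - 2 = h i \<star> p"
    proof -
      have "- 2 \<star> (1 \<star> b) = - 1 \<star> b" for b by (simp add: dih_mult_def parity_sign_def)
      moreover have "2 \<star> - 2 = 0" by (simp add: dih_mult_def parity_sign_def)
      ultimately show ?thesis by (simp add: h_def dih_assoc two_cancel)
    qed
    ultimately show ?thesis by (simp add: conj_twist_shift)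
  qed
  have Bt: "same_type (?y \<star> (?x \<star> \<pi> (e i \<star> p)))" if "same_type p" for i p
    using that by (simp add: same_type_mult[OF same_type_inv[OF y_type]] same_type_mult[OF xt]
        pi_type same_type_mult[OF et])
  have "\<exists>g\<in>factor_auts X (natural_two_factor m n X).
    \<forall>i p. 0 \<le> i \<and> i < m \<longrightarrow> g (u i p) = u (m - i) (h i \<star> p)"
  proof (rule layer_translation_aut)
    show "0 \<le> m - i \<and> m - i \<le> m" if "0 \<le> i" "i < m" for i using that by simp
    show "\<exists>i\<ge>0. i < m \<and> (m - i = j \<or> m - i = m \<and> j = 0)" if "0 \<le> j" "j < m" for j
      using that m_pos by (intro exI[of _ "if j = 0 then 0 else m - j"]) auto
    show "(u (m - i) (h i \<star> p), u (m - (i + 1)) (h (i + 1) \<star> (- 2 \<star> \<pi> p))) \<in> parcs X"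
      if "0 \<le> i" "i + 1 < m" "same_type p" for i p
    proof -
      have "u (m - (i + 1)) (h (i + 1) \<star> (- 2 \<star> \<pi> p)) = u (m - (i + 1)) (?y \<star> (?x \<star> \<pi> (e i \<star> p)))"
        using u_cong[OF B] that by simp
      moreover have "u (m - i) (h i \<star> p) = u (m - i) (- 2 \<star> \<pi> (?y \<star> (?x \<star> \<pi> (e i \<star> p))))"
        using u_cong[OF A] that by simp
      ultimately show ?thesis
        using arc_sym[OF arc_out[of "m - (i + 1)" "?y \<star> (?x \<star> \<pi> (e i \<star> p))"]] that Bt by simp
    qed
    show "(u (m - (m - 1)) (h (m - 1) \<star> p), u (m - 0) (h 0 \<star> (y \<star> (- 2 \<star> \<pi> p)))) \<in> parcs X"
      if p: "same_type p" for p
    proof -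
      let ?B = "?y \<star> (?x \<star> \<pi> (e (m - 1) \<star> p))"
      have "u (m - 0) (h 0 \<star> (y \<star> (- 2 \<star> \<pi> p))) = u 0 (- 1 \<star> (y \<star> (- 2 \<star> \<pi> p)))"
        by (simp add: u_wrap h_def e_def dih_assoc)
      also have "\<dots> = u 0 ?B"
      proof (rule u_cong)
        have "[y \<star> - 1 \<star> y = - 1 \<star> e m] (mod n)" using y_reversal by (simp add: e_def)
        then have "[?y \<star> (y \<star> - 1 \<star> y) = ?y \<star> (- 1 \<star> e m)] (mod n)" by (rule mult_cong[OF cong_refl])
        then have "[?y \<star> (y \<star> - 1 \<star> y) \<star> (- 2 \<star> \<pi> p) = ?y \<star> (- 1 \<star> e m) \<star> (- 2 \<star> \<pi> p)] (mod n)"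
          by (rule mult_cong) simp
        then have "[- 1 \<star> (y \<star> (- 2 \<star> \<pi> p)) = h m \<star> (- 2 \<star> \<pi> p)] (mod n)"
          by (simp add: dih_assoc h_def)
        moreover have "[h m \<star> (- 2 \<star> \<pi> p) = ?B] (mod n)" using B[of "m - 1" p] m_pos p by simp
        ultimately show "[- 1 \<star> (y \<star> (- 2 \<star> \<pi> p)) = ?B] (mod n)" by (rule cong_trans)
      qed
      finally have "u (m - 0) (h 0 \<star> (y \<star> (- 2 \<star> \<pi> p))) = u 0 ?B" .
      moreover have "u 1 (h (m - 1) \<star> p) = u 1 (- 2 \<star> \<pi> ?B)" using u_cong[OF A] p by simp
      ultimately show ?thesis using arc_sym[OF arc_out[of 0 ?B]] m_pos Bt[OF p] by simp
    qed
  qed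
  then obtain g where g: "g \<in> factor_auts X (natural_two_factor m n X)"
    "\<forall>i p. 0 \<le> i \<and> i < m \<longrightarrow> g (u i p) = u (m - i) (h i \<star> p)" by blast
  have "g (u 0 p) = u 0 (- 1 \<star> p)" for p
    using g(2) m_pos by (simp add: u_wrap h_def e_def dih_assoc)
  then show ?thesis using g(1) by blast
qed

text \<open>
  The integers \<open>1\<close> and \<open>- 1\<close> generate the dihedral group, so \<open>swap_aut\<close> and \<open>reversal_aut\<close> make
  layer 0 a single orbit. The rotation reaches the other layers.
\<close>
lemma factor_auts_transitive:
  assumes "a \<in> pverts X" "b \<in> pverts X"
  shows "\<exists>g\<in>factor_auts X (natural_two_factor m n X). g a = b"
proof -
  let ?G = "factor_auts X (natural_two_factor m n X)"
  note inn = natural_two_factor_inner[OF pverts_X]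
  define R where "R a b \<longleftrightarrow> a \<in> pverts X \<and> b \<in> pverts X \<and> (\<exists>g\<in>?G. g a = b)" for a b
  have GV: "g a \<in> pverts X" if "g \<in> ?G" "a \<in> pverts X" for g a
    using that by (auto simp: factor_auts_def carrier_aut_group Bij_def bij_betw_def)
  have trans: "R a c" if ab: "R a b" "R b c" for a b c
  proof -
    obtain g h where "g \<in> ?G" "g a = b" "h \<in> ?G" "h b = c" using ab unfolding R_def by blast
    then have "compose (pverts X) h g \<in> ?G" "compose (pverts X) h g a = c"
      using factor_auts_comp[OF inn, of g h] ab by (auto simp: R_def compose_def)
    then show ?thesis using ab unfolding R_def by blast
  qed
  have sym: "R b a" if ab: "R a b" for a b
  proof -
    obtain g where g: "g \<in> ?G" "g a = b" using ab unfolding R_def by blast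
    have "inj_on g (pverts X)" using g(1) by (auto simp: factor_auts_def carrier_aut_group Bij_def bij_betw_def)
    then have "restrict (inv_into (pverts X) g) (pverts X) b = a" using g ab by (auto simp: R_def)
    then show ?thesis using factor_auts_inv[OF inn g(1)] ab unfolding R_def by blast
  qed
  obtain s where s: "s \<in> ?G" "\<And>p. s (u 0 p) = u 0 (1 \<star> p)" using swap_aut by blast
  obtain d where d: "d \<in> ?G" "\<And>p. d (u 0 p) = u 0 (- 1 \<star> p)" using reversal_aut by blast
  obtain q where q: "q \<in> ?G" "\<And>i p. 0 \<le> i \<and> i < m \<Longrightarrow> q (u i p) = u (i + 1) p" using rotation_aut by blast
  have u0: "u 0 p \<in> pverts X" for p using u_mem m_pos by simp
  have Rs: "R (u 0 p) (u 0 (1 \<star> p))" for p using s u0 by (auto simp: R_def)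
  have Rd: "R (u 0 p) (u 0 (- 1 \<star> p))" for p using d u0 by (auto simp: R_def)
  have next1: "R (u 0 p) (u 0 (p + 1))" for p
  proof -
    have R2: "R (u 0 a) (u 0 (a + 2))" for a
      using trans[OF Rd Rs, of a] by (simp add: dih_mult_def parity_sign_def algebra_simps)
    have R2n: "R (u 0 a) (u 0 (a + 2 * int j))" for a j
    proof (induction j)
      case 0
      then show ?case using trans[OF Rs sym[OF Rs]] by simp
    next
      case (Suc j)
      then show ?case using trans[OF Suc R2[of "a + 2 * int j"]] by (simp add: algebra_simps)
    qed
    have R2z: "R (u 0 a) (u 0 (a + 2 * k))" for a k
    proof (cases "0 \<le> k")
      case True
      then show ?thesis using R2n[of a "nat k"] by simp
    next
      case False
      then show ?thesis using sym[OF R2n[of "a + 2 * k" "nat (- k)"]] by simp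
    qed
    show ?thesis using trans[OF Rs[of p] R2z[of "1 \<star> p" p]]
      by (simp add: dih_mult_def parity_sign_def algebra_simps)
  qed
  have lay0: "R (u 0 0) (u 0 p)" for p
  proof -
    have "R (u 0 0) (u 0 (int j))" for j
    proof (induction j)
      case 0
      then show ?case using trans[OF Rs sym[OF Rs]] by simp
    next
      case (Suc j)
      then show ?case using trans[OF Suc next1[of "int j"]] by (simp add: algebra_simps)
    qed
    from this[of "nat (p mod n)"] have "R (u 0 0) (u 0 (p mod n))" using n_pos by simp
    moreover have "u 0 (p mod n) = u 0 p" by (rule u_cong) (simp add: cong_def)
    ultimately show ?thesis by simp
  qed
  have layi: "R (u 0 p) (u i p)" if "0 \<le> i" "i < m" for i p
    using that
  proof (induction i rule: int_ge_induct)
    case base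
    then show ?case using trans[OF Rs sym[OF Rs]] by simp
  next
    case (step i)
    then have "q (u i p) = u (i + 1) p" using q(2) by simp
    then have "R (u i p) (u (i + 1) p)"
      using q(1) u_mem[of i p] u_mem[of "i + 1" p] step.hyps step.prems unfolding R_def by auto
    then show ?case using trans[OF step.IH] step by simp
  qed
  have base: "R (u 0 0) a" if "a \<in> pverts X" for a
  proof -
    obtain i p where "0 \<le> i" "i < m" "a = u i p" using \<open>a \<in> pverts X\<close> by (rule vertex_cases)
    then show ?thesis using trans[OF lay0[of p] layi[of i p]] by simp
  qed
  show ?thesis using trans[OF sym[OF base[OF assms(1)]] base[OF assms(2)]] by (simp add: R_def)
qed

end

lemma cayley_twist_imp_group:
  assumes "cayley_twist n \<pi> m y" "iso_with_factor \<Gamma> \<C> m n (twisted_graph m n \<pi> y)"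
    and "inner_subgraphs \<Gamma> \<C>"
  shows "\<exists>G. subgroup G (aut_group \<Gamma>) \<and> transitive_on_vertices \<Gamma> G \<and> preserves G \<C>"
proof -
  interpret cayley_twist n \<pi> m y by fact
  obtain f where f: "graph_isomorphism f \<Gamma> X" "graph_image f ` \<C> = natural_two_factor m n X"
    using assms(2) by (auto simp: iso_with_factor_def)
  show ?thesis
    using factor_auts_group[OF assms(3) factor_auts_transport[OF assms(3) f factor_auts_transitive]]
    by blast
qed

section \<open>Bialternating cycle systems\<close>

text \<open>
  Every integer is reached from 0 by right multiplications by \<open>1\<close> and \<open>- 1\<close>.
\<close>
lemma walk_unique:
  fixes f g :: "int \<Rightarrow> 'a"
  assumes f: "\<And>j. s (f j) = f (j \<star> 1)" "\<And>j. d (f j) = f (j \<star> - 1)"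
    and g: "\<And>j. s (g j) = g (j \<star> 1)" "\<And>j. d (g j) = g (j \<star> - 1)"
    and 0: "f 0 = g 0"
  shows "f j = g j"
proof (induction j rule: int_induct[of _ 0])
  case base
  then show ?case by (rule 0)
next
  case (step1 i)
  then show ?case using f[of i] g[of i]
    by (cases "even i") (auto simp: dih_mult_def parity_sign_def)
next
  case (step2 i)
  then show ?case using f[of i] g[of i]
    by (cases "even i") (auto simp: dih_mult_def parity_sign_def)
qed

text \<open>
  A bialternating graph together with its three involutions. The cycle through \<open>v\<close> is number
  \<open>layer v\<close> on the cycle formed by the cycles, \<open>sig v\<close> is the direction in which \<open>out\<close> leaves it, and
  \<open>walk v\<close> is the walk around it that applies \<open>mate\<close> and \<open>flip\<close> alternately. In these terms
  bialternation says that \<open>mate\<close> preserves \<open>sig\<close> and \<open>flip\<close> negates it.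
\<close>
locale bialternating_system =
  fixes \<Gamma> :: "'a pair_pre_digraph" and \<C> :: "'a pair_pre_digraph set"
    and mate flip out :: "'a \<Rightarrow> 'a" and layer sig :: "'a \<Rightarrow> int"
    and walk :: "'a \<Rightarrow> int \<Rightarrow> 'a" and m n :: int
  assumes finite_V: "finite (pverts \<Gamma>)" and nonempty: "pverts \<Gamma> \<noteq> {}"
    and m_ge: "3 \<le> m" and n_ge: "3 \<le> n"
    and mate_in: "v \<in> pverts \<Gamma> \<Longrightarrow> mate v \<in> pverts \<Gamma>"
    and flip_in: "v \<in> pverts \<Gamma> \<Longrightarrow> flip v \<in> pverts \<Gamma>"
    and out_in: "v \<in> pverts \<Gamma> \<Longrightarrow> out v \<in> pverts \<Gamma>"
    and mate_mate: "v \<in> pverts \<Gamma> \<Longrightarrow> mate (mate v) = v"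
    and flip_flip: "v \<in> pverts \<Gamma> \<Longrightarrow> flip (flip v) = v"
    and out_out: "v \<in> pverts \<Gamma> \<Longrightarrow> out (out v) = v"
    and layer_range: "v \<in> pverts \<Gamma> \<Longrightarrow> 0 \<le> layer v \<and> layer v < m"
    and layer_mate: "v \<in> pverts \<Gamma> \<Longrightarrow> layer (mate v) = layer v"
    and layer_flip: "v \<in> pverts \<Gamma> \<Longrightarrow> layer (flip v) = layer v"
    and layer_out: "v \<in> pverts \<Gamma> \<Longrightarrow> layer (out v) = (layer v + sig v) mod m"
    and sig_cases: "v \<in> pverts \<Gamma> \<Longrightarrow> sig v = 1 \<or> sig v = - 1"
    and sig_mate: "v \<in> pverts \<Gamma> \<Longrightarrow> sig (mate v) = sig v"
    and sig_flip: "v \<in> pverts \<Gamma> \<Longrightarrow> sig (flip v) = - sig v"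
    and sig_out: "v \<in> pverts \<Gamma> \<Longrightarrow> sig (out v) = - sig v"
    and walk_0: "v \<in> pverts \<Gamma> \<Longrightarrow> walk v 0 = v"
    and mate_walk: "v \<in> pverts \<Gamma> \<Longrightarrow> mate (walk v j) = walk v (j \<star> 1)"
    and flip_walk: "v \<in> pverts \<Gamma> \<Longrightarrow> flip (walk v j) = walk v (j \<star> - 1)"
    and walk_eq_iff: "v \<in> pverts \<Gamma> \<Longrightarrow> walk v j = walk v k \<longleftrightarrow> [j = k] (mod n)"
    and range_walk: "v \<in> pverts \<Gamma> \<Longrightarrow> range (walk v) = {w \<in> pverts \<Gamma>. layer w = layer v}"
    and arcs: "parcs \<Gamma> = {(v, w). v \<in> pverts \<Gamma> \<and> w \<in> {mate v, flip v, out v}}"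
    and factor: "\<C> = (\<lambda>i. \<lparr> pverts = {v \<in> pverts \<Gamma>. layer v = i},
        parcs = {(v, w). v \<in> pverts \<Gamma> \<and> layer v = i \<and> w \<in> {mate v, flip v}} \<rparr>) ` {0..<m}"
begin

abbreviation "V \<equiv> pverts \<Gamma>"

lemma walk_in: "v \<in> V \<Longrightarrow> walk v j \<in> V" and layer_walk: "v \<in> V \<Longrightarrow> layer (walk v j) = layer v"
  using range_walk by blast+

lemma walk_walk:
  assumes "v \<in> V"
  shows "walk (walk v k) p = walk v (k \<star> p)"
  by (rule walk_unique[where s = mate and d = flip])
     (simp_all add: assms walk_in mate_walk flip_walk walk_0 dih_assoc)

lemma walk_cong: "v \<in> V \<Longrightarrow> [j = k] (mod n) \<Longrightarrow> walk v j = walk v k"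
  by (simp add: walk_eq_iff)

lemma same_layer_walk: "v \<in> V \<Longrightarrow> w \<in> V \<Longrightarrow> layer w = layer v \<Longrightarrow> \<exists>j. w = walk v j"
  using range_walk[of v] by blast

lemma mate_eq_walk: "v \<in> V \<Longrightarrow> mate v = walk v 1" and flip_eq_walk: "v \<in> V \<Longrightarrow> flip v = walk v (- 1)"
  using mate_walk[of v 0] flip_walk[of v 0] by (simp_all add: walk_0)

lemma sig_walk_add2: 
  assumes "v \<in> V"
  shows "sig (walk v (j + 2)) = - sig (walk v j)"
proof (cases "even j")
  case True
  have "walk v (j + 2) = flip (mate (walk v j))"
    using True assms by (simp add: mate_walk flip_walk) (simp add: dih_mult_def parity_sign_def add.commute)
  then show ?thesis using assms by (simp add: sig_flip sig_mate walk_in mate_in)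
next
  case False
  have "walk v (j + 2) = mate (flip (walk v j))"
    using False assms by (simp add: mate_walk flip_walk) (simp add: dih_mult_def parity_sign_def add.commute)
  then show ?thesis using assms by (simp add: sig_flip sig_mate walk_in flip_in)
qed

text \<open>
  \<open>mate\<close> preserves \<open>sig\<close> and \<open>flip\<close> negates it, so \<open>sig\<close> has the pattern \<open>+ + - -\<close> along a cycle.
\<close>
lemma sig_walk:
  assumes "v \<in> V"
  shows "sig (walk v j) = (if same_type j then sig v else - sig v)"
proof -
  have 4: "sig (walk v (j + 4)) = sig (walk v j)" for j
    using sig_walk_add2[OF assms, of j] sig_walk_add2[OF assms, of "j + 2"] by (simp add: algebra_simps)
  have 4: "sig (walk v (j + 4 * k)) = sig (walk v j)" for j k
  proof (induction k rule: int_induct[of _ 0])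
    case (step1 i)
    then show ?case using 4[of "j + 4 * i"] by (simp add: algebra_simps)
  next
    case (step2 i)
    then show ?case using 4[of "j + 4 * (i - 1)"] by (simp add: algebra_simps)
  qed simp
  have s0: "sig (walk v 0) = sig v" "sig (walk v 1) = sig v"
    using assms by (simp_all add: walk_0 mate_eq_walk[symmetric] sig_mate)
  then have s2: "sig (walk v 2) = - sig v" "sig (walk v 3) = - sig v"
    using sig_walk_add2[OF assms, of 0] sig_walk_add2[OF assms, of 1] by simp_all
  have "j mod 4 = 0 \<or> j mod 4 = 1 \<or> j mod 4 = 2 \<or> j mod 4 = 3" by presburger
  moreover have "sig (walk v j) = sig (walk v (j mod 4))"
    using 4[of "j mod 4" "j div 4"] by simp
  ultimately show ?thesis using s0 s2 by (auto simp: same_type_def)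
qed

lemma n_dvd_4: "4 dvd n"
proof -
  obtain v where v: "v \<in> V" using nonempty by blast
  have n: "walk v n = walk v 0" using v by (simp add: walk_eq_iff cong_def)
  \<comment> \<open>on a cycle of odd length \<open>mate\<close> and \<open>flip\<close> would come back interchanged\<close>
  have "even n"
  proof (rule ccontr)
    assume "odd n"
    then have "walk v 1 = walk v (n - 1)"
      using mate_walk[OF v, of 0] mate_walk[OF v, of n] n by (simp add: dih_mult_def parity_sign_def)
    then have "n dvd n - 2" using v by (simp add: walk_eq_iff cong_iff_dvd_diff dvd_diff_commute)
    then have "n dvd n - (n - 2)" by (rule dvd_diff[OF dvd_refl])
    moreover have "n - (n - 2) = 2" by simp
    ultimately have "n dvd 2" by (simp only:)
    then have "n \<le> 2" by (rule zdvd_imp_le) simp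
    then show False using n_ge by simp
  qed
  moreover have "same_type n"
    using sig_walk[OF v, of n] sig_walk[OF v, of 0] n sig_cases[OF v] by (auto split: if_splits)
  ultimately show ?thesis unfolding same_type_def by presburger
qed

lemma n_even: "even n" using n_dvd_4 by auto

lemma n_ge_4: "4 \<le> n"
  using zdvd_imp_le[OF n_dvd_4] n_ge by simp

text \<open>
  \<open>\<Gamma>\<close> is connected: the cycles are connected, and in each of them some vertex has its outside
  neighbour in the next one.
\<close>
lemma layer_closed_induct:
  assumes "v \<in> V" "v \<in> X"
    and "\<And>w. w \<in> V \<Longrightarrow> w \<in> X \<Longrightarrow> mate w \<in> X"
    and "\<And>w. w \<in> V \<Longrightarrow> w \<in> X \<Longrightarrow> flip w \<in> X"
    and "\<And>w. w \<in> V \<Longrightarrow> w \<in> X \<Longrightarrow> out w \<in> X"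
  shows "V \<subseteq> X"
proof -
  have lay: "walk w j \<in> X" if "w \<in> V" "w \<in> X" for w j
  proof (induction j rule: int_induct[of _ 0])
    case base
    then show ?case using that by (simp add: walk_0)
  next
    case (step1 i)
    have "walk w (i + 1) = mate (walk w i) \<or> walk w (i + 1) = flip (walk w i)"
      using that by (cases "even i") (auto simp: mate_walk flip_walk dih_mult_def parity_sign_def)
    then show ?case using assms(3,4) step1.IH walk_in[OF that(1)] by metis
  next
    case (step2 i)
    have "walk w (i - 1) = mate (walk w i) \<or> walk w (i - 1) = flip (walk w i)"
      using that by (cases "even i") (auto simp: mate_walk flip_walk dih_mult_def parity_sign_def)
    then show ?case using assms(3,4) step2.IH walk_in[OF that(1)] by metis
  qed
  have ex: "\<exists>w\<in>V. w \<in> X \<and> layer w = (layer v + int i) mod m" for i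
  proof (induction i)
    case 0
    then show ?case using assms(1,2) layer_range[OF assms(1)] by auto
  next
    case (Suc i)
    then obtain w where w: "w \<in> V" "w \<in> X" "layer w = (layer v + int i) mod m" by blast
    define w' where "w' = (if sig w = 1 then w else flip w)"
    have w': "w' \<in> V" "w' \<in> X" "layer w' = layer w" "sig w' = 1"
      using w assms(4) sig_cases[OF w(1)] by (auto simp: w'_def flip_in layer_flip sig_flip)
    have "layer (out w') = (layer v + int (Suc i)) mod m"
      using w' w(3) by (simp add: layer_out mod_simps algebra_simps)
    then show ?case using w' assms(5) out_in by blast
  qed
  show ?thesis
  proof
    fix x assume x: "x \<in> V"
    obtain w where w: "w \<in> V" "w \<in> X" "layer w = (layer v + int (nat ((layer x - layer v) mod m))) mod m"
      using ex by blast
    have "layer w = layer x" using w(3) m_ge layer_range[OF x] by (simp add: mod_simps)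
    then show "x \<in> X" using same_layer_walk[OF w(1) x] lay[OF w(1,2)] by auto
  qed
qed

lemma out_not_layer:
  assumes "v \<in> V"
  shows "layer (out v) \<noteq> layer v"
proof
  assume "layer (out v) = layer v"
  then have "(layer v + sig v) mod m = layer v mod m"
    using layer_out[OF assms] layer_range[OF assms] by simp
  then have "m dvd layer v + sig v - layer v" by (simp only: mod_eq_dvd_iff)
  then have "m dvd sig v" by simp
  then have "m dvd 1" using sig_cases[OF assms] by auto
  then show False using m_ge zdvd_imp_le[of m 1] by simp
qed

lemma nbrs_distinct:
  assumes "v \<in> V"
  shows "mate v \<noteq> v" "flip v \<noteq> v" "mate v \<noteq> flip v" "out v \<noteq> v" "mate v \<noteq> out v" "flip v \<noteq> out v"
proof -
  have "\<not> [1 = 0] (mod n)" "\<not> [- 1 = 0] (mod n)" "\<not> [1 = - 1] (mod n)"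
    using n_ge zdvd_imp_le[of n 1] zdvd_imp_le[of n 2] by (auto simp: cong_iff_dvd_diff)
  then show "mate v \<noteq> v" "flip v \<noteq> v" "mate v \<noteq> flip v"
    using assms walk_eq_iff[OF assms, of _ 0] walk_eq_iff[OF assms]
    by (simp_all add: mate_eq_walk flip_eq_walk walk_0)
  show "out v \<noteq> v" "mate v \<noteq> out v" "flip v \<noteq> out v"
    using out_not_layer[OF assms] layer_mate[OF assms] layer_flip[OF assms] by auto
qed

lemma inner: "inner_subgraphs \<Gamma> \<C>"
  by (auto simp: inner_subgraphs_def factor mate_in flip_in)

lemma exists_base: "\<exists>v\<in>V. layer v = 0 \<and> sig v = 1"
proof -
  obtain v where v: "v \<in> V" using nonempty by blast
  have "V \<subseteq> {w \<in> V. \<exists>x\<in>V. layer x = (layer w + 1) mod m}" 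
  proof (rule subsetI)
    fix w assume w: "w \<in> V"
    define w' where "w' = (if sig w = 1 then w else flip w)"
    have "w' \<in> V" "layer w' = layer w" "sig w' = 1"
      using w sig_cases[OF w] by (auto simp: w'_def flip_in layer_flip sig_flip)
    then show "w \<in> {w \<in> V. \<exists>x\<in>V. layer x = (layer w + 1) mod m}"
      using w layer_out[of w'] out_in[of w'] by auto
  qed
  then have st: "\<exists>x\<in>V. layer x = (layer w + 1) mod m" if "w \<in> V" for w using that by blast
  have "\<exists>x\<in>V. layer x = (layer v + int i) mod m" for i
  proof (induction i)
    case 0
    then show ?case using v layer_range[OF v] by auto
  next
    case (Suc i)
    then obtain x where "x \<in> V" "layer x = (layer v + int i) mod m" by blast
    then show ?case using st[of x] by (auto simp: mod_simps algebra_simps)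
  qed
  from this[of "nat (m - layer v)"] obtain x where x: "x \<in> V" "layer x = 0"
    using layer_range[OF v] by auto
  show ?thesis
  proof (cases "sig x = 1")
    case False
    then have "flip x \<in> V" "layer (flip x) = 0" "sig (flip x) = 1"
      using x sig_cases[OF x(1)] by (auto simp: flip_in layer_flip sig_flip)
    then show ?thesis by blast
  qed (use x in blast)
qed

definition "base = (SOME v. v \<in> V \<and> layer v = 0 \<and> sig v = 1)"

lemma base: "base \<in> V" "layer base = 0" "sig base = 1"
  using someI_ex[of "\<lambda>v. v \<in> V \<and> layer v = 0 \<and> sig v = 1"] exists_base by (auto simp: base_def)

subsection \<open>Coordinates\<close>

text \<open>
  One step forwards in the layers, which preserves \<open>sig\<close> and thus can be repeated. The detour over
  \<open>mate\<close> moves the base point forward by two, in accordance with \<open>layer_pos\<close>.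
\<close>
definition "advance v = flip (mate (out v))"

lemma advance_in: "v \<in> V \<Longrightarrow> advance v \<in> V"
  by (simp add: advance_def flip_in mate_in out_in)

lemma advance_pow_in: "v \<in> V \<Longrightarrow> (advance ^^ j) v \<in> V"
  by (induction j) (auto simp: advance_in)

lemma sig_advance: "v \<in> V \<Longrightarrow> sig (advance v) = sig v"
  by (simp add: advance_def sig_flip sig_mate sig_out flip_in mate_in out_in)

lemma sig_advance_pow: "v \<in> V \<Longrightarrow> sig ((advance ^^ j) v) = sig v"
  by (induction j) (auto simp: sig_advance advance_pow_in)

lemma layer_advance_pow: "v \<in> V \<Longrightarrow> layer ((advance ^^ j) v) = (layer v + sig v * int j) mod m"
proof (induction j)
  case 0
  then show ?case using layer_range[of v] by simp
next
  case (Suc j)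
  let ?w = "(advance ^^ j) v"
  have "layer (advance ?w) = (layer ?w + sig ?w) mod m"
    using advance_pow_in[OF Suc.prems]
    by (simp add: advance_def layer_flip layer_mate layer_out mate_in out_in)
  then show ?case using Suc by (simp add: sig_advance_pow mod_simps algebra_simps)
qed

lemma advance_eq_walk: "v \<in> V \<Longrightarrow> advance v = walk (out v) 2"
  using flip_walk[of "out v" 1]
  by (simp add: advance_def mate_eq_walk out_in) (simp add: dih_mult_def parity_sign_def)

lemma out_eq_walk_advance: "v \<in> V \<Longrightarrow> walk (out v) p = walk (advance v) (- 2 \<star> p)"
  by (simp add: advance_eq_walk walk_walk out_in) (simp add: dih_mult_def parity_sign_def)

lemma exists_return:
  assumes "v \<in> V"
  shows "\<exists>y. same_type y \<and> (advance ^^ nat m) v = walk v y"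
proof -
  let ?w = "(advance ^^ nat m) v"
  have w: "?w \<in> V" "layer ?w = layer v" "sig ?w = sig v"
    using assms m_ge layer_range[OF assms]
    by (simp_all add: advance_pow_in layer_advance_pow sig_advance_pow)
  obtain y where y: "?w = walk v y" using same_layer_walk[OF assms w(1,2)] by blast
  then have "same_type y"
    using w(3) assms sig_cases[OF assms] by (auto simp: sig_walk split: if_splits)
  then show ?thesis using y by blast
qed

text \<open>
  The base point of layer \<open>i\<close> is \<open>(advance ^^ i) v0\<close>, and the other vertices of the layer are the
  values of the walk that starts there. If \<open>out\<close> acts on positions by the same \<open>\<pi>\<close> in all layers, this
  numbering identifies \<open>\<Gamma>\<close> and its cycles with a twisted layered graph.
\<close>
theorem labelling:
  assumes tw: "cayley_twist n \<pi> m y"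
    and v0: "v0 \<in> V" "layer v0 = 0" "sig v0 = 1"
    and out: "\<And>i p. 0 \<le> i \<Longrightarrow> i < m \<Longrightarrow> same_type p \<Longrightarrow>
      out (walk ((advance ^^ nat i) v0) p) = walk (out ((advance ^^ nat i) v0)) (\<pi> p)"
    and wrap: "(advance ^^ nat m) v0 = walk v0 y"
  shows "iso_with_factor \<Gamma> \<C> m n (twisted_graph m n \<pi> y)"
proof -
  interpret T: cayley_twist n \<pi> m y by (rule tw)
  define c where "c i = (advance ^^ nat i) v0" for i
  have cV: "c i \<in> V" for i using v0 by (simp add: c_def advance_pow_in)
  have cl: "layer (c i) = i" if "0 \<le> i" "i < m" for i
    using that v0 by (simp add: c_def layer_advance_pow)
  have cs: "sig (c i) = 1" for i using v0 by (simp add: c_def sig_advance_pow)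
  have cS: "c (i + 1) = advance (c i)" if "0 \<le> i" for i using that by (simp add: c_def nat_add_distrib)
  define h where "h = (\<lambda>(i, j). walk (c i) (j - 2 * i))"
  have hu: "h (T.u i p) = walk (c i) p" if "0 \<le> i" "i \<le> m" for i p
  proof (cases "i < m")
    case True
    have "[(2 * i + p) mod n - 2 * i = 2 * i + p - 2 * i] (mod n)"
      by (intro cong_diff cong_refl) (simp add: cong_def)
    then show ?thesis using True by (simp add: h_def layer_pos_def walk_cong[OF cV])
  next
    case False
    then have "i = m" using that by simp
    moreover have "walk v0 ((y \<star> p) mod n) = walk v0 (y \<star> p)"
      by (intro walk_cong v0) (simp add: cong_def)
    moreover have "c m = walk v0 y" "c 0 = v0" using wrap by (simp_all add: c_def)
    ultimately show ?thesis using v0 by (simp add: h_def layer_pos_def walk_walk)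
  qed
  have hV: "h a \<in> V" if "a \<in> pverts T.X" for a
    using that by (cases rule: T.vertex_cases) (auto simp: hu walk_in cV)
  have hlayer: "layer (h (i, j)) = i" if "(i, j) \<in> pverts T.X" for i j
    using that cV cl by (auto simp: h_def layer_walk T.pverts_X)
  have inj: "inj_on h (pverts T.X)"
  proof (rule inj_onI)
    fix a b assume ab: "a \<in> pverts T.X" "b \<in> pverts T.X" "h a = h b"
    obtain i j where a: "a = (i, j)" by (cases a)
    obtain i' j' where b: "b = (i', j')" by (cases b)
    have i: "i = i'" using hlayer ab a b by metis
    have "[j - 2 * i = j' - 2 * i] (mod n)"
      using ab(3) a b i walk_eq_iff[OF cV] by (simp add: h_def)
    then have "[j - 2 * i + 2 * i = j' - 2 * i + 2 * i] (mod n)" by (intro cong_add cong_refl)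
    then have "j = j'" using ab a b by (simp add: cong_def T.pverts_X)
    then show "a = b" using a b i by simp
  qed
  have onto: "\<exists>i p. 0 \<le> i \<and> i < m \<and> w = walk (c i) p" if "w \<in> V" for w
    using same_layer_walk[OF cV that, of "layer w"] cl layer_range[OF that] by auto
  have surj: "h ` pverts T.X = V"
  proof
    show "h ` pverts T.X \<subseteq> V" using hV by auto
    show "V \<subseteq> h ` pverts T.X"
    proof
      fix w assume "w \<in> V"
      then obtain i p where ip: "0 \<le> i" "i < m" "w = walk (c i) p" using onto by blast
      then have "w = h (T.u i p)" by (simp add: hu)
      then show "w \<in> h ` pverts T.X" using T.u_mem[of i p] ip by auto
    qed
  qed
  have bij: "bij_betw h (pverts T.X) V" using inj surj by (simp add: bij_betw_def)
  have out': "out (walk (c i) p) = walk (c (i + 1)) (- 2 \<star> \<pi> p)"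
    if "0 \<le> i" "i < m" "same_type p" for i p
    using out[OF that] out_eq_walk_advance[OF cV[of i]] that by (simp add: c_def[symmetric] cS)
  have nb: "walk v (p + 1) = (if even p then mate (walk v p) else flip (walk v p))"
    "walk v (p - 1) = (if even p then flip (walk v p) else mate (walk v p))" if "v \<in> V" for v p
    using that by (simp_all add: mate_walk flip_walk) (simp_all add: dih_mult_def parity_sign_def)
  have symG: "(b, a) \<in> parcs \<Gamma>" if "(a, b) \<in> parcs \<Gamma>" for a b
    using that by (auto simp: arcs mate_in flip_in out_in mate_mate flip_flip out_out)
  have fwd: "(h a, h b) \<in> parcs \<Gamma>" if "(a, b) \<in> parcs T.X" for a b
  proof -
    have 1: "(walk v p, walk v (p + 1)) \<in> parcs \<Gamma>" if "v \<in> V" for v p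
      using that nb(1)[OF that, of p] by (auto simp: arcs walk_in)
    have 2: "(walk (c i) p, walk (c (i + 1)) (- 2 \<star> \<pi> p)) \<in> parcs \<Gamma>"
      if "0 \<le> i" "i < m" "same_type p" for i p
      using out'[OF that] by (auto simp: arcs walk_in cV)
    show ?thesis using that
      by (cases rule: T.arcs_cases) (auto simp: hu intro: 1 2 cV symG)
  qed
  \<comment> \<open>an arc between layers is listed in \<open>twisted_graph\<close> from its end of type \<open>same_type\<close>, which may be \<open>a\<close> or \<open>b\<close>\<close>
  have bwd: "(a, b) \<in> parcs T.X"
    if a: "a \<in> pverts T.X" and b: "b \<in> pverts T.X" and ab: "(h a, h b) \<in> parcs \<Gamma>" for a b
  proof -
    obtain i p where ip: "0 \<le> i" "i < m" "a = T.u i p" using a by (rule T.vertex_cases)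
    obtain i' p' where ip': "0 \<le> i'" "i' < m" "b = T.u i' p'" using b by (rule T.vertex_cases)
    have O: "(a, b) \<in> parcs T.X"
      if h: "h b = out (h a)" "same_type p" "0 \<le> i" "i < m" "a = T.u i p" "b \<in> pverts T.X" for a b i p
    proof -
      have "h b = h (T.u (i + 1) (- 2 \<star> \<pi> p))" using h by (simp add: hu out')
      then have "b = T.u (i + 1) (- 2 \<star> \<pi> p)" using inj h T.u_mem[of "i + 1"] by (auto dest: inj_onD)
      then show ?thesis using T.arc_out h by simp
    qed
    have "h b \<in> {mate (h a), flip (h a), out (h a)}" using ab by (auto simp: arcs)
    then consider "h b = walk (c i) (p + 1)" | "h b = walk (c i) (p - 1)" | "h b = out (h a)"
      using ip nb[OF cV[of i], of p] by (auto simp: hu split: if_splits)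
    then show ?thesis
    proof cases
      case 1
      then have "h b = h (T.u i (p + 1))" using ip by (simp add: hu)
      then have "b = T.u i (p + 1)" using inj b T.u_mem[of i] ip by (auto dest: inj_onD)
      then show ?thesis using T.arc_next ip by simp
    next
      case 2
      then have "h b = h (T.u i (p - 1))" using ip by (simp add: hu)
      then have "b = T.u i (p - 1)" using inj b T.u_mem[of i] ip by (auto dest: inj_onD)
      then show ?thesis using T.arc_sym[OF T.arc_next[of i "p - 1"]] ip by simp
    next
      case 3
      show ?thesis
      proof (cases "same_type p")
        case True
        then show ?thesis using O[OF 3] ip b by blast
      next
        case False
        have "sig (h a) = - 1" using False ip by (simp add: hu sig_walk cV cs)
        then have "sig (h b) = 1" using 3 hV[OF a] by (simp add: sig_out)
        then have "same_type p'" using ip' by (auto simp: hu sig_walk cV cs split: if_splits)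
        moreover have "h a = out (h b)" using 3 hV[OF a] by (simp add: out_out)
        ultimately have "(b, a) \<in> parcs T.X" using O ip' a by blast
        then show ?thesis by (rule T.arc_sym)
      qed
    qed
  qed
  have iso: "graph_isomorphism h T.X \<Gamma>"
    using bij fwd bwd by (auto simp: graph_isomorphism_def)
  let ?N = "natural_two_factor m n T.X"
  let ?C = "\<lambda>i. \<lparr> pverts = {v \<in> V. layer v = i},
        parcs = {(v, w). v \<in> V \<and> layer v = i \<and> w \<in> {mate v, flip v}} \<rparr>"
  let ?D = "\<lambda>i. \<lparr> pverts = {i} \<times> {0..<n}, parcs = parcs T.X \<inter> ({i} \<times> {0..<n}) \<times> ({i} \<times> {0..<n}) \<rparr>"
  have N: "?N = ?D ` {0..<m}" by (simp add: natural_two_factor_def Let_def)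
  have img: "graph_image h (?D i) = ?C i" if i: "i \<in> {0..<m}" for i
  proof -
    have sub: "{i} \<times> {0..<n} \<subseteq> pverts T.X" using i by (auto simp: T.pverts_X)
    have hi: "a \<in> {i} \<times> {0..<n} \<longleftrightarrow> layer (h a) = i" if "a \<in> pverts T.X" for a
      using that hlayer by (cases a) (auto simp: T.pverts_X)
    have v: "h ` ({i} \<times> {0..<n}) = {v \<in> V. layer v = i}"
    proof
      show "h ` ({i} \<times> {0..<n}) \<subseteq> {v \<in> V. layer v = i}" using sub hV hi by blast
      show "{v \<in> V. layer v = i} \<subseteq> h ` ({i} \<times> {0..<n})"
      proof
        fix v assume v: "v \<in> {v \<in> V. layer v = i}"
        then obtain a where "a \<in> pverts T.X" "v = h a" using surj by blast
        then show "v \<in> h ` ({i} \<times> {0..<n})" using v hi by blast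
      qed
    qed
    have "map_prod h h ` (parcs T.X \<inter> ({i} \<times> {0..<n}) \<times> ({i} \<times> {0..<n})) =
       {(v, w). v \<in> V \<and> layer v = i \<and> w \<in> {mate v, flip v}}" (is "?A = ?B")
    proof
      show "?A \<subseteq> ?B"
      proof
        fix e assume "e \<in> ?A"
        then obtain a b where ab: "e = (h a, h b)" "(a, b) \<in> parcs T.X"
          "a \<in> {i} \<times> {0..<n}" "b \<in> {i} \<times> {0..<n}" by auto
        then have "(h a, h b) \<in> parcs \<Gamma>" "layer (h a) = i" "layer (h b) = i"
          using fwd hi sub by blast+
        then show "e \<in> ?B" using ab(1) out_not_layer[of "h a"] by (auto simp: arcs)
      qed
      show "?B \<subseteq> ?A"
      proof
        fix e assume e: "e \<in> ?B"
        then obtain v w where vw: "e = (v, w)" "v \<in> V" "layer v = i" "w \<in> {mate v, flip v}" by blast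
        then have w: "w \<in> V" "layer w = i" "(v, w) \<in> parcs \<Gamma>"
          by (auto simp: mate_in flip_in layer_mate layer_flip arcs)
        have "v \<in> h ` ({i} \<times> {0..<n})" "w \<in> h ` ({i} \<times> {0..<n})"
          unfolding v using vw w by simp_all
        then obtain a b where ab: "a \<in> {i} \<times> {0..<n}" "b \<in> {i} \<times> {0..<n}" "v = h a" "w = h b"
          by (elim imageE)
        then have "a \<in> pverts T.X" "b \<in> pverts T.X" using sub by (auto dest: subsetD)
        then have "(a, b) \<in> parcs T.X" using bwd w(3) ab(3,4) by simp
        then show "e \<in> ?A" using ab vw(1) by (intro image_eqI[of _ _ "(a, b)"]) auto
      qed
    qed
    then show ?thesis by (simp add: graph_image_def v)
  qed
  have "graph_image h ` ?N = \<C>"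
    unfolding N factor image_image using img by (intro image_cong) auto
  moreover have "inj_on (graph_image h) ?N"
  proof (rule inj_onI)
    fix A B assume "A \<in> ?N" "B \<in> ?N" and eq: "graph_image h A = graph_image h B"
    then obtain i j where ij: "A = ?D i" "B = ?D j" "i \<in> {0..<m}" "j \<in> {0..<m}"
      unfolding N by (elim imageE)
    then have "?C i = ?C j" using eq img[OF ij(3)] img[OF ij(4)] by simp
    then have "{v \<in> V. layer v = i} = {v \<in> V. layer v = j}" by simp
    moreover have "c i \<in> {v \<in> V. layer v = i}" using ij cV cl by simp
    ultimately have "c i \<in> {v \<in> V. layer v = j}" by simp
    then have "i = j" using cl[of i] ij(3) by simp
    then show "A = B" using ij by simp
  qed
  ultimately have "bij_betw (graph_image h) ?N \<C>" by (simp add: bij_betw_def)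
  from graph_image_inv[OF natural_two_factor_inner[OF T.pverts_X] bij this]
  have "graph_image (inv_into (pverts T.X) h) ` \<C> = ?N" by (simp add: bij_betw_def)
  then show ?thesis using graph_isomorphism_inv[OF iso] by (auto simp: iso_with_factor_def)
qed

end

section \<open>Cycle systems with a transitive group\<close>

text \<open>
  By \<open>homogeneous_of_group\<close>, a transitive group that permutes the cycles is such a set \<open>G\<close>.
\<close>
locale homogeneous_system = bialternating_system +
  fixes G :: "('a \<Rightarrow> 'a) set"
  assumes G_in: "g \<in> G \<Longrightarrow> v \<in> pverts \<Gamma> \<Longrightarrow> g v \<in> pverts \<Gamma>"
    and G_mate: "g \<in> G \<Longrightarrow> v \<in> pverts \<Gamma> \<Longrightarrow> g (mate v) = mate (g v)"
    and G_flip: "g \<in> G \<Longrightarrow> v \<in> pverts \<Gamma> \<Longrightarrow> g (flip v) = flip (g v)"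
    and G_out: "g \<in> G \<Longrightarrow> v \<in> pverts \<Gamma> \<Longrightarrow> g (out v) = out (g v)"
    and G_trans: "v \<in> pverts \<Gamma> \<Longrightarrow> w \<in> pverts \<Gamma> \<Longrightarrow> \<exists>g\<in>G. g v = w"
begin

lemma G_walk:
  assumes "g \<in> G" "v \<in> V"
  shows "g (walk v j) = walk (g v) j"
  by (rule walk_unique[where s = mate and d = flip, symmetric])
     (simp_all add: assms mate_walk flip_walk walk_0 walk_in G_in flip: G_mate G_flip)

lemma G_advance: "g \<in> G \<Longrightarrow> v \<in> V \<Longrightarrow> g (advance v) = advance (g v)"
  by (simp add: advance_def G_flip G_mate G_out mate_in out_in)

lemma G_advance_pow: "g \<in> G \<Longrightarrow> v \<in> V \<Longrightarrow> g ((advance ^^ j) v) = (advance ^^ j) (g v)"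
  by (induction j) (simp_all add: G_advance advance_pow_in)

text \<open>
  The reduction of \<open>p\<close> modulo \<open>n\<close> makes the choice depend on the residue class only.
\<close>
definition "twist p = (SOME k. out (walk base (p mod n)) = walk (out base) k)"

lemma out_walk_base:
  assumes "same_type p"
  shows "out (walk base p) = walk (out base) (twist p)"
proof -
  have p: "walk base (p mod n) = walk base p" by (intro walk_cong base) (simp add: cong_def)
  have "layer (out (walk base p)) = layer (out base)"
    using assms base by (simp add: layer_out layer_walk sig_walk walk_in)
  then have "\<exists>k. out (walk base p) = walk (out base) k"
    using base by (intro same_layer_walk) (simp_all add: out_in walk_in)
  then have "\<exists>k. out (walk base (p mod n)) = walk (out base) k" by (simp only: p)
  from someI_ex[OF this] show ?thesis by (simp add: twist_def p)
qed

text \<open>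
  Transport along \<open>G\<close> shows that one and the same permutation \<open>twist\<close> of positions describes \<open>out\<close>
  everywhere. Applying this at the two points \<open>v\<close> and \<open>walk v k\<close> makes \<open>twist\<close> a homomorphism.
\<close>
lemma out_walk:
  assumes v: "v \<in> V" and p: "same_type p"
  shows "out (walk v p) = walk (out v) (twist p)"
proof -
  obtain g where g: "g \<in> G" "g base = v" using G_trans[OF base(1) v] by blast
  have "out (walk v p) = g (out (walk base p))"
    using g base by (simp add: G_out walk_in G_walk)
  also have "\<dots> = walk (out v) (twist p)"
    using g base p by (simp add: out_walk_base G_walk G_out out_in)
  finally show ?thesis .
qed

lemma twist_cong: "[p = p'] (mod n) \<Longrightarrow> twist p = twist p'"
  by (simp add: twist_def cong_def)

lemma twist_type:
  assumes "same_type p"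
  shows "same_type (twist p)"
proof (rule ccontr)
  assume "\<not> same_type (twist p)"
  then have "sig (out (walk base p)) = 1"
    using out_walk[OF base(1) assms] base by (simp add: sig_walk out_in sig_out)
  moreover have "sig (out (walk base p)) = - 1"
    using assms base by (simp add: sig_out sig_walk walk_in)
  ultimately show False by simp
qed

lemma twist_hom:
  assumes "same_type k" "same_type p"
  shows "[twist (k \<star> p) = twist k \<star> twist p] (mod n)"
proof -
  have "walk (out base) (twist (k \<star> p)) = out (walk (walk base k) p)"
    using assms base by (simp add: walk_walk out_walk same_type_mult)
  also have "\<dots> = walk (out (walk base k)) (twist p)"
    by (intro out_walk walk_in base assms)
  also have "out (walk base k) = walk (out base) (twist k)" by (intro out_walk base assms)
  also have "walk (walk (out base) (twist k)) (twist p) = walk (out base) (twist k \<star> twist p)"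
    using base by (intro walk_walk out_in)
  finally show ?thesis using base by (simp add: walk_eq_iff out_in)
qed

lemma twist_twist:
  assumes "same_type p"
  shows "[twist (twist p) = p] (mod n)"
proof -
  have "walk base p = out (walk (out base) (twist p))"
    using assms base by (simp flip: out_walk add: out_out walk_in)
  also have "\<dots> = walk base (twist (twist p))"
    using base assms by (simp add: out_walk out_in twist_type out_out)
  finally show ?thesis using base by (simp add: walk_eq_iff cong_sym_eq)
qed

lemma dihedral_involution_twist: "dihedral_involution n twist"
  using n_ge n_dvd_4 twist_type twist_hom twist_twist
  by unfold_locales (auto dest: twist_cong)

sublocale dihedral_involution n twist by (rule dihedral_involution_twist)

abbreviation "\<psi> \<equiv> conj_twist twist"

lemma advance_walk:
  assumes "v \<in> V" "same_type p"
  shows "advance (walk v p) = walk (advance v) (\<psi> p)"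
proof -
  have "advance (walk v p) = walk (out v) (twist p \<star> (1 \<star> - 1))"
    using assms by (simp add: advance_def out_walk mate_walk flip_walk out_in dih_assoc)
  also have "\<dots> = walk (advance v) (\<psi> p)"
    using assms by (simp add: out_eq_walk_advance conj_twist_def dih_assoc)
      (simp add: dih_mult_def parity_sign_def)
  finally show ?thesis .
qed

lemma conj_twist_pow_type: "same_type p \<Longrightarrow> same_type ((\<psi> ^^ j) p)"
  by (induction j) (auto intro: conj_twist_type)

lemma advance_pow_walk:
  assumes "v \<in> V" "same_type p"
  shows "(advance ^^ j) (walk v p) = walk ((advance ^^ j) v) ((\<psi> ^^ j) p)"
  using assms by (induction j) (simp_all add: advance_walk advance_pow_in conj_twist_pow_type)

lemma common_return: "\<exists>y. same_type y \<and> (\<forall>v\<in>V. (advance ^^ nat m) v = walk v y)"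
proof -
  obtain y where y: "same_type y" "(advance ^^ nat m) base = walk base y"
    using exists_return[OF base(1)] by blast
  have "(advance ^^ nat m) v = walk v y" if v: "v \<in> V" for v
  proof -
    obtain g where g: "g \<in> G" "g base = v" using G_trans[OF base(1) v] by blast
    have "(advance ^^ nat m) v = g ((advance ^^ nat m) base)" using g base by (simp add: G_advance_pow)
    then show ?thesis using g base y by (simp add: G_walk)
  qed
  then show ?thesis using y(1) by blast
qed

text \<open>
  \<open>walk w (- 1)\<close> is \<open>flip w\<close>, from where \<open>advance\<close> leads in the opposite direction.
\<close>
lemma advance_pow_reversal:
  assumes "v \<in> V"
  shows "(advance ^^ j) (walk ((advance ^^ j) v) (- 1)) = walk v (- 1 \<star> reversal_shift twist j)"
  using assms
proof (induction j arbitrary: v)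
  case (Suc j)
  let ?v = "advance v"
  have v: "?v \<in> V" using Suc.prems by (rule advance_in)
  have "(advance ^^ Suc j) (walk ((advance ^^ Suc j) v) (- 1)) =
      advance ((advance ^^ j) (walk ((advance ^^ j) ?v) (- 1)))"
    by (simp add: funpow_swap1)
  also have "\<dots> = advance (walk (walk ?v (- 1)) (reversal_shift twist j))"
    using Suc.IH[OF v] v by (simp add: walk_walk)
  also have "\<dots> = walk (advance (walk ?v (- 1))) (\<psi> (reversal_shift twist j))"
    using v reversal_shift_type by (simp add: advance_walk walk_in)
  also have "advance (walk ?v (- 1)) = walk v (twist 1 \<star> 2)"
  proof -
    have "walk ?v (- 1) = walk (out v) 1"
      using Suc.prems out_eq_walk_advance[of v 1] by (simp add: dih_mult_def parity_sign_def)
    then have "advance (walk ?v (- 1)) = walk v (twist 1 \<star> (1 \<star> - 1))"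
      using Suc.prems by (simp add: advance_def out_walk out_in out_out mate_walk flip_walk dih_assoc)
    then show ?thesis by (simp add: dih_mult_def parity_sign_def)
  qed
  also have "walk (walk v (twist 1 \<star> 2)) (\<psi> (reversal_shift twist j)) =
      walk v (- 1 \<star> (- 1 \<star> (twist 1 \<star> 2 \<star> \<psi> (reversal_shift twist j))))"
    using Suc.prems by (simp add: walk_walk) (simp add: dih_mult_def parity_sign_def algebra_simps)
  finally show ?case by (simp add: dih_assoc)
qed (simp)

text \<open>
  The relations of \<open>cayley_twist\<close> compare two evaluations of the \<open>m\<close>-fold \<open>advance\<close>, which is
  \<open>walk v y\<close> for every \<open>v\<close>. The last part is the relation \<open>y_conj\<close> with an arbitrary element in place
  of 1; its case \<open>k = 4\<close> will relate the parity of \<open>y\<close> to the \<open>m\<close>-th power of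
  the factor by which \<open>twist\<close> multiplies rotations.
\<close>
theorem exists_cayley_twist:
  "\<exists>y. cayley_twist n twist m y \<and> iso_with_factor \<Gamma> \<C> m n (twisted_graph m n twist y) \<and>
     (\<forall>k. same_type k \<longrightarrow> [y \<star> (\<psi> ^^ nat m) k = k \<star> y] (mod n))"
proof -
  obtain y where y: "same_type y" "\<And>v. v \<in> V \<Longrightarrow> (advance ^^ nat m) v = walk v y"
    using common_return by blast
  have ab: "advance base \<in> V" using base by (simp add: advance_in)
  have fixed: "[\<psi> y = y] (mod n)"
  proof -
    have "walk (advance base) y = advance ((advance ^^ nat m) base)"
      using y(2)[OF ab] by (simp add: funpow_swap1)
    also have "\<dots> = walk (advance base) (\<psi> y)" using y base by (simp add: advance_walk)
    finally show ?thesis using ab by (simp add: walk_eq_iff cong_sym_eq)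
  qed
  have conj: "[y \<star> (\<psi> ^^ nat m) k = k \<star> y] (mod n)" if k: "same_type k" for k
  proof -
    have "walk base (y \<star> (\<psi> ^^ nat m) k) = (advance ^^ nat m) (walk base k)"
      using base k y by (simp add: advance_pow_walk walk_walk)
    also have "\<dots> = walk base (k \<star> y)" using base y(2)[of "walk base k"] by (simp add: walk_in walk_walk)
    finally show ?thesis using base by (simp add: walk_eq_iff)
  qed
  have "walk base (y \<star> - 1 \<star> y) = (advance ^^ nat m) (walk ((advance ^^ nat m) base) (- 1))"
    using base y(2)[of base] y(2)[of "walk (walk base y) (- 1)"] by (simp add: walk_in walk_walk)
  also have "\<dots> = walk base (- 1 \<star> reversal_shift twist (nat m))"
    using base by (simp add: advance_pow_reversal)
  finally have rev: "[y \<star> - 1 \<star> y = - 1 \<star> reversal_shift twist (nat m)] (mod n)"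
    using base by (simp add: walk_eq_iff)
  have tw: "cayley_twist n twist m y"
    using dihedral_involution_twist m_ge y(1) fixed conj[OF same_type_1] rev
    by (simp add: cayley_twist_def cayley_twist_axioms_def)
  moreover have "iso_with_factor \<Gamma> \<C> m n (twisted_graph m n twist y)"
    by (rule labelling[OF tw base]) (simp_all add: out_walk advance_pow_in base y)
  ultimately show ?thesis using conj by blast
qed

end

section \<open>Short cycles\<close>

text \<open>
  A closed walk that never turns back contains a cycle: take two equal vertices at minimal distance
  along the walk.
\<close>

lemma girth_le_nonbacktracking:
  fixes f :: "nat \<Rightarrow> 'a"
  assumes "pair_graph \<Gamma>" and k: "0 < k" "f k = f 0"
    and arc: "\<And>i. i < k \<Longrightarrow> (f i, f (Suc i)) \<in> parcs \<Gamma>"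
    and nb: "\<And>i. i + 2 \<le> k \<Longrightarrow> f (i + 2) \<noteq> f i"
  shows "girth \<Gamma> \<le> enat k"
proof -
  interpret pair_graph \<Gamma> by fact
  define rep where "rep d \<longleftrightarrow> 0 < d \<and> (\<exists>i. i + d \<le> k \<and> f (i + d) = f i)" for d
  have "rep k" using k by (auto simp: rep_def)
  define d where "d = (LEAST d. rep d)"
  have d: "rep d" "\<And>d'. rep d' \<Longrightarrow> d \<le> d'" using \<open>rep k\<close> by (auto simp: d_def intro: LeastI Least_le)
  obtain i where i: "0 < d" "i + d \<le> k" "f (i + d) = f i" using d(1) by (auto simp: rep_def)
  have "d \<noteq> 1" using no_loops'[OF arc[of i]] i by auto
  moreover have "d \<noteq> 2" using nb[of i] i by auto
  ultimately have d3: "3 \<le> d" using i by simp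
  let ?p = "map (\<lambda>t. (f t, f (Suc t))) [i..<i + d]"
  have verts: "pawalk_verts (f i) (map (\<lambda>t. (f t, f (Suc t))) [i..<i + e]) = map f [i..<i + Suc e]" for e i
  proof (induction e arbitrary: i)
    case (Suc e)
    have "[i..<i + Suc e] = i # [Suc i..<Suc i + e]" by (simp add: upt_conv_Cons)
    moreover have "[i..<i + Suc (Suc e)] = i # [Suc i..<Suc i + Suc e]"
      by (simp add: upt_conv_Cons del: upt_Suc)
    ultimately show ?case using Suc[of "Suc i"] by simp
  qed simp
  have cas: "pcas (f i) (map (\<lambda>t. (f t, f (Suc t))) [i..<i + e]) (f (i + e))" for e i
  proof (induction e arbitrary: i)
    case (Suc e)
    have "[i..<i + Suc e] = i # [Suc i..<Suc i + e]" by (simp add: upt_conv_Cons)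
    then show ?case using Suc[of "Suc i"] by simp
  qed simp
  have "inj_on f {Suc i..<i + Suc d}"
  proof -
    have "\<not> (s < t \<and> f s = f t)" if "s \<in> {Suc i..<i + Suc d}" "t \<in> {Suc i..<i + Suc d}" for s t
    proof
      assume st: "s < t \<and> f s = f t"
      then have "rep (t - s)" using that i by (auto simp: rep_def intro!: exI[of _ s])
      then have "d \<le> t - s" by (rule d(2))
      then show False using that by auto
    qed
    then show ?thesis by (metis inj_onI linorder_neqE_nat)
  qed
  then have "distinct (tl (map f [i..<i + Suc d]))"
    by (simp add: distinct_map upt_conv_Cons del: upt_Suc)
  moreover have "awalk (f i) ?p (f i)"
    using arc[of i] arc i cas[of i d] in_arcsD1[of "f i" "f (Suc i)"]
    by (auto simp: awalk_def)
  ultimately have "cycle ?p"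
    unfolding cycle_def using verts[of i d] i(1) by (intro exI[of _ "f i"]) (simp del: upt_Suc)
  then have "girth \<Gamma> \<le> enat (length ?p)"
    unfolding girth_def using d3 by (intro INF_lower) simp
  then show ?thesis using i(2) by (simp add: order_trans)
qed

lemma (in bialternating_system) arc_nbrs:
  "v \<in> V \<Longrightarrow> (v, mate v) \<in> parcs \<Gamma>" "v \<in> V \<Longrightarrow> (v, flip v) \<in> parcs \<Gamma>" "v \<in> V \<Longrightarrow> (v, out v) \<in> parcs \<Gamma>"
  by (auto simp: arcs)

lemma (in bialternating_system) girth_le_cycle:
  assumes "pair_graph \<Gamma>"
  shows "girth \<Gamma> \<le> enat (nat n)"
proof -
  obtain v where v: "v \<in> V" using nonempty by blast
  show ?thesis
  proof (rule girth_le_nonbacktracking[OF assms, where f = "\<lambda>i. walk v (int i)"])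
    show "0 < nat n" using n_ge by simp
    show "walk v (int (nat n)) = walk v (int 0)" using v n_ge by (simp add: walk_eq_iff cong_def)
    show "(walk v (int i), walk v (int (Suc i))) \<in> parcs \<Gamma>" for i
      using v arc_nbrs[OF walk_in[OF v, of "int i"]]
      by (cases "even i") (auto simp: mate_walk flip_walk dih_mult_def parity_sign_def add.commute)
    show "walk v (int (i + 2)) \<noteq> walk v (int i)" for i
      using v n_ge zdvd_imp_le[of n 2] by (auto simp: walk_eq_iff cong_iff_dvd_diff)
  qed
qed

text \<open>
  The word \<open>out\<close>, \<open>mate\<close>, \<open>out\<close>, \<open>mate\<close>, \<open>flip\<close> leads from \<open>v\<close> to position \<open>twist 1 \<star> 1 \<star> - 1\<close>
  of the same cycle. This is a product of three reflections, hence a reflection, and applying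
  the word twice closes up.
\<close>
lemma (in homogeneous_system) girth_le_10:
  assumes "pair_graph \<Gamma>" "odd (twist 1)"
  shows "girth \<Gamma> \<le> 10"
proof -
  define step where "step i = (if i mod 5 = 4 then flip else if even (i mod 5) then out else mate)" for i :: nat
  define f where "f = rec_nat base (\<lambda>i. step i)"
  have f: "f 0 = base" "\<And>i. f (Suc i) = step i (f i)" by (auto simp: f_def)
  have fV: "f i \<in> V" for i by (induction i) (auto simp: f base step_def flip_in out_in mate_in)
  have five: "f (i + 5) = walk (f i) (twist 1 \<star> 1 \<star> - 1)" if "i mod 5 = 0" for i
  proof -
    have m: "Suc i mod 5 = 1" "Suc (Suc i) mod 5 = 2" "Suc (Suc (Suc i)) mod 5 = 3"
      "Suc (Suc (Suc (Suc i))) mod 5 = 4"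
      using that by (simp_all add: mod_Suc)
    have "step i = out" "step (Suc i) = mate" "step (Suc (Suc i)) = out"
      "step (Suc (Suc (Suc i))) = mate" "step (Suc (Suc (Suc (Suc i)))) = flip"
      unfolding step_def m that by simp_all
    moreover have "i + 5 = Suc (Suc (Suc (Suc (Suc i))))" by simp
    ultimately have "f (i + 5) = flip (mate (out (mate (out (f i)))))"
      by (simp only: f)
    also have "mate (out (f i)) = walk (out (f i)) 1" by (simp add: mate_eq_walk out_in fV)
    finally show ?thesis by (simp add: out_walk out_in fV out_out mate_walk flip_walk)
  qed
  have ten: "f 10 = f 0"
  proof -
    have "f 10 = walk (f 0) ((twist 1 \<star> 1 \<star> - 1) \<star> (twist 1 \<star> 1 \<star> - 1))"
      using five[of 0] five[of 5] by (simp add: walk_walk fV)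
    moreover have "(twist 1 \<star> 1 \<star> - 1) \<star> (twist 1 \<star> 1 \<star> - 1) = 0"
      using assms(2) by (simp add: dih_mult_def parity_sign_def)
    ultimately show ?thesis by (simp add: walk_0 fV)
  qed
  have "girth \<Gamma> \<le> enat 10"
  proof (rule girth_le_nonbacktracking[OF assms(1), where f = f])
    show "(f i, f (Suc i)) \<in> parcs \<Gamma>" for i
      using arc_nbrs[OF fV[of i]] by (simp add: f step_def)
    show "f (i + 2) \<noteq> f i" for i
    proof
      assume eq: "f (i + 2) = f i"
      have inv: "step j (step j v) = v" if "v \<in> V" for j v
        using that by (simp add: step_def mate_mate flip_flip out_out)
      have "f (i + 2) = step (Suc i) (step i (f i))" by (simp add: f)
      then have "step (Suc i) (f i) = step i (f i)"
        using eq inv[OF fV[of "Suc i"], of "Suc i"] f(2)[of i] by simp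
      moreover have "step (Suc i) v \<noteq> step i v" if "v \<in> V" for v
      proof -
        have "i mod 5 = 0 \<or> i mod 5 = 1 \<or> i mod 5 = 2 \<or> i mod 5 = 3 \<or> i mod 5 = 4" by presburger
        then show ?thesis using nbrs_distinct[OF that] by (auto simp: step_def mod_Suc)
      qed
      ultimately show False using fV by blast
    qed
  qed (use ten in simp_all)
  then show ?thesis by (simp add: numeral_eq_enat)
qed

section \<open>Affine twists\<close>

lemma cong_scale4: "[4 * u = 4 * v] (mod 4 * n0) \<longleftrightarrow> [u = v] (mod (n0::int))"
proof -
  have "4 * u - 4 * v = 4 * (u - v)" by simp
  then show ?thesis by (simp only: cong_iff_dvd_diff dvd_mult_cancel_left) simp
qed

lemma cong_subst:
  fixes a b :: int
  assumes "[a = b] (mod k)"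
  shows "[a = c] (mod k) \<longleftrightarrow> [b = c] (mod k)" "[c = a] (mod k) \<longleftrightarrow> [c = b] (mod k)"
  using assms by (simp_all add: cong_def)

lemma cong_scale4_1: "[4 * u + 1 = 4 * v + 1] (mod 4 * n0) \<longleftrightarrow> [u = v] (mod (n0::int))"
  using cong_scale4[of u v n0] by (simp add: cong_iff_dvd_diff)

lemma dih_mult_4 [simp]: "4 * a \<star> c = 4 * a + c"
  by (simp add: dih_mult_def parity_sign_def)

lemma dih_mult_4_1 [simp]: "(4 * a + 1) \<star> c = 4 * a + 1 - c"
  by (simp add: dih_mult_def parity_sign_def)

text \<open>
  For the affine twists below, \<open>(conj_twist \<pi> ^^ j) 1\<close> is \<open>4 * drift b0 a0 j + 1\<close> and
  \<open>reversal_shift \<pi> j\<close> is \<open>4 * reversal_drift b0 a0 j\<close>.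
\<close>
fun drift :: "int \<Rightarrow> int \<Rightarrow> nat \<Rightarrow> int" where
  "drift b0 a0 0 = 0"
| "drift b0 a0 (Suc j) = b0 * drift b0 a0 j + a0 - 1"

fun reversal_drift :: "int \<Rightarrow> int \<Rightarrow> nat \<Rightarrow> int" where
  "reversal_drift b0 a0 0 = 0"
| "reversal_drift b0 a0 (Suc j) = b0 * reversal_drift b0 a0 j - a0"

text \<open>
  The twists that preserve rotations: \<open>b0\<close> is the factor by which the exponents of rotations are
  multiplied, \<open>a0\<close> the displacement of the reflection 1.
\<close>
locale affine_twist =
  fixes n0 b0 a0 :: int and \<pi> :: "int \<Rightarrow> int"
  assumes cong: "[p = p'] (mod 4 * n0) \<Longrightarrow> [\<pi> p = \<pi> p'] (mod 4 * n0)"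
    and pi_0: "[\<pi> (4 * x) = 4 * (b0 * x)] (mod 4 * n0)"
    and pi_1: "[\<pi> (4 * x + 1) = 4 * (b0 * x + a0) + 1] (mod 4 * n0)"
begin

lemma even_mod: "even (4 * n0)" by simp

lemmas mult_cong = dih_mult_cong[OF even_mod]

lemma conj_twist_cong: "[p = p'] (mod 4 * n0) \<Longrightarrow> [conj_twist \<pi> p = conj_twist \<pi> p'] (mod 4 * n0)"
  unfolding conj_twist_def by (intro mult_cong cong cong_refl)

lemma conj_twist_0: "[conj_twist \<pi> (4 * x) = 4 * (b0 * x)] (mod 4 * n0)"
proof -
  have "[- 2 \<star> \<pi> (4 * x) \<star> 2 = - 2 \<star> (4 * (b0 * x)) \<star> 2] (mod 4 * n0)"
    by (intro mult_cong cong_refl pi_0)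
  moreover have "- 2 \<star> (4 * (b0 * x)) \<star> 2 = 4 * (b0 * x)"
    by (simp add: dih_mult_def parity_sign_def)
  ultimately show ?thesis by (simp add: conj_twist_def)
qed

lemma conj_twist_1: "[conj_twist \<pi> (4 * x + 1) = 4 * (b0 * x + a0 - 1) + 1] (mod 4 * n0)"
proof -
  have "[- 2 \<star> \<pi> (4 * x + 1) \<star> 2 = - 2 \<star> (4 * (b0 * x + a0) + 1) \<star> 2] (mod 4 * n0)"
    by (intro mult_cong cong_refl pi_1)
  moreover have "- 2 \<star> (4 * (b0 * x + a0) + 1) \<star> 2 = 4 * (b0 * x + a0 - 1) + 1"
    by (simp add: dih_mult_def parity_sign_def)
  ultimately show ?thesis by (simp add: conj_twist_def)
qed

lemma conj_twist_pow_1: "[(conj_twist \<pi> ^^ j) 1 = 4 * drift b0 a0 j + 1] (mod 4 * n0)"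
proof (induction j)
  case (Suc j)
  show ?case using cong_trans[OF conj_twist_cong[OF Suc] conj_twist_1] by simp
qed simp

lemma conj_twist_pow_4: "[(conj_twist \<pi> ^^ j) 4 = 4 * b0 ^ j] (mod 4 * n0)"
proof (induction j)
  case (Suc j)
  show ?case using cong_trans[OF conj_twist_cong[OF Suc] conj_twist_0[of "b0 ^ j"]] by simp
qed simp

lemma reversal_shift_cong: "[reversal_shift \<pi> j = 4 * reversal_drift b0 a0 j] (mod 4 * n0)"
proof (induction j)
  case (Suc j)
  have "[\<pi> 1 = 4 * a0 + 1] (mod 4 * n0)" using pi_1[of 0] by simp
  then have "[- 1 \<star> \<pi> 1 \<star> 2 \<star> conj_twist \<pi> (reversal_shift \<pi> j) =
      - 1 \<star> (4 * a0 + 1) \<star> 2 \<star> (4 * (b0 * reversal_drift b0 a0 j))] (mod 4 * n0)"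
    by (intro mult_cong cong_refl cong_trans[OF conj_twist_cong[OF Suc] conj_twist_0])
  moreover have "- 1 \<star> (4 * a0 + 1) \<star> 2 \<star> (4 * (b0 * reversal_drift b0 a0 j)) =
      4 * (b0 * reversal_drift b0 a0 j - a0)"
    by (simp add: dih_mult_def parity_sign_def)
  ultimately show ?case by simp
qed simp

text \<open>
  The relations of \<open>cayley_twist\<close>, and \<open>y_conj\<close> for 4 in place of 1, written modulo \<open>n0\<close>: the even
  lemmas are for the rotations \<open>y = 4 * z\<close>, the odd ones for the reflections \<open>y = 4 * z + 1\<close>.
\<close>
lemma fixed_even: "[conj_twist \<pi> (4 * z) = 4 * z] (mod 4 * n0) \<longleftrightarrow> [b0 * z = z] (mod n0)"
  by (simp only: cong_subst(1)[OF conj_twist_0] cong_scale4)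

lemma fixed_odd:
  "[conj_twist \<pi> (4 * z + 1) = 4 * z + 1] (mod 4 * n0) \<longleftrightarrow> [b0 * z + a0 - 1 = z] (mod n0)"
  by (simp only: cong_subst(1)[OF conj_twist_1] cong_scale4_1)

lemma conj_even:
  "[4 * z \<star> ((conj_twist \<pi> ^^ j) 1) = 1 \<star> (4 * z)] (mod 4 * n0) \<longleftrightarrow> [2 * z + drift b0 a0 j = 0] (mod n0)"
proof -
  have 1: "[4 * z \<star> ((conj_twist \<pi> ^^ j) 1) = 4 * z \<star> (4 * drift b0 a0 j + 1)] (mod 4 * n0)"
    by (intro mult_cong cong_refl conj_twist_pow_1)
  have 2: "4 * z \<star> (4 * drift b0 a0 j + 1) = 4 * (z + drift b0 a0 j) + 1" by simp
  have 3: "1 \<star> (4 * z) = 4 * (- z) + 1" by (simp add: dih_mult_def parity_sign_def)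
  have "[4 * z \<star> ((conj_twist \<pi> ^^ j) 1) = 1 \<star> (4 * z)] (mod 4 * n0) \<longleftrightarrow>
      [4 * (z + drift b0 a0 j) + 1 = 4 * (- z) + 1] (mod 4 * n0)"
    by (simp only: cong_subst(1)[OF 1] 2 3)
  then show ?thesis by (simp only: cong_scale4_1) (simp add: cong_iff_dvd_diff algebra_simps)
qed

lemma conj_odd:
  "[(4 * z + 1) \<star> ((conj_twist \<pi> ^^ j) 1) = 1 \<star> (4 * z + 1)] (mod 4 * n0) \<longleftrightarrow>
    [2 * z = drift b0 a0 j] (mod n0)"
proof -
  have 1: "[(4 * z + 1) \<star> ((conj_twist \<pi> ^^ j) 1) = (4 * z + 1) \<star> (4 * drift b0 a0 j + 1)] (mod 4 * n0)"
    by (intro mult_cong cong_refl conj_twist_pow_1)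
  have 2: "(4 * z + 1) \<star> (4 * drift b0 a0 j + 1) = 4 * (z - drift b0 a0 j)" by simp
  have 3: "1 \<star> (4 * z + 1) = 4 * (- z)" by (simp add: dih_mult_def parity_sign_def)
  have "[(4 * z + 1) \<star> ((conj_twist \<pi> ^^ j) 1) = 1 \<star> (4 * z + 1)] (mod 4 * n0) \<longleftrightarrow>
      [4 * (z - drift b0 a0 j) = 4 * (- z)] (mod 4 * n0)"
    by (simp only: cong_subst(1)[OF 1] 2 3)
  then show ?thesis by (simp only: cong_scale4) (simp add: cong_iff_dvd_diff algebra_simps)
qed

lemma conj4_even:
  "[4 * z \<star> ((conj_twist \<pi> ^^ j) 4) = 4 \<star> (4 * z)] (mod 4 * n0) \<longleftrightarrow> [b0 ^ j = 1] (mod n0)"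
proof -
  have 1: "[4 * z \<star> ((conj_twist \<pi> ^^ j) 4) = 4 * z \<star> (4 * b0 ^ j)] (mod 4 * n0)"
    by (intro mult_cong cong_refl conj_twist_pow_4)
  have 2: "4 * z \<star> (4 * b0 ^ j) = 4 * (z + b0 ^ j)" by simp
  have 3: "4 \<star> (4 * z) = 4 * (1 + z)" by (simp add: dih_mult_def parity_sign_def)
  have "[4 * z \<star> ((conj_twist \<pi> ^^ j) 4) = 4 \<star> (4 * z)] (mod 4 * n0) \<longleftrightarrow>
      [4 * (z + b0 ^ j) = 4 * (1 + z)] (mod 4 * n0)"
    by (simp only: cong_subst(1)[OF 1] 2 3)
  then show ?thesis by (simp only: cong_scale4) (simp add: cong_iff_dvd_diff algebra_simps)
qed

lemma conj4_odd:
  "[(4 * z + 1) \<star> ((conj_twist \<pi> ^^ j) 4) = 4 \<star> (4 * z + 1)] (mod 4 * n0) \<longleftrightarrow> [b0 ^ j = - 1] (mod n0)"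
proof -
  have 1: "[(4 * z + 1) \<star> ((conj_twist \<pi> ^^ j) 4) = (4 * z + 1) \<star> (4 * b0 ^ j)] (mod 4 * n0)"
    by (intro mult_cong cong_refl conj_twist_pow_4)
  have 2: "(4 * z + 1) \<star> (4 * b0 ^ j) = 4 * (z - b0 ^ j) + 1" by simp
  have 3: "4 \<star> (4 * z + 1) = 4 * (1 + z) + 1" by (simp add: dih_mult_def parity_sign_def)
  have "[(4 * z + 1) \<star> ((conj_twist \<pi> ^^ j) 4) = 4 \<star> (4 * z + 1)] (mod 4 * n0) \<longleftrightarrow>
      [4 * (z - b0 ^ j) + 1 = 4 * (1 + z) + 1] (mod 4 * n0)"
    by (simp only: cong_subst(1)[OF 1] 2 3)
  moreover have "[z - b0 ^ j = 1 + z] (mod n0) \<longleftrightarrow> [b0 ^ j = - 1] (mod n0)"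
    using dvd_minus_iff[of n0 "z - b0 ^ j - (1 + z)"] by (simp add: cong_iff_dvd_diff algebra_simps)
  ultimately show ?thesis by (simp only: cong_scale4_1)
qed

lemma reversal_even:
  "[4 * z \<star> - 1 \<star> (4 * z) = - 1 \<star> reversal_shift \<pi> j] (mod 4 * n0) \<longleftrightarrow> [reversal_drift b0 a0 j = 0] (mod n0)"
proof -
  have 1: "[- 1 \<star> reversal_shift \<pi> j = - 1 \<star> (4 * reversal_drift b0 a0 j)] (mod 4 * n0)"
    by (intro mult_cong cong_refl reversal_shift_cong)
  have 2: "4 * z \<star> - 1 \<star> (4 * z) = - 1" by (simp add: dih_mult_def parity_sign_def)
  have 3: "- 1 \<star> (4 * reversal_drift b0 a0 j) = - 1 - 4 * reversal_drift b0 a0 j"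
    by (simp add: dih_mult_def parity_sign_def)
  have "[4 * z \<star> - 1 \<star> (4 * z) = - 1 \<star> reversal_shift \<pi> j] (mod 4 * n0) \<longleftrightarrow>
      [- 1 = - 1 - 4 * reversal_drift b0 a0 j] (mod 4 * n0)"
    by (simp only: cong_subst(2)[OF 1] 2 3)
  then show ?thesis by (simp add: cong_iff_dvd_diff)
qed

lemma reversal_odd:
  "[(4 * z + 1) \<star> - 1 \<star> (4 * z + 1) = - 1 \<star> reversal_shift \<pi> j] (mod 4 * n0) \<longleftrightarrow>
    [2 * z + 1 + reversal_drift b0 a0 j = 0] (mod n0)"
proof -
  have 1: "[- 1 \<star> reversal_shift \<pi> j = - 1 \<star> (4 * reversal_drift b0 a0 j)] (mod 4 * n0)"
    by (intro mult_cong cong_refl reversal_shift_cong)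
  have 2: "(4 * z + 1) \<star> - 1 \<star> (4 * z + 1) = 8 * z + 3" by (simp add: dih_mult_def parity_sign_def)
  have 3: "- 1 \<star> (4 * reversal_drift b0 a0 j) = - 1 - 4 * reversal_drift b0 a0 j"
    by (simp add: dih_mult_def parity_sign_def)
  have "[(4 * z + 1) \<star> - 1 \<star> (4 * z + 1) = - 1 \<star> reversal_shift \<pi> j] (mod 4 * n0) \<longleftrightarrow>
      [8 * z + 3 = - 1 - 4 * reversal_drift b0 a0 j] (mod 4 * n0)"
    by (simp only: cong_subst(2)[OF 1] 2 3)
  also have "\<dots> \<longleftrightarrow> [4 * (2 * z + 1 + reversal_drift b0 a0 j) = 4 * 0] (mod 4 * n0)"
    by (simp add: cong_iff_dvd_diff algebra_simps)
  finally show ?thesis by (simp only: cong_scale4)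
qed

end

text \<open>The two recursions have period two up to a linear term.\<close>

lemma drift_closed:
  assumes "[b0 * b0 = 1] (mod n0)" "[b0 * a0 + a0 = 0] (mod n0)"
  shows "[drift b0 a0 (2 * k) = - int k * (b0 + 1)] (mod n0)"
    and "[drift b0 a0 (Suc (2 * k)) = - int k * (b0 + 1) + a0 - 1] (mod n0)"
proof -
  have odd: "[drift b0 a0 (Suc j) = - int k * (b0 + 1) + a0 - 1] (mod n0)"
    if "[drift b0 a0 j = - int k * (b0 + 1)] (mod n0)" for j k
  proof -
    have "[b0 * drift b0 a0 j + a0 - 1 = b0 * (- int k * (b0 + 1)) + a0 - 1] (mod n0)"
      by (intro cong_diff cong_add cong_mult cong_refl that)
    also have "b0 * (- int k * (b0 + 1)) + a0 - 1 = - int k * (b0 * b0 + b0) + a0 - 1"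
      by (simp add: algebra_simps)
    also have "[\<dots> = - int k * (1 + b0) + a0 - 1] (mod n0)"
      by (intro cong_diff cong_add cong_mult cong_refl assms)
    finally show ?thesis by (simp add: add.commute)
  qed
  have even: "[drift b0 a0 (Suc (Suc j)) = - int (Suc k) * (b0 + 1)] (mod n0)"
    if "[drift b0 a0 (Suc j) = - int k * (b0 + 1) + a0 - 1] (mod n0)" for j k
  proof -
    have "[b0 * drift b0 a0 (Suc j) + a0 - 1 = b0 * (- int k * (b0 + 1) + a0 - 1) + a0 - 1] (mod n0)"
      by (intro cong_diff cong_add cong_mult cong_refl that)
    also have "b0 * (- int k * (b0 + 1) + a0 - 1) + a0 - 1 =
        - int k * (b0 * b0 + b0) - b0 - 1 + (b0 * a0 + a0)"
      by (simp add: algebra_simps)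
    also have "[\<dots> = - int k * (1 + b0) - b0 - 1 + 0] (mod n0)"
      by (intro cong_diff cong_add cong_mult cong_refl assms)
    also have "- int k * (1 + b0) - b0 - 1 + 0 = - int (Suc k) * (b0 + 1)" by (simp add: algebra_simps)
    finally show ?thesis by simp
  qed
  show e: "[drift b0 a0 (2 * k) = - int k * (b0 + 1)] (mod n0)"
  proof (induction k)
    case (Suc k)
    show ?case using even[OF odd[OF Suc]] by simp
  qed simp
  show "[drift b0 a0 (Suc (2 * k)) = - int k * (b0 + 1) + a0 - 1] (mod n0)" by (rule odd[OF e])
qed

lemma reversal_drift_closed:
  assumes "[b0 * a0 + a0 = 0] (mod n0)"
  shows "[reversal_drift b0 a0 j = (if even j then 0 else - a0)] (mod n0)"
proof (induction j)
  case (Suc j)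
  have "[b0 * reversal_drift b0 a0 j - a0 = b0 * (if even j then 0 else - a0) - a0] (mod n0)"
    by (intro cong_diff cong_mult cong_refl Suc)
  moreover have "[b0 * (- a0) - a0 = 0] (mod n0)"
  proof -
    have "[- (b0 * a0 + a0) = - 0] (mod n0)" using assms by (simp only: cong_minus_minus_iff)
    moreover have "- (b0 * a0 + a0) = b0 * (- a0) - a0" by simp
    ultimately show ?thesis by simp
  qed
  ultimately show ?case by (auto intro: cong_trans)
qed simp

text \<open>
  The rule \<open>4 * j + \<delta> \<mapsto> b * j + \<delta> * a\<close> by which the graphs \<open>Xb\<close> join consecutive layers. Only the
  values at positions with \<open>\<delta> \<in> {0, 1}\<close> matter.
\<close>
definition affine_pi :: "int \<Rightarrow> int \<Rightarrow> int \<Rightarrow> int" where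
  "affine_pi b a p = b * (p div 4) + (p mod 4) * a"

lemma affine_pi_simps [simp]: "affine_pi b a (4 * x) = b * x" "affine_pi b a (4 * x + 1) = b * x + a"
  by (simp_all add: affine_pi_def)

lemma affine_twist_affine_pi: "affine_twist n0 b0 a0 (affine_pi (4 * b0) (4 * a0 + 1))"
proof
  fix p p' :: int assume "[p = p'] (mod 4 * n0)"
  then obtain k where k: "p = p' + 4 * (n0 * k)"
    by (metis cong_iff_lin cong_sym mult.assoc)
  have "p div 4 = p' div 4 + n0 * k" "p mod 4 = p' mod 4" unfolding k by simp_all
  then have "affine_pi (4 * b0) (4 * a0 + 1) p = affine_pi (4 * b0) (4 * a0 + 1) p' + (4 * n0) * (b0 * k)"
    by (simp add: affine_pi_def algebra_simps)
  then show "[affine_pi (4 * b0) (4 * a0 + 1) p = affine_pi (4 * b0) (4 * a0 + 1) p'] (mod 4 * n0)"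
    by (simp add: cong_def)
next
  fix x
  have "affine_pi (4 * b0) (4 * a0 + 1) (4 * x) = 4 * (b0 * x)" by simp
  then show "[affine_pi (4 * b0) (4 * a0 + 1) (4 * x) = 4 * (b0 * x)] (mod 4 * n0)"
    by (simp only: cong_refl)
  have "affine_pi (4 * b0) (4 * a0 + 1) (4 * x + 1) = 4 * (b0 * x + a0) + 1" by simp
  then show "[affine_pi (4 * b0) (4 * a0 + 1) (4 * x + 1) = 4 * (b0 * x + a0) + 1] (mod 4 * n0)"
    by (simp only: cong_refl)
qed

lemma affine_dihedral_involution:
  assumes "1 \<le> n0" "[b0 * b0 = 1] (mod n0)" "[b0 * a0 + a0 = 0] (mod n0)"
  shows "dihedral_involution (4 * n0) (affine_pi (4 * b0) (4 * a0 + 1))"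
proof -
  interpret affine_twist n0 b0 a0 "affine_pi (4 * b0) (4 * a0 + 1)"
    by (rule affine_twist_affine_pi)
  let ?p = "affine_pi (4 * b0) (4 * a0 + 1)"
  have e1: "?p (4 * x + 1) = 4 * (b0 * x + a0) + 1" for x by simp
  have e0: "?p (4 * x) = 4 * (b0 * x)" for x by simp
  show ?thesis
  proof
    show "0 < 4 * n0" "4 dvd 4 * n0" using assms(1) by simp_all
    show "[?p p = ?p p'] (mod 4 * n0)" if "[p = p'] (mod 4 * n0)" for p p' using that by (rule cong)
    show "same_type (?p p)" if "same_type p" for p
      using that by (rule same_type_cases) (simp_all only: e0 e1 same_type_simps)
    show "[?p (k \<star> p) = ?p k \<star> ?p p] (mod 4 * n0)" if "same_type k" "same_type p" for k p
    proof -
      have "?p (k \<star> p) = ?p k \<star> ?p p"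
      proof (rule same_type_cases[OF that(1)]; rule same_type_cases[OF that(2)])
        fix x y assume "k = 4 * x" "p = 4 * y"
        moreover have "4 * x \<star> (4 * y) = 4 * (x + y)" by simp
        ultimately show ?thesis by (simp only: e0 dih_mult_4) (simp add: algebra_simps)
      next
        fix x y assume "k = 4 * x" "p = 4 * y + 1"
        moreover have "4 * x \<star> (4 * y + 1) = 4 * (x + y) + 1" by simp
        ultimately show ?thesis by (simp only: e0 e1 dih_mult_4) (simp add: algebra_simps)
      next
        fix x y assume "k = 4 * x + 1" "p = 4 * y"
        moreover have "(4 * x + 1) \<star> (4 * y) = 4 * (x - y) + 1" by simp
        ultimately show ?thesis by (simp only: e0 e1 dih_mult_4_1) (simp add: algebra_simps)
      next
        fix x y assume "k = 4 * x + 1" "p = 4 * y + 1"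
        moreover have "(4 * x + 1) \<star> (4 * y + 1) = 4 * (x - y)" by simp
        ultimately show ?thesis by (simp only: e0 e1 dih_mult_4_1) (simp add: algebra_simps)
      qed
      then show ?thesis by simp
    qed
    show "[?p (?p p) = p] (mod 4 * n0)" if "same_type p" for p
      using that
    proof (rule same_type_cases)
      fix x assume p: "p = 4 * x"
      have "[b0 * b0 * x = 1 * x] (mod n0)" by (intro cong_mult assms cong_refl)
      then show ?thesis by (simp only: p e0 cong_scale4) (simp add: mult.assoc)
    next
      fix x assume p: "p = 4 * x + 1"
      have "[b0 * b0 * x + (b0 * a0 + a0) = 1 * x + 0] (mod n0)" by (intro cong_add cong_mult assms cong_refl)
      then show ?thesis by (simp only: p e1 cong_scale4_1) (simp add: algebra_simps)
    qed
  qed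
qed

text \<open>
  The relations of \<open>cayley_twist\<close> for an affine twist. The first two congruences say that the
  twist is an involution, at 4 and at 1. The conditional terms are the value of \<open>reversal_drift\<close>,
  which depends on the parity of \<open>m\<close> only.
\<close>
definition twist_params :: "int \<Rightarrow> int \<Rightarrow> int \<Rightarrow> int \<Rightarrow> int \<Rightarrow> bool" where
  "twist_params n0 b0 a0 m y \<longleftrightarrow>
     [b0 * b0 = 1] (mod n0) \<and> [b0 * a0 + a0 = 0] (mod n0) \<and>
     ((\<exists>z. y = 4 * z \<and> [b0 * z = z] (mod n0) \<and> [2 * z + drift b0 a0 (nat m) = 0] (mod n0) \<and>
           [(if even m then 0 else - a0) = 0] (mod n0)) \<or>
      (\<exists>z. y = 4 * z + 1 \<and> [b0 * z + a0 - 1 = z] (mod n0) \<and> [2 * z = drift b0 a0 (nat m)] (mod n0) \<and>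
           [2 * z + 1 + (if even m then 0 else - a0) = 0] (mod n0)))"

lemma (in affine_twist) reversal_parity:
  assumes "[b0 * a0 + a0 = 0] (mod n0)" "0 \<le> m"
  shows "[c + reversal_drift b0 a0 (nat m) = d] (mod n0) \<longleftrightarrow>
    [c + (if even m then 0 else - a0) = d] (mod n0)"
proof -
  have "[c + reversal_drift b0 a0 (nat m) = c + (if even m then 0 else - a0)] (mod n0)"
    using reversal_drift_closed[OF assms(1), of "nat m"] assms(2)
    by (intro cong_add cong_refl) (simp add: even_nat_iff)
  then show ?thesis by (rule cong_subst)
qed

lemma (in affine_twist) cayley_twist_iff:
  assumes "dihedral_involution (4 * n0) \<pi>" "0 < m" "same_type y"
  shows "cayley_twist (4 * n0) \<pi> m y \<longleftrightarrow> twist_params n0 b0 a0 m y"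
proof -
  interpret dihedral_involution "4 * n0" \<pi> by fact
  have A1: "[b0 * b0 = 1] (mod n0)"
  proof -
    have "[4 = \<pi> (\<pi> 4)] (mod 4 * n0)" by (intro cong_sym[OF pi_pi]) (use same_type_simps(1)[of 1] in simp)
    also have "[\<pi> (\<pi> 4) = \<pi> (4 * b0)] (mod 4 * n0)" using pi_0[of 1] by (intro pi_cong) simp
    also have "[\<pi> (4 * b0) = 4 * (b0 * b0)] (mod 4 * n0)" by (rule pi_0)
    finally have "[4 * 1 = 4 * (b0 * b0)] (mod 4 * n0)" by simp
    then show ?thesis unfolding cong_scale4 by (rule cong_sym)
  qed
  have A2: "[b0 * a0 + a0 = 0] (mod n0)"
  proof -
    have "[1 = \<pi> (\<pi> 1)] (mod 4 * n0)" by (intro cong_sym[OF pi_pi]) simp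
    also have "[\<pi> (\<pi> 1) = \<pi> (4 * a0 + 1)] (mod 4 * n0)" using pi_1[of 0] by (intro pi_cong) simp
    also have "[\<pi> (4 * a0 + 1) = 4 * (b0 * a0 + a0) + 1] (mod 4 * n0)" by (rule pi_1)
    finally have "[4 * 0 + 1 = 4 * (b0 * a0 + a0) + 1] (mod 4 * n0)" by simp
    then show ?thesis unfolding cong_scale4_1 by (rule cong_sym)
  qed
  have iff: "cayley_twist (4 * n0) \<pi> m y \<longleftrightarrow>
      [conj_twist \<pi> y = y] (mod 4 * n0) \<and> [y \<star> ((conj_twist \<pi> ^^ nat m) 1) = 1 \<star> y] (mod 4 * n0) \<and>
      [y \<star> - 1 \<star> y = - 1 \<star> reversal_shift \<pi> (nat m)] (mod 4 * n0)"
    using assms by (auto simp: cayley_twist_def cayley_twist_axioms_def)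
  have m0: "0 \<le> m" using assms(2) by simp
  have neq: "4 * z \<noteq> 4 * x + (1::int)" for x z by presburger
  show ?thesis
  proof (rule same_type_cases[OF assms(3)])
    fix z assume y: "y = 4 * z"
    show ?thesis
      using A1 A2 neq reversal_parity[OF A2 m0, of 0 0]
      unfolding iff[unfolded y] y twist_params_def fixed_even conj_even reversal_even by auto
  next
    fix z assume y: "y = 4 * z + 1"
    show ?thesis
      using A1 A2 neq[symmetric] reversal_parity[OF A2 m0, of "2 * z + 1" 0]
      unfolding iff[unfolded y] y twist_params_def fixed_odd conj_odd reversal_odd by auto
  qed
qed

section \<open>The listed graphs as twisted layered graphs\<close>

lemma twisted_graph_cong:
  assumes "even n" "[y = y'] (mod n)" "\<And>p. same_type p \<Longrightarrow> [\<pi> p = \<pi>' p] (mod n)"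
  shows "twisted_graph m n \<pi> y = twisted_graph m n \<pi>' y'"
proof -
  have y: "layer_pos m n y i p = layer_pos m n y' i p'" if "[p = p'] (mod n)" for i p p'
    using dih_mult_cong[OF assms(1,2) that] cong_add[OF cong_refl that, of "2 * i"]
    by (simp add: layer_pos_def cong_def)
  have 1: "layer_pos m n y = layer_pos m n y'" by (intro ext y cong_refl)
  have 2: "layer_pos m n y i (- 2 \<star> \<pi> p) = layer_pos m n y' i (- 2 \<star> \<pi>' p)" if "same_type p" for i p
    by (intro y dih_mult_cong[OF assms(1)] cong_refl assms(3) that)
  have "{(layer_pos m n y i p, layer_pos m n y (i + 1) (- 2 \<star> \<pi> p)) | i p. 0 \<le> i \<and> i < m \<and> same_type p} =
      {(layer_pos m n y' i p, layer_pos m n y' (i + 1) (- 2 \<star> \<pi>' p)) | i p. 0 \<le> i \<and> i < m \<and> same_type p}"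
    using 1 2 by (intro Collect_cong ex_cong1) auto
  then show ?thesis using 1 by (simp add: twisted_graph_def Let_def)
qed

definition twist_arcs :: "int \<Rightarrow> int \<Rightarrow> (int \<Rightarrow> int) \<Rightarrow> int \<Rightarrow> ((int \<times> int) \<times> (int \<times> int)) set" where
  "twist_arcs m n \<pi> y = {(layer_pos m n y i p, layer_pos m n y (i + 1) (- 2 \<star> \<pi> p)) | i p.
     0 \<le> i \<and> i < m \<and> same_type p}"

lemma layered_eq_twisted:
  assumes "0 < m"
  shows "layered_graph m n (twist_arcs m n \<pi> y) = twisted_graph m n \<pi> y"
proof -
  have "{(uv m n i j, uv m n i (j + 1)) | i j. True} =
      {(layer_pos m n y i p, layer_pos m n y i (p + 1)) | i p. 0 \<le> i \<and> i < m}" (is "?A = ?B")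
  proof (intro equalityI subsetI)
    fix e assume "e \<in> ?A"
    then obtain i j where "e = (uv m n i j, uv m n i (j + 1))" by blast
    then have "e = (layer_pos m n y (i mod m) (j - 2 * (i mod m)),
        layer_pos m n y (i mod m) (j - 2 * (i mod m) + 1))"
      using assms by (simp add: uv_def layer_pos_def)
    moreover have "0 \<le> i mod m" "i mod m < m" using assms by simp_all
    ultimately show "e \<in> ?B" by blast
  next
    fix e assume "e \<in> ?B"
    then obtain i p where "0 \<le> i" "i < m" "e = (layer_pos m n y i p, layer_pos m n y i (p + 1))" by blast
    then have "e = (uv m n i (2 * i + p), uv m n i (2 * i + p + 1))"
      by (simp add: uv_def layer_pos_def add.assoc)
    then show "e \<in> ?A" by blast
  qed
  then show ?thesis by (simp add: layered_graph_def twisted_graph_def twist_arcs_def Let_def)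
qed

lemma out_arc_inner:
  assumes "0 \<le> i" "i \<le> m - 2"
  shows "(uv m n i (2 * i + p), uv m n (i + 1) (2 * i + \<pi> p)) =
    (layer_pos m n y i p, layer_pos m n y (i + 1) (- 2 \<star> \<pi> p))"
  using assms by (simp add: uv_def layer_pos_def dih_mult_def parity_sign_def algebra_simps)

lemma out_arc_wrap:
  assumes "0 < m" "[l = y - 2 * parity_sign y] (mod n)"
  shows "(uv m n (m - 1) (2 * (m - 1) + p), uv m n 0 (l + parity_sign y * \<pi> p)) =
    (layer_pos m n y (m - 1) p, layer_pos m n y (m - 1 + 1) (- 2 \<star> \<pi> p))"
proof -
  have "[l + parity_sign y * \<pi> p = y - 2 * parity_sign y + parity_sign y * \<pi> p] (mod n)"
    by (intro cong_add assms cong_refl)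
  also have "y - 2 * parity_sign y + parity_sign y * \<pi> p = y \<star> (- 2 \<star> \<pi> p)"
    by (simp add: dih_mult_def parity_sign_def algebra_simps)
  finally have "(l + parity_sign y * \<pi> p) mod n = (y \<star> (- 2 \<star> \<pi> p)) mod n" by (simp only: cong_def)
  then show ?thesis using assms(1) by (simp add: uv_def layer_pos_def zmod_minus1)
qed

lemma twist_arcsI:
  assumes "same_type p" "0 < m"
  shows "0 \<le> i \<Longrightarrow> i \<le> m - 2 \<Longrightarrow> (uv m n i (2 * i + p), uv m n (i + 1) (2 * i + \<pi> p)) \<in> twist_arcs m n \<pi> y"
    and "[l = y - 2 * parity_sign y] (mod n) \<Longrightarrow>
      (uv m n (m - 1) (2 * (m - 1) + p), uv m n 0 (l + parity_sign y * \<pi> p)) \<in> twist_arcs m n \<pi> y"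
proof -
  assume i: "0 \<le> i" "i \<le> m - 2"
  have "i < m" using i by simp
  then show "(uv m n i (2 * i + p), uv m n (i + 1) (2 * i + \<pi> p)) \<in> twist_arcs m n \<pi> y"
    unfolding out_arc_inner[OF i, of n p \<pi> y] twist_arcs_def using i assms by blast
next
  assume l: "[l = y - 2 * parity_sign y] (mod n)"
  have "0 \<le> m - 1" "m - 1 < m" using assms by simp_all
  then show "(uv m n (m - 1) (2 * (m - 1) + p), uv m n 0 (l + parity_sign y * \<pi> p)) \<in> twist_arcs m n \<pi> y"
    unfolding out_arc_wrap[OF assms(2) l, of p \<pi>] twist_arcs_def using assms(1) by blast
qed

text \<open>
  It suffices to take one position from each residue class; \<open>Q\<close> describes such a choice.
\<close>
lemma twist_arcsE:
  assumes "e \<in> twist_arcs m n \<pi> y" "0 < m" "[l = y - 2 * parity_sign y] (mod n)"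
    and repr: "\<And>p. same_type p \<Longrightarrow> \<exists>p'. Q p' \<and> [p = p'] (mod n)"
    and n: "even n" and pi: "\<And>p p'. [p = p'] (mod n) \<Longrightarrow> [\<pi> p = \<pi> p'] (mod n)"
  obtains i p where "Q p" "0 \<le> i" "i \<le> m - 2" "e = (uv m n i (2 * i + p), uv m n (i + 1) (2 * i + \<pi> p))"
  | p where "Q p" "e = (uv m n (m - 1) (2 * (m - 1) + p), uv m n 0 (l + parity_sign y * \<pi> p))"
proof -
  obtain i q where iq: "0 \<le> i" "i < m" "same_type q"
    "e = (layer_pos m n y i q, layer_pos m n y (i + 1) (- 2 \<star> \<pi> q))"
    using assms(1) unfolding twist_arcs_def by blast
  obtain p where p: "Q p" "[q = p] (mod n)" using repr[OF iq(3)] by blast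
  have c: "layer_pos m n y i a = layer_pos m n y i b" if "[a = b] (mod n)" for i a b
    using dih_mult_cong[OF n cong_refl that] cong_add[OF cong_refl that, of "2 * i"]
    by (simp add: layer_pos_def cong_def)
  have e: "e = (layer_pos m n y i p, layer_pos m n y (i + 1) (- 2 \<star> \<pi> p))"
    unfolding iq(4) using c[OF p(2)] c[OF dih_mult_cong[OF n cong_refl pi[OF p(2)]]] by simp
  show ?thesis
  proof (cases "i \<le> m - 2")
    case True
    then show ?thesis using that(1)[OF p(1) iq(1) True] e out_arc_inner[OF iq(1) True, of n p \<pi> y] by simp
  next
    case False
    then have "i = m - 1" using iq by simp
    then show ?thesis using that(2)[OF p(1)] e out_arc_wrap[OF assms(2,3), of p \<pi>] by simp
  qed
qed

text \<open>
  In terms of indices the shift by \<open>- 2\<close> in \<open>twisted_graph\<close> cancels against the starting points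
  \<open>2 * i\<close> of the positions. At the transition to layer 0 it remains, and \<open>l\<close> is \<open>y \<star> - 2\<close>; then
  \<open>l\<close> and \<open>y\<close> have the same parity, and the sign \<open>\<epsilon>\<close> is \<open>parity_sign y\<close>.
\<close>
lemma Xb_eq_twisted:
  assumes m: "0 < m" and n: "n = 4 * n0" "1 \<le> n0" and l: "[l = y - 2 * parity_sign y] (mod n)"
    and ab: "a = 4 * a0 + 1" "b = 4 * b0"
  shows "Xb m n a b l = twisted_graph m n (affine_pi b a) y"
proof -
  interpret affine_twist n0 b0 a0 "affine_pi b a"
    unfolding ab by (rule affine_twist_affine_pi)
  have evn: "even n" using n by simp
  have "even l \<longleftrightarrow> even y"
  proof -
    have "[l = y - 2 * parity_sign y] (mod 2)" using l evn cong_dvd_modulus by blast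
    then have "even (l - (y - 2 * parity_sign y))" by (simp add: cong_iff_dvd_diff)
    then show ?thesis by simp
  qed
  then have eps: "(if even l then 1 else - 1) = parity_sign y" by (simp add: parity_sign_def)
  let ?Q = "\<lambda>p. \<exists>j \<delta>. 0 \<le> j \<and> j < n0 \<and> \<delta> \<in> {0, 1} \<and> p = 4 * j + \<delta>"
  have Qt: "same_type p" if "?Q p" for p using that by auto
  have repr: "\<exists>p'. ?Q p' \<and> [p = p'] (mod n)" if "same_type p" for p
    using that
  proof (rule same_type_cases)
    fix x assume "p = 4 * x"
    then have "[p = 4 * (x mod n0) + 0] (mod n)" using cong_scale4[of x "x mod n0" n0] n by (simp add: cong_def)
    moreover have "0 \<le> x mod n0" "x mod n0 < n0" using n by simp_all
    ultimately show ?thesis by blast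
  next
    fix x assume "p = 4 * x + 1"
    then have "[p = 4 * (x mod n0) + 1] (mod n)" using cong_scale4_1[of x "x mod n0" n0] n by (simp add: cong_def)
    moreover have "0 \<le> x mod n0" "x mod n0 < n0" using n by simp_all
    ultimately show ?thesis by blast
  qed
  have pi: "affine_pi b a (4 * j + \<delta>) = b * j + \<delta> * a" if "\<delta> \<in> {0, 1}" for j \<delta>
    using that by auto
  define R where "R = {(uv m n i (2 * i + 4 * j0 + \<delta>), uv m n (i + 1) (2 * i + b * j0 + \<delta> * a)) | i j0 \<delta>.
            0 \<le> i \<and> i \<le> m - 2 \<and> 0 \<le> j0 \<and> j0 < n0 \<and> \<delta> \<in> {0, 1}} \<union>
         {(uv m n (m - 1) (2 * (m - 1) + 4 * j0 + \<delta>), uv m n 0 (l + parity_sign y * (b * j0 + \<delta> * a))) | j0 \<delta>.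
            0 \<le> j0 \<and> j0 < n0 \<and> \<delta> \<in> {0, 1}}"
  have "R = twist_arcs m n (affine_pi b a) y"
  proof (intro equalityI subsetI)
    fix e assume "e \<in> R"
    then consider i j \<delta> where "0 \<le> i" "i \<le> m - 2" "0 \<le> j" "j < n0" "\<delta> \<in> {0, 1}"
        "e = (uv m n i (2 * i + 4 * j + \<delta>), uv m n (i + 1) (2 * i + b * j + \<delta> * a))"
      | j \<delta> where "0 \<le> j" "j < n0" "\<delta> \<in> {0, 1}"
        "e = (uv m n (m - 1) (2 * (m - 1) + 4 * j + \<delta>), uv m n 0 (l + parity_sign y * (b * j + \<delta> * a)))"
      unfolding R_def by blast
    then show "e \<in> twist_arcs m n (affine_pi b a) y"
    proof cases
      case 1
      then have "?Q (4 * j + \<delta>)" by blast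
      from twist_arcsI(1)[OF Qt[OF this] m 1(1,2), of n "affine_pi b a" y]
      show ?thesis unfolding 1(6) pi[OF 1(5)] by (simp only: add.assoc)
    next
      case 2
      then have "?Q (4 * j + \<delta>)" by blast
      from twist_arcsI(2)[OF Qt[OF this] m l, of "affine_pi b a"]
      show ?thesis unfolding 2(4) pi[OF 2(3)] by (simp only: add.assoc)
    qed
  next
    fix e assume "e \<in> twist_arcs m n (affine_pi b a) y"
    then show "e \<in> R"
    proof (rule twist_arcsE[OF _ m l, where Q = ?Q])
      show "[affine_pi b a p = affine_pi b a p'] (mod n)" if "[p = p'] (mod n)" for p p'
        using cong that unfolding n(1) by blast
      fix i p assume i: "0 \<le> i" "i \<le> m - 2" and "?Q p"
        and e: "e = (uv m n i (2 * i + p), uv m n (i + 1) (2 * i + affine_pi b a p))"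
      then obtain j \<delta> where j: "0 \<le> j" "j < n0" "\<delta> \<in> {0, 1}" "p = 4 * j + \<delta>" by blast
      have "e = (uv m n i (2 * i + 4 * j + \<delta>), uv m n (i + 1) (2 * i + b * j + \<delta> * a))"
        unfolding e j(4) pi[OF j(3)] by (simp only: add.assoc)
      then show "e \<in> R" unfolding R_def using i j by blast
    next
      fix p assume "?Q p"
        and e: "e = (uv m n (m - 1) (2 * (m - 1) + p), uv m n 0 (l + parity_sign y * affine_pi b a p))"
      then obtain j \<delta> where j: "0 \<le> j" "j < n0" "\<delta> \<in> {0, 1}" "p = 4 * j + \<delta>" by blast
      have "e = (uv m n (m - 1) (2 * (m - 1) + 4 * j + \<delta>), uv m n 0 (l + parity_sign y * (b * j + \<delta> * a)))"
        unfolding e j(4) pi[OF j(3)] by (simp only: add.assoc)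
      then show "e \<in> R" unfolding R_def using j by blast
    qed (use repr evn in auto)
  qed
  moreover have "Xb m n a b l = layered_graph m n R"
    using n by (simp add: Xb_def Let_def R_def eps)
  ultimately show ?thesis using layered_eq_twisted[OF m] by simp
qed

subsection \<open>The two exceptional twists of period eight\<close>

text \<open>
  Modulo 8 the positions of type \<open>same_type\<close> are 0, 1, 4, 5 and form Klein's four-group, in which
  every transposition of two involutions is an automorphism.
\<close>
definition swap8 :: "int \<Rightarrow> int \<Rightarrow> int \<Rightarrow> int" where
  "swap8 s t p = (if p mod 8 = s then t else if p mod 8 = t then s else p mod 8)"

lemma same_type_mod8: "same_type p \<longleftrightarrow> p mod 8 = 0 \<or> p mod 8 = 1 \<or> p mod 8 = 4 \<or> p mod 8 = 5"
proof -
  have 1: "p mod 4 = (p mod 8) mod 4" by (simp add: mod_mod_cancel)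
  have "0 \<le> p mod 8" "p mod 8 < 8" by simp_all
  then have "p mod 8 = 0 \<or> p mod 8 = 1 \<or> p mod 8 = 2 \<or> p mod 8 = 3 \<or> p mod 8 = 4 \<or> p mod 8 = 5
    \<or> p mod 8 = 6 \<or> p mod 8 = 7" by arith
  then show ?thesis unfolding same_type_def 1 by (elim disjE) simp_all
qed

lemma swap8_cong: "[p = p'] (mod 8) \<Longrightarrow> swap8 s t p = swap8 s t p'"
  by (simp add: swap8_def cong_def)

lemma swap8_dihedral_involution:
  assumes st: "s = 1 \<and> t = 4 \<or> s = 4 \<and> t = 5"
  shows "dihedral_involution 8 (swap8 s t)"
proof
  show "[swap8 s t p = swap8 s t p'] (mod 8)" if "[p = p'] (mod 8)" for p p'
    using swap8_cong[OF that] by simp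
  show "same_type (swap8 s t p)" if "same_type p" for p
    using st that unfolding same_type_mod8[of p]
    by (elim disjE conjE; simp add: same_type_mod8 swap8_def)
  show "[swap8 s t (swap8 s t p) = p] (mod 8)" if "same_type p" for p
    using st that unfolding same_type_mod8[of p]
    by (elim disjE conjE; simp add: swap8_def cong_def)
  show "[swap8 s t (k \<star> p) = swap8 s t k \<star> swap8 s t p] (mod 8)" if "same_type k" "same_type p" for k p
  proof -
    have *: "[k \<star> p = (k mod 8) \<star> (p mod 8)] (mod 8)"
      by (rule dih_mult_cong) (simp_all add: cong_def)
    show ?thesis
      using st that unfolding swap8_cong[OF *] same_type_mod8
      by (elim disjE conjE; simp; simp add: swap8_def cong_def dih_mult_def parity_sign_def)
  qed
qed simp_all

lemma repr8: "same_type p \<Longrightarrow> \<exists>p'. p' \<in> {0, 1, 4, 5} \<and> [p = p'] (mod 8)"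
  unfolding same_type_mod8 by (intro exI[of _ "p mod 8"]) (auto simp: cong_def)

text \<open>
  The connecting edges of \<open>Xb1\<close> and \<open>Xb2\<close> list the values of the twist at 0, 1 and at 4, 5
  separately. The index 6 is \<open>0 \<star> - 2\<close> modulo 8, so that \<open>y = 0\<close>.
\<close>
lemma twist_arcs8_eq:
  fixes \<alpha> \<beta> :: "int \<Rightarrow> int"
  assumes m: "0 < m" and cong: "\<And>p p'. [p = p'] (mod 8) \<Longrightarrow> [\<pi> p = \<pi> p'] (mod 8)"
    and pi: "\<And>\<delta>. \<delta> \<in> {0, 1} \<Longrightarrow> \<pi> \<delta> = \<alpha> \<delta>" "\<And>\<delta>. \<delta> \<in> {0, 1} \<Longrightarrow> \<pi> (4 + \<delta>) = \<beta> \<delta>"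
  shows "{(uv m 8 i (2 * i + \<delta>), uv m 8 (i + 1) (2 * i + \<alpha> \<delta>)) | i \<delta>.
            0 \<le> i \<and> i \<le> m - 2 \<and> \<delta> \<in> {0, 1}} \<union>
         {(uv m 8 i (2 * i + 4 + \<delta>), uv m 8 (i + 1) (2 * i + \<beta> \<delta>)) | i \<delta>.
            0 \<le> i \<and> i \<le> m - 2 \<and> \<delta> \<in> {0, 1}} \<union>
         {(uv m 8 (m - 1) (2 * (m - 1) + \<delta>), uv m 8 0 (6 + \<alpha> \<delta>)) | \<delta>. \<delta> \<in> {0, 1}} \<union>
         {(uv m 8 (m - 1) (2 * (m - 1) + 4 + \<delta>), uv m 8 0 (6 + \<beta> \<delta>)) | \<delta>. \<delta> \<in> {0, 1}}
     = twist_arcs m 8 \<pi> 0" (is "?R1 \<union> ?R2 \<union> ?R3 \<union> ?R4 = _")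
proof (intro equalityI subsetI)
  have l: "[6 = 0 - 2 * parity_sign 0] (mod 8)" by (simp add: parity_sign_def cong_def)
  have one: "parity_sign 0 = 1" by (simp add: parity_sign_def)
  have t: "same_type \<delta>" "same_type (4 + \<delta>)" if "\<delta> \<in> {0, 1}" for \<delta>
    using that by (auto simp: same_type_mod8)
  fix e
  show "e \<in> twist_arcs m 8 \<pi> 0" if "e \<in> ?R1 \<union> ?R2 \<union> ?R3 \<union> ?R4"
  proof -
    consider i \<delta> where "0 \<le> i" "i \<le> m - 2" "\<delta> \<in> {0, 1}"
        "e = (uv m 8 i (2 * i + \<delta>), uv m 8 (i + 1) (2 * i + \<alpha> \<delta>))"
      | i \<delta> where "0 \<le> i" "i \<le> m - 2" "\<delta> \<in> {0, 1}"
        "e = (uv m 8 i (2 * i + 4 + \<delta>), uv m 8 (i + 1) (2 * i + \<beta> \<delta>))"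
      | \<delta> where "\<delta> \<in> {0, 1}" "e = (uv m 8 (m - 1) (2 * (m - 1) + \<delta>), uv m 8 0 (6 + \<alpha> \<delta>))"
      | \<delta> where "\<delta> \<in> {0, 1}" "e = (uv m 8 (m - 1) (2 * (m - 1) + 4 + \<delta>), uv m 8 0 (6 + \<beta> \<delta>))"
      using \<open>e \<in> _\<close> by blast
    then show ?thesis
    proof cases
      case 1
      show ?thesis using twist_arcsI(1)[OF t(1)[OF 1(3)] m 1(1,2), of 8 \<pi> 0] unfolding 1(4) pi(1)[OF 1(3)] .
    next
      case 2
      show ?thesis using twist_arcsI(1)[OF t(2)[OF 2(3)] m 2(1,2), of 8 \<pi> 0]
        unfolding 2(4) pi(2)[OF 2(3)] add.assoc .
    next
      case 3
      show ?thesis using twist_arcsI(2)[OF t(1)[OF 3(1)] m l, of \<pi>]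
        unfolding 3(2) pi(1)[OF 3(1)] one mult_1 .
    next
      case 4
      show ?thesis using twist_arcsI(2)[OF t(2)[OF 4(1)] m l, of \<pi>]
        unfolding 4(2) pi(2)[OF 4(1)] one mult_1 add.assoc .
    qed
  qed
  have split: "\<exists>\<delta>\<in>{0, 1}. p = \<delta> \<or> p = 4 + \<delta>" if "p \<in> {0, 1, 4, 5}" for p :: int
    using that by auto
  show "e \<in> ?R1 \<union> ?R2 \<union> ?R3 \<union> ?R4" if "e \<in> twist_arcs m 8 \<pi> 0"
    using that
  proof (rule twist_arcsE[OF _ m l, where Q = "\<lambda>p. p \<in> {0, 1, 4, 5}"])
    show "\<exists>p'. p' \<in> {0, 1, 4, 5} \<and> [p = p'] (mod 8)" if "same_type p" for p using that by (rule repr8)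
    show "[\<pi> p = \<pi> p'] (mod 8)" if "[p = p'] (mod 8)" for p p' using that by (rule cong)
    fix i p assume p: "p \<in> {0, 1, 4, 5}" and i: "0 \<le> i" "i \<le> m - 2"
      and e: "e = (uv m 8 i (2 * i + p), uv m 8 (i + 1) (2 * i + \<pi> p))"
    obtain \<delta> where d: "\<delta> \<in> {0, 1}" "p = \<delta> \<or> p = 4 + \<delta>" using split[OF p] by blast
    from d(2) show "e \<in> ?R1 \<union> ?R2 \<union> ?R3 \<union> ?R4"
    proof
      assume "p = \<delta>"
      then have "e = (uv m 8 i (2 * i + \<delta>), uv m 8 (i + 1) (2 * i + \<alpha> \<delta>))"
        using e pi(1)[OF d(1)] by simp
      then have "e \<in> ?R1" using i d(1) by blast
      then show ?thesis by blast
    next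
      assume "p = 4 + \<delta>"
      then have "e = (uv m 8 i (2 * i + 4 + \<delta>), uv m 8 (i + 1) (2 * i + \<beta> \<delta>))"
        using e pi(2)[OF d(1)] by (simp only: add.assoc)
      then have "e \<in> ?R2" using i d(1) by blast
      then show ?thesis by blast
    qed
  next
    fix p assume p: "p \<in> {0, 1, 4, 5}"
      and e: "e = (uv m 8 (m - 1) (2 * (m - 1) + p), uv m 8 0 (6 + parity_sign 0 * \<pi> p))"
    obtain \<delta> where d: "\<delta> \<in> {0, 1}" "p = \<delta> \<or> p = 4 + \<delta>" using split[OF p] by blast
    from d(2) show "e \<in> ?R1 \<union> ?R2 \<union> ?R3 \<union> ?R4"
    proof
      assume "p = \<delta>"
      then have "e = (uv m 8 (m - 1) (2 * (m - 1) + \<delta>), uv m 8 0 (6 + \<alpha> \<delta>))"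
        using e pi(1)[OF d(1)] one by (simp only: mult_1)
      then have "e \<in> ?R3" using d(1) by blast
      then show ?thesis by blast
    next
      assume "p = 4 + \<delta>"
      then have "e = (uv m 8 (m - 1) (2 * (m - 1) + 4 + \<delta>), uv m 8 0 (6 + \<beta> \<delta>))"
        using e pi(2)[OF d(1)] one by (simp only: mult_1 add.assoc)
      then have "e \<in> ?R4" using d(1) by blast
      then show ?thesis by blast
    qed
  qed simp
qed

lemma Xb1_eq_twisted:
  assumes m: "0 < m"
  shows "Xb1 m = twisted_graph m 8 (swap8 1 4) 0"
proof -
  have pi: "swap8 1 4 \<delta> = 4 * \<delta>" "swap8 1 4 (4 + \<delta>) = 1 + 4 * \<delta>" if "\<delta> \<in> {0, 1}" for \<delta>
    using that by (auto simp: swap8_def)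
  have cong: "[swap8 1 4 p = swap8 1 4 p'] (mod 8)" if "[p = p'] (mod 8)" for p p'
    using swap8_cong[OF that] by simp
  have s: "6 + (1 + 4 * \<delta>) = 7 + 4 * \<delta>" for \<delta> :: int by simp
  have "Xb1 m = layered_graph m 8 (twist_arcs m 8 (swap8 1 4) 0)"
    using arg_cong[where f = "layered_graph m 8",
        OF twist_arcs8_eq[where \<alpha> = "\<lambda>\<delta>. 4 * \<delta>" and \<beta> = "\<lambda>\<delta>. 1 + 4 * \<delta>", OF m cong pi]]
    by (simp only: Xb1_def Let_def add.assoc s)
  then show ?thesis using layered_eq_twisted[OF m] by simp
qed

lemma Xb2_eq_twisted:
  assumes m: "0 < m"
  shows "Xb2 m = twisted_graph m 8 (swap8 4 5) 0"
proof -
  have pi: "swap8 4 5 \<delta> = \<delta>" "swap8 4 5 (4 + \<delta>) = 5 - \<delta>" if "\<delta> \<in> {0, 1}" for \<delta>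
    using that by (auto simp: swap8_def)
  have cong: "[swap8 4 5 p = swap8 4 5 p'] (mod 8)" if "[p = p'] (mod 8)" for p p'
    using swap8_cong[OF that] by simp
  have w: "uv m 8 0 (6 + (5 - \<delta>)) = uv m 8 0 (3 - \<delta>)" for \<delta>
  proof -
    have "6 + (5 - \<delta>) = (3 - \<delta>) + 8" by simp
    then show ?thesis unfolding uv_def by (simp only: mod_add_self2)
  qed
  have "Xb2 m = layered_graph m 8 (twist_arcs m 8 (swap8 4 5) 0)"
    using arg_cong[where f = "layered_graph m 8",
        OF twist_arcs8_eq[where \<alpha> = "\<lambda>\<delta>. \<delta>" and \<beta> = "\<lambda>\<delta>. 5 - \<delta>", OF m cong pi]]
    unfolding w by (simp only: Xb2_def Let_def add_diff_eq)
  then show ?thesis using layered_eq_twisted[OF m] by simp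
qed

text \<open>
  Values at representatives that are not reduced modulo 8, as they arise when \<open>conj_twist\<close> is
  iterated.
\<close>
lemma conj_swap8:
  "conj_twist (swap8 1 4) 0 = 0" "conj_twist (swap8 4 5) 0 = 0"
  "conj_twist (swap8 1 4) 1 = 4" "conj_twist (swap8 1 4) 4 = - 3" "conj_twist (swap8 1 4) (- 3) = 1"
  "conj_twist (swap8 1 4) (- 7) = 4" "conj_twist (swap8 1 4) (- 11) = 1"
  "conj_twist (swap8 4 5) 1 = - 3" "conj_twist (swap8 4 5) (- 3) = 4" "conj_twist (swap8 4 5) 4 = 1"
  by (simp_all add: conj_twist_def swap8_def dih_mult_def parity_sign_def)

text \<open>
  Conjugation with 2 exchanges 1 and 5. Composed with one of the two swaps it permutes the three
  involutions cyclically, so the relations hold with \<open>y = 0\<close> if \<open>m\<close> is divisible by three.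
\<close>
lemma swap8_cayley_twist:
  assumes st: "s = 1 \<and> t = 4 \<or> s = 4 \<and> t = 5" and m: "0 < m" "3 dvd m"
  shows "cayley_twist 8 (swap8 s t) m 0"
proof -
  interpret dihedral_involution 8 "swap8 s t" by (rule swap8_dihedral_involution[OF st])
  let ?f = "conj_twist (swap8 s t)" and ?r = "reversal_shift (swap8 s t)"
  obtain m' where "m = 3 * m'" using m(2) by (auto simp: dvd_def)
  then have "nat m = 3 * nat m'" using m(1) by (simp add: nat_mult_distrib)
  then obtain k where k: "nat m = 3 * k" by blast
  have f0: "?f 0 = 0" and f1: "?f (?f (?f 1)) = 1" using st by (elim disjE conjE; simp add: conj_swap8)+
  have "(?f ^^ (3 * k)) 1 = 1"
  proof (induction k)
    case (Suc k)
    have "3 * Suc k = Suc (Suc (Suc (3 * k)))" by simp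
    then show ?case using Suc f1 by (simp only: funpow.simps o_apply)
  qed simp
  moreover have "[?r (3 * k) = 0] (mod 8)"
  proof (induction k)
    case (Suc k)
    have "?f (?r (3 * k)) = ?f 0"
      using swap8_cong[OF Suc] by (simp add: conj_twist_def)
    then have "?r (Suc (3 * k)) = - 1 \<star> swap8 s t 1 \<star> 2" by (simp add: f0)
    then have "?r (Suc (Suc (Suc (3 * k)))) =
        - 1 \<star> swap8 s t 1 \<star> 2 \<star> ?f (- 1 \<star> swap8 s t 1 \<star> 2 \<star> ?f (- 1 \<star> swap8 s t 1 \<star> 2))"
      by simp
    also have "[\<dots> = 0] (mod 8)"
    proof -
      have "- 1 \<star> swap8 1 4 1 \<star> 2 = - 7" "- 1 \<star> swap8 4 5 1 \<star> 2 = 0"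
        "- 7 \<star> 4 = - 11" "- 7 \<star> 1 = - 8"
        by (simp_all add: swap8_def dih_mult_def parity_sign_def)
      then show ?thesis using st by (elim disjE conjE; simp add: conj_swap8 cong_def)
    qed
    finally have "[?r (Suc (Suc (Suc (3 * k)))) = 0] (mod 8)" .
    moreover have "3 * Suc k = Suc (Suc (Suc (3 * k)))" by simp
    ultimately show ?case by (simp only:)
  qed simp
  then have "[- 1 \<star> ?r (nat m) = - 1 \<star> 0] (mod 8)"
    unfolding k by (intro mult_cong cong_refl)
  then have "[0 \<star> - 1 \<star> 0 = - 1 \<star> ?r (nat m)] (mod 8)" by (simp add: cong_sym_eq)
  ultimately show ?thesis
    using m(1) k f0 by unfold_locales simp_all
qed

section \<open>Which twists are affine\<close>

context dihedral_involution
begin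

lemma same_type_multiples: "same_type 4" "same_type 8" "same_type (- 4)" "same_type 5"
  using same_type_simps(1)[of 1] same_type_simps(1)[of 2] same_type_simps(1)[of "- 1"]
    same_type_simps(2)[of 1] by simp_all

lemma pi_8_nonzero:
  assumes "12 \<le> n"
  shows "\<not> [\<pi> 8 = 0] (mod n)"
proof
  assume "[\<pi> 8 = 0] (mod n)"
  then have "[\<pi> (\<pi> 8) = 0] (mod n)" using pi_cong pi_zero cong_trans by blast
  then have "[8 = 0] (mod n)" using pi_pi[OF same_type_multiples(2)] cong_sym cong_trans by blast
  then have "n dvd 8" by (simp add: cong_iff_dvd_diff)
  then show False using zdvd_imp_le[of n 8] assms by simp
qed

lemma pi_8: "[\<pi> 8 = \<pi> 4 \<star> \<pi> 4] (mod n)"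
  using pi_hom[OF same_type_multiples(1,1)] by (simp add: dih_mult_def parity_sign_def)

text \<open>
  A reflection has square 0. The square of 4 is 8, which is not 0 modulo \<open>n\<close> for \<open>n \<ge> 12\<close>, so the
  image of 4 is a rotation.
\<close>
lemma even_pi_4:
  assumes "12 \<le> n"
  shows "even (\<pi> 4)"
proof (rule ccontr)
  assume "odd (\<pi> 4)"
  then have "\<pi> 4 \<star> \<pi> 4 = 0" by (simp add: dih_mult_def parity_sign_def)
  then show False using pi_8 pi_8_nonzero[OF assms] by simp
qed

text \<open>
  The reflection 1 inverts 4. If its image were a rotation, it would also commute with the image of
  4, which would then have order two.
\<close>
lemma odd_pi_1:
  assumes "12 \<le> n"
  shows "odd (\<pi> 1)"
proof
  assume e1: "even (\<pi> 1)"
  note e4 = even_pi_4[OF assms]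
  have "4 \<star> 1 = 5" "1 \<star> - 4 = 5" "4 \<star> - 4 = 0" by (simp_all add: dih_mult_def parity_sign_def)
  then have h: "[\<pi> 5 = \<pi> 4 \<star> \<pi> 1] (mod n)" "[\<pi> 5 = \<pi> 1 \<star> \<pi> (- 4)] (mod n)" "[\<pi> 0 = \<pi> 4 \<star> \<pi> (- 4)] (mod n)"
    using pi_hom[OF same_type_multiples(1) same_type_1] pi_hom[OF same_type_1 same_type_multiples(3)]
      pi_hom[OF same_type_multiples(1,3)] by simp_all
  have "[\<pi> 4 + \<pi> 1 = \<pi> 1 + \<pi> (- 4)] (mod n)"
    using cong_trans[OF cong_sym[OF h(1)] h(2)] e1 e4 by (simp add: dih_mult_def parity_sign_def)
  then have "[\<pi> 4 = \<pi> (- 4)] (mod n)" by (simp add: cong_iff_dvd_diff)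
  then have "[\<pi> 4 + \<pi> 4 = \<pi> 4 + \<pi> (- 4)] (mod n)" by (intro cong_add cong_refl)
  also have "[\<pi> 4 + \<pi> (- 4) = \<pi> 0] (mod n)"
    using cong_sym[OF h(3)] e4 by (simp add: dih_mult_def parity_sign_def)
  also note pi_zero
  finally have "[\<pi> 4 + \<pi> 4 = 0] (mod n)" .
  moreover have "\<pi> 4 \<star> \<pi> 4 = \<pi> 4 + \<pi> 4" using e4 by (simp add: dih_mult_def parity_sign_def)
  ultimately have "[\<pi> 8 = 0] (mod n)" using pi_8 cong_trans by simp
  then show False using pi_8_nonzero[OF assms] by simp
qed

text \<open>
  The rotation 4 and the reflection 1 generate the group, so \<open>\<pi>\<close> is determined by its values there.
\<close>
lemma affine_twist_of_parity:
  assumes n: "n = 4 * n0" and p4: "even (\<pi> 4)" and p1: "odd (\<pi> 1)"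
  shows "\<exists>b0 a0. 0 \<le> b0 \<and> b0 < n0 \<and> 0 \<le> a0 \<and> a0 < n0 \<and> affine_twist n0 b0 a0 \<pi>"
proof -
  have n0: "1 \<le> n0" using n_pos n by simp
  obtain b1 where b1: "\<pi> 4 = 4 * b1"
    using pi_type[OF same_type_multiples(1)] p4 by (auto elim!: same_type_cases)
  obtain a1 where a1: "\<pi> 1 = 4 * a1 + 1"
    using pi_type[OF same_type_1] p1 by (auto elim!: same_type_cases)
  define b0 where "b0 = b1 mod n0"
  define a0 where "a0 = a1 mod n0"
  have b0: "[\<pi> 4 = 4 * b0] (mod 4 * n0)" unfolding b1 cong_scale4 by (simp add: b0_def cong_def)
  have a0: "[\<pi> 1 = 4 * a0 + 1] (mod 4 * n0)" unfolding a1 cong_scale4_1 by (simp add: a0_def cong_def)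
  have pi0: "[\<pi> (4 * x) = 4 * (b0 * x)] (mod 4 * n0)" for x
  proof (induction x rule: int_induct[of _ 0])
    case base
    then show ?case using pi_zero n by simp
  next
    case (step1 i)
    have e: "4 * (i + 1) = 4 \<star> (4 * i)" by (simp add: dih_mult_def parity_sign_def)
    have "[\<pi> (4 * (i + 1)) = \<pi> 4 \<star> \<pi> (4 * i)] (mod 4 * n0)"
      unfolding e using pi_hom[OF same_type_multiples(1) same_type_simps(1)] n by simp
    also have "[\<pi> 4 \<star> \<pi> (4 * i) = 4 * b0 \<star> (4 * (b0 * i))] (mod 4 * n0)"
      using mult_cong[OF _ _] b0 step1.IH n by blast
    also have "4 * b0 \<star> (4 * (b0 * i)) = 4 * (b0 * (i + 1))" by (simp only: dih_mult_4) (simp add: algebra_simps)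
    finally show ?case .
  next
    case (step2 i)
    have e: "4 * i = 4 \<star> (4 * (i - 1))" by (simp add: dih_mult_def parity_sign_def)
    have "[\<pi> 4 \<star> \<pi> (4 * (i - 1)) = \<pi> (4 * i)] (mod 4 * n0)"
      using cong_sym[OF pi_hom[OF same_type_multiples(1) same_type_simps(1)[of "i - 1"]]]
      unfolding n e[symmetric] .
    also note step2.IH
    also have "4 * (b0 * i) = 4 * b0 \<star> (4 * (b0 * (i - 1)))" by (simp only: dih_mult_4) (simp add: algebra_simps)
    also have "[4 * b0 \<star> (4 * (b0 * (i - 1))) = \<pi> 4 \<star> (4 * (b0 * (i - 1)))] (mod 4 * n0)"
      using mult_cong[OF cong_sym[OF b0[folded n]] cong_refl] n by simp
    finally show ?case by (rule dih_mult_cancel)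
  qed
  have pi1: "[\<pi> (4 * x + 1) = 4 * (b0 * x + a0) + 1] (mod 4 * n0)" for x
  proof -
    have e: "4 * x + 1 = 4 * x \<star> 1" by simp
    have "[\<pi> (4 * x + 1) = \<pi> (4 * x) \<star> \<pi> 1] (mod 4 * n0)"
      unfolding e using pi_hom[OF same_type_simps(1) same_type_1] n by simp
    also have "[\<pi> (4 * x) \<star> \<pi> 1 = 4 * (b0 * x) \<star> (4 * a0 + 1)] (mod 4 * n0)"
      using mult_cong[OF _ _] pi0 a0 n by blast
    also have "4 * (b0 * x) \<star> (4 * a0 + 1) = 4 * (b0 * x + a0) + 1" by (simp only: dih_mult_4) (simp add: algebra_simps)
    finally show ?thesis .
  qed
  have "affine_twist n0 b0 a0 \<pi>"
    using pi_cong n pi0 pi1 by unfold_locales simp_all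
  moreover have "0 \<le> b0" "b0 < n0" "0 \<le> a0" "a0 < n0" using n0 by (simp_all add: b0_def a0_def)
  ultimately show ?thesis by blast
qed

end

section \<open>The admissible parameters\<close>

lemma involution_power:
  assumes "[b0 * b0 = 1] (mod (n0::int))"
  shows "[b0 ^ j = (if even j then 1 else b0)] (mod n0)"
proof (induction j)
  case (Suc j)
  have "[b0 * b0 ^ j = b0 * (if even j then 1 else b0)] (mod n0)" by (intro cong_mult cong_refl Suc)
  also have "[b0 * (if even j then 1 else b0) = (if even j then b0 else 1)] (mod n0)" using assms by simp
  finally show ?case by (cases "even j") simp_all
qed simp

lemma half_parity:
  fixes m :: int
  assumes "0 < m"
  shows "even m \<Longrightarrow> nat m = 2 * nat (m div 2)" "even m \<Longrightarrow> m = 2 * int (nat (m div 2))"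
    and "odd m \<Longrightarrow> nat m = Suc (2 * nat (m div 2))" "odd m \<Longrightarrow> m = 2 * int (nat (m div 2)) + 1"
proof -
  have 1: "int (nat (m div 2)) = m div 2" using assms by simp
  have 2: "m = 2 * (m div 2) + m mod 2" by simp
  show e: "m = 2 * int (nat (m div 2))" if "even m" using that 1 by simp
  show o: "m = 2 * int (nat (m div 2)) + 1" if "odd m" using that 1 2 by (simp add: odd_iff_mod_2_eq_one)
  show "nat m = 2 * nat (m div 2)" if "even m" using e[OF that] by linarith
  show "nat m = Suc (2 * nat (m div 2))" if "odd m" using o[OF that] by linarith
qed

text \<open>
  Since \<open>b0 * b0 = 1\<close>, the relation \<open>pow\<close> reads \<open>1 = parity_sign y\<close> for even \<open>m\<close> and
  \<open>b0 = parity_sign y\<close> for odd \<open>m\<close>. It rules out odd \<open>y\<close> for even \<open>m\<close>, except modulo 2, where the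
  last congruence for odd \<open>y\<close> fails. The remaining three cases are the three families.
\<close>
lemma twist_params_cases:
  assumes tp: "twist_params n0 b0 a0 m y" and m: "3 \<le> m" and n0: "2 \<le> n0"
    and pow: "[b0 ^ nat m = parity_sign y] (mod n0)"
  obtains z where "odd m" "y = 4 * z + 1" "[b0 = - 1] (mod n0)" "[a0 = 2 * z + 1] (mod n0)"
  | z where "odd m" "y = 4 * z" "[b0 = 1] (mod n0)" "[a0 = 0] (mod n0)" "[2 * z = m] (mod n0)"
  | z where "even m" "y = 4 * z" "[b0 * z = z] (mod n0)" "[2 * z = (m div 2) * (b0 + 1)] (mod n0)"
proof -
  have A: "[b0 * b0 = 1] (mod n0)" "[b0 * a0 + a0 = 0] (mod n0)" using tp by (auto simp: twist_params_def)
  define k where "k = nat (m div 2)"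
  have mk: "even m \<Longrightarrow> nat m = 2 * k" "odd m \<Longrightarrow> nat m = Suc (2 * k)"
    "even m \<Longrightarrow> m = 2 * int k" "odd m \<Longrightarrow> m = 2 * int k + 1"
    using half_parity[of m] m unfolding k_def by simp_all
  have pw: "[parity_sign y = (if even m then 1 else b0)] (mod n0)"
    using cong_trans[OF cong_sym[OF pow] involution_power[OF A(1), of "nat m"]] m by (simp add: even_nat_iff)
  consider (e) z where "y = 4 * z" "[b0 * z = z] (mod n0)" "[2 * z + drift b0 a0 (nat m) = 0] (mod n0)"
      "[(if even m then 0 else - a0) = 0] (mod n0)"
    | (o) z where "y = 4 * z + 1" "[b0 * z + a0 - 1 = z] (mod n0)" "[2 * z = drift b0 a0 (nat m)] (mod n0)"
      "[2 * z + 1 + (if even m then 0 else - a0) = 0] (mod n0)"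
    using tp unfolding twist_params_def by blast
  then show ?thesis
  proof cases
    case e
    show ?thesis
    proof (cases "even m")
      case True
      have d: "[2 * z + drift b0 a0 (2 * k) = 2 * z + - int k * (b0 + 1)] (mod n0)"
        by (intro cong_add cong_refl drift_closed A)
      have "[2 * z + - int k * (b0 + 1) = 0] (mod n0)"
        using e(3) unfolding mk(1)[OF True] cong_subst(1)[OF d] .
      then have "[2 * z = (m div 2) * (b0 + 1)] (mod n0)"
        using mk(3)[OF True] by (simp add: cong_iff_dvd_diff)
      then show ?thesis using that(3)[OF True e(1,2)] by simp
    next
      case False
      have b1: "[b0 = 1] (mod n0)" using pw False e(1) by (simp add: parity_sign_def cong_sym_eq)
      have a0: "[a0 = 0] (mod n0)" using e(4) False by (simp add: cong_iff_dvd_diff)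
      have "[2 * z + drift b0 a0 (Suc (2 * k)) = 2 * z + (- int k * (b0 + 1) + a0 - 1)] (mod n0)"
        by (intro cong_add cong_refl drift_closed(2) A)
      also have "[2 * z + (- int k * (b0 + 1) + a0 - 1) = 2 * z + (- int k * (1 + 1) + 0 - 1)] (mod n0)"
        by (intro cong_add cong_diff cong_mult cong_refl b1 a0)
      finally have d: "[2 * z + drift b0 a0 (Suc (2 * k)) = 2 * z + (- int k * (1 + 1) + 0 - 1)] (mod n0)" .
      have "[2 * z + (- int k * (1 + 1) + 0 - 1) = 0] (mod n0)"
        using e(3) unfolding mk(2)[OF False] cong_subst(1)[OF d] .
      moreover have "2 * z + (- int k * (1 + 1) + 0 - 1) = 2 * z - m" using mk(4)[OF False] by simp
      ultimately have "[2 * z = m] (mod n0)" by (simp add: cong_iff_dvd_diff)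
      then show ?thesis using that(2)[OF False e(1) b1 a0] by simp
    qed
  next
    case o
    show ?thesis
    proof (cases "even m")
      case True
      have "[- 1 = 1] (mod n0)" using pw True o(1) by (simp add: parity_sign_def)
      then have "n0 dvd 2" by (simp add: cong_iff_dvd_diff)
      then have "n0 = 2" using n0 zdvd_imp_le[of n0 2] by simp
      then have "2 dvd 2 * z + 1" using o(4) True by (simp add: cong_iff_dvd_diff)
      then show ?thesis by simp
    next
      case False
      have "[b0 = - 1] (mod n0)" using pw False o(1) by (simp add: parity_sign_def cong_sym_eq)
      moreover have "[a0 = 2 * z + 1] (mod n0)"
        using o(4) False dvd_diff_commute[of n0 a0 "2 * z + 1"] by (simp add: cong_iff_dvd_diff)
      ultimately show ?thesis using that(1)[OF False o(1)] by simp
    qed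
  qed
qed

lemma twist_params_odd_odd:
  assumes m: "odd m" "0 < m" and b0: "[b0 = - 1] (mod n0)" and a0: "[a0 = 2 * z + 1] (mod n0)"
  shows "twist_params n0 b0 a0 m (4 * z + 1)"
proof -
  define k where "k = nat (m div 2)"
  have k: "nat m = Suc (2 * k)" using half_parity(3)[OF m(2,1)] by (simp add: k_def)
  have A1: "[b0 * b0 = 1] (mod n0)" using cong_mult[OF b0 b0] by simp
  have A2: "[b0 * a0 + a0 = 0] (mod n0)" using cong_add[OF cong_mult[OF b0 cong_refl[of a0]] cong_refl[of a0]] by simp
  have 1: "[b0 * z + a0 - 1 = z] (mod n0)"
    using cong_diff[OF cong_add[OF cong_mult[OF b0 cong_refl[of z]] a0] cong_refl[of 1]] by simp
  have "[- int k * (b0 + 1) + a0 - 1 = - int k * (- 1 + 1) + (2 * z + 1) - 1] (mod n0)"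
    by (intro cong_add cong_diff cong_mult cong_refl b0 a0)
  then have "[- int k * (b0 + 1) + a0 - 1 = 2 * z] (mod n0)" by simp
  then have 2: "[2 * z = drift b0 a0 (nat m)] (mod n0)"
    unfolding k using drift_closed(2)[OF A1 A2, of k] cong_trans cong_sym by blast
  have "[2 * z + 1 - a0 = 2 * z + 1 - (2 * z + 1)] (mod n0)" by (intro cong_diff cong_refl a0)
  then show ?thesis using A1 A2 1 2 m(1) unfolding twist_params_def by simp
qed

lemma twist_params_odd_even:
  assumes m: "odd m" "0 < m" and b0: "[b0 = 1] (mod n0)" and a0: "[a0 = 0] (mod n0)"
    and z: "[2 * z = m] (mod n0)"
  shows "twist_params n0 b0 a0 m (4 * z)"
proof -
  define k where "k = nat (m div 2)"
  have k: "nat m = Suc (2 * k)" using half_parity(3)[OF m(2,1)] by (simp add: k_def)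
  then have mk: "m = 2 * int k + 1" using half_parity(4)[OF m(2,1)] by (simp add: k_def)
  have A1: "[b0 * b0 = 1] (mod n0)" using cong_mult[OF b0 b0] by simp
  have A2: "[b0 * a0 + a0 = 0] (mod n0)" using cong_add[OF cong_mult[OF b0 a0] a0] by simp
  have 1: "[b0 * z = z] (mod n0)" using cong_mult[OF b0 cong_refl[of z]] by simp
  have "[2 * z + drift b0 a0 (Suc (2 * k)) = m + (- int k * (b0 + 1) + a0 - 1)] (mod n0)"
    by (intro cong_add z drift_closed(2) A1 A2)
  also have "[m + (- int k * (b0 + 1) + a0 - 1) = m + (- int k * (1 + 1) + 0 - 1)] (mod n0)"
    by (intro cong_add cong_diff cong_mult cong_refl b0 a0)
  also have "m + (- int k * (1 + 1) + 0 - 1) = 0" using mk by simp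
  finally have 2: "[2 * z + drift b0 a0 (nat m) = 0] (mod n0)" unfolding k .
  have "[- a0 = 0] (mod n0)" using a0 by (simp add: cong_iff_dvd_diff)
  then show ?thesis using A1 A2 1 2 unfolding twist_params_def by simp
qed

lemma twist_params_even_even:
  assumes m: "even m" "0 < m" and A: "[b0 * b0 = 1] (mod n0)" "[b0 * a0 + a0 = 0] (mod n0)"
    and z: "[b0 * z = z] (mod n0)" "[2 * z = (m div 2) * (b0 + 1)] (mod n0)"
  shows "twist_params n0 b0 a0 m (4 * z)"
proof -
  define k where "k = nat (m div 2)"
  have k: "nat m = 2 * k" "m div 2 = int k" using half_parity(1)[OF m(2,1)] m by (simp_all add: k_def)
  have "[2 * z + drift b0 a0 (2 * k) = (m div 2) * (b0 + 1) + - int k * (b0 + 1)] (mod n0)"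
    by (intro cong_add z drift_closed A)
  also have "(m div 2) * (b0 + 1) + - int k * (b0 + 1) = 0" using k by simp
  finally have "[2 * z + drift b0 a0 (nat m) = 0] (mod n0)" unfolding k(1) .
  then show ?thesis using A z(1) m(1) unfolding twist_params_def by simp
qed

text \<open>
  The congruence \<open>b0 * b0 = 1\<close> contains the coprimality of \<open>n0\<close> and \<open>b0\<close>.
\<close>
lemma admissibleI:
  assumes "3 \<le> m" "n = 4 * n0" "2 \<le> n0" "0 \<le> b0" "b0 < n0" "0 \<le> a0" "a0 < n0" "0 \<le> l" "l < n"
    and A: "[b0 * b0 = 1] (mod n0)" "[b0 * a0 + a0 = 0] (mod n0)" and l: "4 dvd l - 2 \<or> 4 dvd l - 3"
  shows "admissible m n (4 * a0 + 1) (4 * b0) l"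
proof -
  have "b0 \<noteq> 0"
  proof
    assume "b0 = 0"
    then have "n0 dvd 1" using A(1) by (simp add: cong_iff_dvd_diff)
    then show False using assms(3) by simp
  qed
  then have b0: "1 \<le> b0" using assms(4) by simp
  have cop: "coprime n0 b0"
    using A(1) coprime_iff_invertible_int[of b0 n0] by (auto simp: coprime_commute)
  have "[4 * (b0 * b0) = 4 * 1] (mod 4 * n0)" using A(1) by (simp only: cong_scale4)
  then have 1: "[4 * b0 * b0 = 4] (mod n)" using assms(2) by (simp add: mult.assoc)
  have "[4 * (b0 * a0 + a0) + 1 = 4 * 0 + 1] (mod 4 * n0)" using A(2) by (simp only: cong_scale4_1)
  then have 2: "[4 * b0 * a0 + (4 * a0 + 1) = 1] (mod n)" using assms(2) by (simp add: algebra_simps)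
  show ?thesis
    unfolding admissible_def using assms b0 cop 1 2
    by (intro conjI exI[of _ n0] exI[of _ a0] exI[of _ b0]) auto
qed

lemma (in cayley_twist) Xb_of_parity:
  assumes n: "n = 4 * n0" "2 \<le> n0" and p: "even (\<pi> 4)" "odd (\<pi> 1)" and m: "3 \<le> m"
    and conj4: "[y \<star> (conj_twist \<pi> ^^ nat m) 4 = 4 \<star> y] (mod n)"
  obtains b0 a0 where "0 \<le> b0" "b0 < n0" "0 \<le> a0" "a0 < n0"
    "[b0 * b0 = 1] (mod n0)" "[b0 * a0 + a0 = 0] (mod n0)"
    "twist_params n0 b0 a0 m y" "[b0 ^ nat m = parity_sign y] (mod n0)"
    "X = Xb m n (4 * a0 + 1) (4 * b0) ((y - 2 * parity_sign y) mod n)"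
proof -
  obtain b0 a0 where r: "0 \<le> b0" "b0 < n0" "0 \<le> a0" "a0 < n0" and aff: "affine_twist n0 b0 a0 \<pi>"
    using affine_twist_of_parity[OF n(1) p] by blast
  interpret A: affine_twist n0 b0 a0 \<pi> by (rule aff)
  have di: "dihedral_involution (4 * n0) \<pi>" using n dihedral_involution_axioms by simp
  have tp: "twist_params n0 b0 a0 m y"
    using A.cayley_twist_iff[OF di m_pos y_type] cayley_twist_axioms n by simp
  have pow: "[b0 ^ nat m = parity_sign y] (mod n0)"
    using y_type
  proof (rule same_type_cases)
    fix z assume y: "y = 4 * z"
    then show ?thesis using conj4 A.conj4_even[of z "nat m"] n by (simp add: parity_sign_def)
  next
    fix z assume y: "y = 4 * z + 1"
    have "[(4 * z + 1) \<star> (conj_twist \<pi> ^^ nat m) 4 = 4 \<star> (4 * z + 1)] (mod 4 * n0)"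
      using conj4 unfolding y n(1) .
    then show ?thesis unfolding A.conj4_odd by (simp add: parity_sign_def y)
  qed
  have "X = twisted_graph m n (affine_pi (4 * b0) (4 * a0 + 1)) y"
  proof (rule twisted_graph_cong[OF n_even cong_refl])
    fix p assume "same_type p"
    then show "[\<pi> p = affine_pi (4 * b0) (4 * a0 + 1) p] (mod n)"
    proof (rule same_type_cases)
      fix x assume p: "p = 4 * x"
      have "affine_pi (4 * b0) (4 * a0 + 1) (4 * x) = 4 * (b0 * x)" by simp
      then show ?thesis using A.pi_0[of x] unfolding p n(1) by (simp only:)
    next
      fix x assume p: "p = 4 * x + 1"
      have "affine_pi (4 * b0) (4 * a0 + 1) (4 * x + 1) = 4 * (b0 * x + a0) + 1" by simp
      then show ?thesis using A.pi_1[of x] unfolding p n(1) by (simp only:)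
    qed
  qed
  also have "\<dots> = Xb m n (4 * a0 + 1) (4 * b0) ((y - 2 * parity_sign y) mod n)"
    using n by (intro Xb_eq_twisted[OF m_pos n(1), symmetric]) (auto simp: cong_def)
  finally have "X = Xb m n (4 * a0 + 1) (4 * b0) ((y - 2 * parity_sign y) mod n)" .
  then show ?thesis using that r tp pow by (auto simp: twist_params_def)
qed

definition listed_8 :: "int \<Rightarrow> int \<Rightarrow> int \<Rightarrow> bool" where
  "listed_8 m a l \<longleftrightarrow> odd m \<and> a = 5 \<and> l \<in> {3, 7} \<or> even m \<and> a \<in> {1, 5} \<and> l \<in> {2, 6}"

definition listed_12 :: "int \<Rightarrow> int \<Rightarrow> int \<Rightarrow> int \<Rightarrow> int \<Rightarrow> bool" where
  "listed_12 m n a b l \<longleftrightarrow>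
     (odd m \<and> odd l \<and> [b = n - 4] (mod n) \<and> [a = 2 * l - 1] (mod n)) \<or>
     (odd m \<and> even l \<and> a = 1 \<and> b = 4 \<and>
        (\<exists>n0. n = 4 * n0 \<and> odd n0 \<and> n0 \<ge> 3 \<and> [l = 2 * n0 + 2 * m - 2] (mod n))) \<or>
     (even m \<and> even l \<and>
        (\<exists>b0. b = 4 * b0 \<and> [(l + 2) * (b0 - 1) = 0] (mod n) \<and>
           [2 * (l + 2) = 2 * m * (b0 + 1)] (mod n)))"

lemma (in cayley_twist) listed_8_of_parity:
  assumes n: "n = 8" and p: "even (\<pi> 4)" "odd (\<pi> 1)" and m: "3 \<le> m"
    and conj4: "[y \<star> (conj_twist \<pi> ^^ nat m) 4 = 4 \<star> y] (mod n)"
  shows "\<exists>a l. listed_8 m a l \<and> X = Xb m 8 a 4 l"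
proof -
  have n': "n = 4 * 2" using n by simp
  obtain b0 a0 where r: "0 \<le> b0" "b0 < 2" "0 \<le> a0" "a0 < 2" and A: "[b0 * b0 = 1] (mod 2)"
    and tp: "twist_params 2 b0 a0 m y" "[b0 ^ nat m = parity_sign y] (mod 2)"
    and X: "X = Xb m n (4 * a0 + 1) (4 * b0) ((y - 2 * parity_sign y) mod n)"
    by (rule Xb_of_parity[OF n' order.refl p m conj4]) (rule that; assumption)
  have "b0 = 0 \<or> b0 = 1" using r by linarith
  then have b0: "b0 = 1" using A by (auto simp: cong_def)
  have a0: "a0 = 0 \<or> a0 = 1" using r by linarith
  have X': "X = Xb m 8 (4 * a0 + 1) 4 ((y - 2 * parity_sign y) mod 8)" using X n b0 by simp
  from tp(1) m _ tp(2) show ?thesis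
  proof (rule twist_params_cases)
    fix z assume z: "odd m" "y = 4 * z + 1" "[a0 = 2 * z + 1] (mod 2)"
    then have "a0 = 1" using a0 by (auto simp: cong_iff_dvd_diff)
    moreover have "(y - 2 * parity_sign y) mod 8 \<in> {3, 7}"
    proof -
      have "(4 * z + 3) mod 8 = 3 \<or> (4 * z + 3) mod 8 = 7" by presburger
      then show ?thesis using z(2) by (simp add: parity_sign_def add.commute)
    qed
    ultimately show ?thesis using X' z(1) by (auto simp: listed_8_def)
  next
    fix z assume "odd m" "[2 * z = m] (mod 2)"
    then show ?thesis by (simp add: cong_iff_dvd_diff)
  next
    fix z assume z: "even m" "y = 4 * z"
    have "(y - 2 * parity_sign y) mod 8 \<in> {2, 6}"
    proof -
      have "(4 * z - 2) mod 8 = 2 \<or> (4 * z - 2) mod 8 = 6" by presburger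
      then show ?thesis using z(2) by (simp add: parity_sign_def)
    qed
    then have "listed_8 m (4 * a0 + 1) ((y - 2 * parity_sign y) mod 8)"
      using z(1) a0 by (auto simp: listed_8_def)
    then show ?thesis using X' by blast
  qed simp
qed

lemma (in cayley_twist) listed_12_of_parity:
  assumes n: "12 \<le> n" and p: "even (\<pi> 4)" "odd (\<pi> 1)" and m: "3 \<le> m"
    and conj4: "[y \<star> (conj_twist \<pi> ^^ nat m) 4 = 4 \<star> y] (mod n)"
  shows "\<exists>a b l. admissible m n a b l \<and> listed_12 m n a b l \<and> X = Xb m n a b l"
proof -
  obtain n0 where n': "n = 4 * n0" using n_dvd by (auto simp: dvd_def)
  have n0: "3 \<le> n0" using n n' by simp
  obtain b0 a0 where r: "0 \<le> b0" "b0 < n0" "0 \<le> a0" "a0 < n0"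
    and A: "[b0 * b0 = 1] (mod n0)" "[b0 * a0 + a0 = 0] (mod n0)"
    and tp: "twist_params n0 b0 a0 m y" "[b0 ^ nat m = parity_sign y] (mod n0)"
    and X: "X = Xb m n (4 * a0 + 1) (4 * b0) ((y - 2 * parity_sign y) mod n)"
    using Xb_of_parity[OF n' _ p m conj4] n0 by auto
  define l where "l = (y - 2 * parity_sign y) mod n"
  have lc: "[l = y - 2 * parity_sign y] (mod n)" by (simp add: l_def cong_def)
  have lr: "0 \<le> l" "l < n" using n_pos by (simp_all add: l_def)
  have l4: "[l = y - 2 * parity_sign y] (mod 4)" using lc n_dvd cong_dvd_modulus by blast
  have ev: "even l \<longleftrightarrow> even y"
  proof -
    have "[l = y - 2 * parity_sign y] (mod 2)" using lc n_even cong_dvd_modulus by blast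
    then have "even (l - (y - 2 * parity_sign y))" by (simp add: cong_iff_dvd_diff)
    then show ?thesis by simp
  qed
  have "4 dvd l - 2 \<or> 4 dvd l - 3"
    using y_type
  proof (rule same_type_cases)
    fix z assume y: "y = 4 * z"
    then have "4 dvd l - (4 * z - 2)" using l4 by (simp add: cong_iff_dvd_diff parity_sign_def)
    then show ?thesis by presburger
  next
    fix z assume y: "y = 4 * z + 1"
    then have "4 dvd l - (4 * z + 3)" using l4 by (simp add: cong_iff_dvd_diff parity_sign_def add.commute)
    then show ?thesis by presburger
  qed
  then have adm: "admissible m n (4 * a0 + 1) (4 * b0) l"
    using admissibleI[OF m n' _ r lr A] n0 by simp
  have "listed_12 m n (4 * a0 + 1) (4 * b0) l"
    using tp(1) m _ tp(2)
  proof (rule twist_params_cases)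
    show "2 \<le> n0" using n0 by simp
  next
    fix z assume z: "odd m" "y = 4 * z + 1" "[b0 = - 1] (mod n0)" "[a0 = 2 * z + 1] (mod n0)"
    have "[4 * b0 = 4 * (- 1)] (mod n)" using z(3) unfolding n' cong_scale4 .
    then have 1: "[4 * b0 = n - 4] (mod n)" by (simp add: cong_def)
    have "[4 * a0 + 1 = 4 * (2 * z + 1) + 1] (mod n)" using z(4) unfolding n' cong_scale4_1 .
    also have "4 * (2 * z + 1) + 1 = 2 * (4 * z + 3) - 1" by simp
    also have "[2 * (4 * z + 3) - 1 = 2 * l - 1] (mod n)"
      using cong_sym[OF lc] z(2) by (intro cong_diff cong_mult cong_refl) (simp add: parity_sign_def add.commute)
    finally have 2: "[4 * a0 + 1 = 2 * l - 1] (mod n)" .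
    have "odd l" using ev z(2) by simp
    then show ?thesis using z(1) 1 2 unfolding listed_12_def by blast
  next
    fix z assume z: "odd m" "y = 4 * z" "[b0 = 1] (mod n0)" "[a0 = 0] (mod n0)" "[2 * z = m] (mod n0)"
    have a0: "a0 = 0" using z(4) r by (simp add: cong_def)
    have b0: "b0 = 1" using z(3) r n0 by (simp add: cong_def)
    obtain t where t: "2 * z - m = n0 * t" using z(5) by (auto simp: cong_iff_dvd_diff dvd_def)
    have "odd (n0 * t)" using z(1) unfolding t[symmetric] by simp
    then have o: "odd n0" "odd t" by simp_all
    obtain s where s: "t = 2 * s + 1" using o(2) by (auto elim: oddE)
    have "[l = 4 * z - 2] (mod n)" using lc z(2) by (simp add: parity_sign_def)
    also have "4 * z - 2 = 2 * n0 + 2 * m - 2 + n * s" using t n' s by (simp add: algebra_simps)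
    also have "[2 * n0 + 2 * m - 2 + n * s = 2 * n0 + 2 * m - 2] (mod n)" by (simp add: cong_def)
    finally have 1: "[l = 2 * n0 + 2 * m - 2] (mod n)" .
    have "even l" using ev z(2) by simp
    then have "odd m \<and> even l \<and> 4 * a0 + 1 = 1 \<and> 4 * b0 = 4 \<and>
        (\<exists>n0. n = 4 * n0 \<and> odd n0 \<and> n0 \<ge> 3 \<and> [l = 2 * n0 + 2 * m - 2] (mod n))"
      using z(1) a0 b0 n' o(1) n0 1 by auto
    then show ?thesis unfolding listed_12_def by blast
  next
    fix z assume z: "even m" "y = 4 * z" "[b0 * z = z] (mod n0)" "[2 * z = m div 2 * (b0 + 1)] (mod n0)"
    have "[l = 4 * z - 2] (mod n)" using lc z(2) by (simp add: parity_sign_def)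
    then have "[l + 2 = 4 * z - 2 + 2] (mod n)" by (intro cong_add cong_refl)
    then have l2: "[l + 2 = 4 * z] (mod n)" by simp
    have "[(l + 2) * (b0 - 1) = 4 * z * (b0 - 1)] (mod n)" by (intro cong_mult cong_refl l2)
    also have "4 * z * (b0 - 1) = 4 * (b0 * z - z)" by (simp add: algebra_simps)
    also have "[4 * (b0 * z - z) = 4 * 0] (mod n)"
      unfolding n' cong_scale4 using z(3) by (simp add: cong_iff_dvd_diff)
    finally have 1: "[(l + 2) * (b0 - 1) = 0] (mod n)" by simp
    have "[2 * (l + 2) = 2 * (4 * z)] (mod n)" by (intro cong_mult cong_refl l2)
    also have "2 * (4 * z) = 4 * (2 * z)" by simp
    also have "[4 * (2 * z) = 4 * (m div 2 * (b0 + 1))] (mod n)"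
      unfolding n' cong_scale4 using z(4) .
    also have "4 * (m div 2 * (b0 + 1)) = 2 * m * (b0 + 1)" using z(1) by (auto elim!: evenE)
    finally have 2: "[2 * (l + 2) = 2 * m * (b0 + 1)] (mod n)" .
    have "even l" using ev z(2) by simp
    then show ?thesis using z(1) 1 2 unfolding listed_12_def by blast
  qed
  then show ?thesis using adm X unfolding l_def by blast
qed

lemma affine_cayley_twist:
  assumes n: "n = 4 * n0" "1 \<le> n0" and m: "0 < m" and tp: "twist_params n0 b0 a0 m y"
    and l: "[l = y - 2 * parity_sign y] (mod n)"
  shows "\<exists>\<pi>. cayley_twist n \<pi> m y \<and> Xb m n (4 * a0 + 1) (4 * b0) l = twisted_graph m n \<pi> y"
proof -
  let ?p = "affine_pi (4 * b0) (4 * a0 + 1)"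
  interpret affine_twist n0 b0 a0 ?p by (rule affine_twist_affine_pi)
  have "dihedral_involution (4 * n0) ?p"
    using tp by (intro affine_dihedral_involution n) (auto simp: twist_params_def)
  moreover have "same_type y" using tp unfolding twist_params_def by auto
  ultimately have "cayley_twist n ?p m y" using cayley_twist_iff m tp n(1) by blast
  moreover have "Xb m n (4 * a0 + 1) (4 * b0) l = twisted_graph m n ?p y"
    by (rule Xb_eq_twisted[OF m n l]) simp_all
  ultimately show ?thesis by blast
qed

lemma listed_8_cayley_twist:
  assumes m: "0 < m" and L: "listed_8 m a l"
  shows "\<exists>\<pi> y. cayley_twist 8 \<pi> m y \<and> Xb m 8 a 4 l = twisted_graph m 8 \<pi> y"
proof -
  have "\<exists>a0 y. a = 4 * a0 + 1 \<and> twist_params 2 1 a0 m y \<and> [l = y - 2 * parity_sign y] (mod 8)"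
  proof (cases "odd m")
    case True
    then have al: "a = 4 * 1 + 1" "l = 4 * 0 + 3 \<or> l = 4 * 1 + 3" using L by (auto simp: listed_8_def)
    then obtain z where z: "l = 4 * z + 3" by blast
    have "[1 = 2 * z + 1] (mod 2)" "[1 = - 1] (mod (2::int))" by (simp_all add: cong_iff_dvd_diff)
    then have "twist_params 2 1 1 m (4 * z + 1)" using twist_params_odd_odd[OF True m] by blast
    moreover have "l = (4 * z + 1) - 2 * parity_sign (4 * z + 1)" using z by (simp add: parity_sign_def)
    ultimately show ?thesis using al(1) by (intro exI[of _ 1] exI[of _ "4 * z + 1"]) simp
  next
    case False
    then have "a = 4 * 0 + 1 \<or> a = 4 * 1 + 1" "l = 4 * 1 - 2 \<or> l = 4 * 2 - 2"
      using L by (auto simp: listed_8_def)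
    then obtain a0 z where az: "a = 4 * a0 + 1" "l = 4 * z - 2" by blast
    have "[1 * 1 = 1] (mod (2::int))" "[1 * a0 + a0 = 0] (mod 2)" "[1 * z = z] (mod 2)"
      "[2 * z = m div 2 * (1 + 1)] (mod 2)" by (simp_all add: cong_iff_dvd_diff)
    then have "twist_params 2 1 a0 m (4 * z)" using twist_params_even_even False m by blast
    moreover have "l = (4 * z) - 2 * parity_sign (4 * z)" using az by (simp add: parity_sign_def)
    ultimately show ?thesis using az(1) by (intro exI[of _ a0] exI[of _ "4 * z"]) simp
  qed
  then obtain a0 y where ay: "a = 4 * a0 + 1" "twist_params 2 1 a0 m y" "[l = y - 2 * parity_sign y] (mod 8)"
    by blast
  have "\<exists>\<pi>. cayley_twist 8 \<pi> m y \<and> Xb m 8 (4 * a0 + 1) (4 * 1) l = twisted_graph m 8 \<pi> y"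
    by (rule affine_cayley_twist[OF _ _ m ay(2,3)]) simp_all
  then show ?thesis unfolding ay(1) by auto
qed

lemma listed_12_cayley_twist:
  assumes adm: "admissible m n a b l" and L: "listed_12 m n a b l"
  shows "\<exists>\<pi> y. cayley_twist n \<pi> m y \<and> Xb m n a b l = twisted_graph m n \<pi> y"
proof -
  obtain n0 a0 b0 where m: "3 \<le> m" and n0: "2 \<le> n0" "n = 4 * n0" and b: "b = 4 * b0" "1 \<le> b0" "b0 < n0"
    and a: "a = 4 * a0 + 1" "0 \<le> a0" "a0 < n0"
    and A': "[b * b0 = 4] (mod n)" "[b * a0 + a = 1] (mod n)" and l: "4 dvd l - 2 \<or> 4 dvd l - 3"
    using adm unfolding admissible_def by blast
  have "[4 * (b0 * b0) = 4 * 1] (mod 4 * n0)" using A'(1) b n0 by (simp add: mult.assoc)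
  then have A1: "[b0 * b0 = 1] (mod n0)" by (simp only: cong_scale4)
  have "[4 * (b0 * a0 + a0) + 1 = 4 * 0 + 1] (mod 4 * n0)" using A'(2) a b n0 by (simp add: algebra_simps)
  then have A2: "[b0 * a0 + a0 = 0] (mod n0)" by (simp only: cong_scale4_1)
  have m0: "0 < m" using m by simp
  have "\<exists>y. twist_params n0 b0 a0 m y \<and> l = y - 2 * parity_sign y"
    using L unfolding listed_12_def
  proof (elim disjE conjE exE)
    assume c: "odd m" "odd l" "[b = n - 4] (mod n)" "[a = 2 * l - 1] (mod n)"
    have "\<not> 4 dvd l - 2" using c(2) by presburger
    then obtain z where z: "l - 3 = 4 * z" using l by (auto simp: dvd_def)
    have "[4 * b0 = 4 * (- 1)] (mod 4 * n0)" using c(3) b n0 by (simp add: cong_def)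
    then have b0: "[b0 = - 1] (mod n0)" by (simp only: cong_scale4)
    have "2 * l - 1 = 4 * (2 * z + 1) + 1" using z by simp
    then have "[4 * a0 + 1 = 4 * (2 * z + 1) + 1] (mod 4 * n0)" using c(4) a n0 by simp
    then have a0: "[a0 = 2 * z + 1] (mod n0)" by (simp only: cong_scale4_1)
    show ?thesis
      using twist_params_odd_odd[OF c(1) m0 b0 a0] z by (intro exI[of _ "4 * z + 1"]) (simp add: parity_sign_def)
  next
    fix n1 assume c: "odd m" "even l" "a = 1" "b = 4" "n = 4 * n1" "[l = 2 * n1 + 2 * m - 2] (mod n)"
    have "\<not> 4 dvd l - 3" using c(2) by presburger
    then obtain w where w: "l - 2 = 4 * w" using l by (auto simp: dvd_def)
    define z where "z = w + 1"
    have z: "l = 4 * z - 2" using w by (simp add: z_def)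
    have "4 * n0 dvd l - (2 * n0 + 2 * m - 2)" using c(5,6) n0 by (simp add: cong_iff_dvd_diff)
    moreover have "l - (2 * n0 + 2 * m - 2) = 4 * z - 2 * n0 - 2 * m" using z by simp
    ultimately obtain t where "4 * z - 2 * n0 - 2 * m = 4 * n0 * t" unfolding dvd_def by auto
    then have "2 * z - m = n0 * (2 * t + 1)" by (simp add: algebra_simps)
    then have zm: "[2 * z = m] (mod n0)" by (simp add: cong_iff_dvd_diff)
    have "b0 = 1" "a0 = 0" using c(3,4) a b by simp_all
    then show ?thesis
      using twist_params_odd_even[OF c(1) m0 _ _ zm, of b0 a0] z
      by (intro exI[of _ "4 * z"]) (simp add: parity_sign_def)
  next
    fix b1 assume c: "even m" "even l" "b = 4 * b1" "[(l + 2) * (b1 - 1) = 0] (mod n)"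
      "[2 * (l + 2) = 2 * m * (b1 + 1)] (mod n)"
    have b1: "b1 = b0" using c(3) b by simp
    have "\<not> 4 dvd l - 3" using c(2) by presburger
    then obtain w where w: "l - 2 = 4 * w" using l by (auto simp: dvd_def)
    define z where "z = w + 1"
    have z: "l = 4 * z - 2" using w by (simp add: z_def)
    have "(l + 2) * (b1 - 1) = 4 * (b0 * z - z)" using z b1 by (simp add: algebra_simps)
    then have "[4 * (b0 * z - z) = 4 * 0] (mod 4 * n0)" using c(4) n0 by simp
    then have z1: "[b0 * z = z] (mod n0)" unfolding cong_scale4 by (simp add: cong_iff_dvd_diff)
    have "2 * (l + 2) = 4 * (2 * z)" "2 * m * (b1 + 1) = 4 * (m div 2 * (b0 + 1))"
      using z b1 c(1) by (auto elim!: evenE)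
    then have "[4 * (2 * z) = 4 * (m div 2 * (b0 + 1))] (mod 4 * n0)" using c(5) n0 by (simp only:)
    then have z2: "[2 * z = m div 2 * (b0 + 1)] (mod n0)" unfolding cong_scale4 .
    show ?thesis
      using twist_params_even_even[OF c(1) m0 A1 A2 z1 z2] z
      by (intro exI[of _ "4 * z"]) (simp add: parity_sign_def)
  qed
  then obtain y where y: "twist_params n0 b0 a0 m y" "l = y - 2 * parity_sign y" by blast
  have n01: "1 \<le> n0" using n0 by simp
  show ?thesis
    using affine_cayley_twist[OF n0(2) n01 m0 y(1), of l] y(2) unfolding a b by auto
qed

section \<open>The case of period eight\<close>

text \<open>
  The twist permutes the three involutions 1, 4, 5 of Klein's four-group. If it fixes 4, it is
  affine. Otherwise it exchanges 4 with 1 or with 5; then \<open>conj_twist \<pi>\<close> permutes 1, 4, 5 cyclically,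
  so that \<open>y\<close>, being fixed by it, is 0, and \<open>conj\<close> for \<open>k = 4\<close> says that its \<open>m\<close>-th power is trivial.
\<close>
lemma (in cayley_twist) period_8_cases:
  assumes n: "n = 8" and m: "3 \<le> m"
    and conj: "\<And>k. same_type k \<Longrightarrow> [y \<star> (conj_twist \<pi> ^^ nat m) k = k \<star> y] (mod n)"
  shows "(\<exists>a l. listed_8 m a l \<and> X = Xb m 8 a 4 l) \<or> 3 dvd m \<and> (X = Xb1 m \<or> X = Xb2 m)"
proof -
  have m8: "(x::int) mod 8 = y mod 8" if "[x = y] (mod 8)" for x y using that by (simp add: cong_def)
  have t: "same_type 4" "same_type 1" "same_type 5" by (simp_all add: same_type_mod8)
  have p0: "\<pi> 0 mod 8 = 0" using pi_zero n by (simp add: cong_def)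
  have inj: "p mod 8 = p' mod 8" if "\<pi> p mod 8 = \<pi> p' mod 8" "same_type p" "same_type p'" for p p'
  proof -
    have "[\<pi> (\<pi> p) = \<pi> (\<pi> p')] (mod 8)" using pi_cong[of "\<pi> p" "\<pi> p'"] that(1) n by (simp add: cong_def)
    then have "[p = p'] (mod 8)"
      using pi_pi[OF that(2)] pi_pi[OF that(3)] n by (metis cong_sym cong_trans)
    then show ?thesis by (simp add: cong_def)
  qed
  have invol: "\<pi> q mod 8 = p mod 8" if "\<pi> p mod 8 = q mod 8" "same_type p" for p q
    using pi_cong[of "\<pi> p" q] pi_pi[OF that(2)] that(1) n by (simp add: cong_def)
  have par: "even x \<longleftrightarrow> even (x mod 8)" for x :: int by presburger
  have p4: "\<pi> 4 mod 8 = 1 \<or> \<pi> 4 mod 8 = 4 \<or> \<pi> 4 mod 8 = 5"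
    using pi_type[OF t(1)] inj[of 4 0] p0 t unfolding same_type_mod8[of "\<pi> 4"] by auto
  have swap: "3 dvd m \<and> X = twisted_graph m 8 (swap8 s t) 0"
    if st: "s = 1 \<and> t = 4 \<or> s = 4 \<and> t = 5"
      and eq: "\<And>p. same_type p \<Longrightarrow> [\<pi> p = swap8 s t p] (mod 8)" for s t
  proof -
    let ?f = "conj_twist (swap8 s t)"
    interpret S: dihedral_involution 8 "swap8 s t" by (rule swap8_dihedral_involution[OF st])
    have feq: "[conj_twist \<pi> p = ?f p] (mod 8)" if "same_type p" for p
      unfolding conj_twist_def by (intro S.mult_cong cong_refl eq that)
    have f4: "?f 4 \<noteq> 4 \<and> ?f 4 mod 8 \<noteq> 4" "?f (?f 4) mod 8 \<noteq> 4" "?f (?f (?f 4)) = 4"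
      using st by (elim disjE conjE; simp add: conj_swap8)+
    have y0: "y mod 8 = 0"
    proof -
      have "?f y mod 8 = y mod 8" using cong_trans[OF cong_sym[OF feq[OF y_type]]] y_fixed n
        by (simp add: cong_def)
      moreover have "?f y = ?f (y mod 8)" by (simp add: conj_twist_def swap8_def)
      moreover have "?f 1 mod 8 \<noteq> 1" "?f 4 mod 8 \<noteq> 4" "?f 5 mod 8 \<noteq> 5"
        using st by (elim disjE conjE;
          simp add: conj_twist_def swap8_def dih_mult_def parity_sign_def)+
      ultimately show ?thesis using y_type unfolding same_type_mod8 by metis
    qed
    have fpow: "[(conj_twist \<pi> ^^ j) 4 = (?f ^^ j) 4] (mod 8) \<and> same_type ((conj_twist \<pi> ^^ j) 4)" for j
    proof (induction j)
      case (Suc j)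
      have "[conj_twist \<pi> ((conj_twist \<pi> ^^ j) 4) = ?f ((conj_twist \<pi> ^^ j) 4)] (mod 8)"
        using feq Suc by blast
      also have "[?f ((conj_twist \<pi> ^^ j) 4) = ?f ((?f ^^ j) 4)] (mod 8)" using S.conj_twist_cong Suc by blast
      finally show ?case using conj_twist_type Suc by simp
    qed (use t in simp)
    have "[(?f ^^ nat m) 4 = 4] (mod 8)"
    proof -
      have "[y \<star> (conj_twist \<pi> ^^ nat m) 4 = 0 \<star> (?f ^^ nat m) 4] (mod 8)"
        using y0 fpow by (intro S.mult_cong) (simp_all add: cong_def)
      moreover have "[4 \<star> y = 4 \<star> 0] (mod 8)" using y0 by (intro S.mult_cong) (simp_all add: cong_def)
      ultimately show ?thesis using conj[OF t(1)] n by (metis cong_sym cong_trans dih_0)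
    qed
    moreover have "(?f ^^ (3 * k)) 4 = 4" for k
    proof (induction k)
      case (Suc k)
      have "3 * Suc k = Suc (Suc (Suc (3 * k)))" by simp
      then show ?case using Suc f4(3) by (simp only: funpow.simps o_apply)
    qed simp
    moreover have "nat m = 3 * (nat m div 3) + nat m mod 3" by simp
    moreover have "nat m mod 3 = 0 \<or> nat m mod 3 = 1 \<or> nat m mod 3 = 2"
    proof -
      have "nat m mod 3 < 3" by simp
      then show ?thesis by arith
    qed
    ultimately have "nat m mod 3 = 0"
    proof -
      define k where "k = nat m div 3"
      have k: "nat m = 3 * k + nat m mod 3" by (simp add: k_def)
      have "(?f ^^ Suc (3 * k)) 4 = ?f 4" "(?f ^^ Suc (Suc (3 * k))) 4 = ?f (?f 4)"
        using \<open>\<And>k. (?f ^^ (3 * k)) 4 = 4\<close> by simp_all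
      then have "nat m \<noteq> Suc (3 * k)" "nat m \<noteq> Suc (Suc (3 * k))"
        using \<open>[(?f ^^ nat m) 4 = 4] (mod 8)\<close> f4 by (auto simp: cong_def simp del: funpow.simps)
      then show ?thesis using k \<open>nat m mod 3 = 0 \<or> nat m mod 3 = 1 \<or> nat m mod 3 = 2\<close> by linarith
    qed
    then have "3 dvd nat m" by (simp add: dvd_eq_mod_eq_0)
    then have "int 3 dvd int (nat m)" by (simp only: int_dvd_int_iff)
    then have "3 dvd m" using m by simp
    moreover have "X = twisted_graph m 8 (swap8 s t) 0"
      unfolding n using y0 eq by (intro twisted_graph_cong) (simp_all add: cong_def)
    ultimately show ?thesis by blast
  qed
  have eqI: "[\<pi> p = swap8 s t p] (mod 8)"
    if "\<pi> 1 mod 8 = swap8 s t 1" "\<pi> 4 mod 8 = swap8 s t 4" "\<pi> 5 mod 8 = swap8 s t 5" "same_type p"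
      "s = 1 \<and> t = 4 \<or> s = 4 \<and> t = 5" for s t p
  proof -
    have "\<pi> p mod 8 = \<pi> (p mod 8) mod 8" using pi_cong[of p "p mod 8"] n by (simp add: cong_def)
    also have "\<dots> = swap8 s t (p mod 8)"
    proof -
      have "\<pi> 0 mod 8 = swap8 s t 0" using p0 that(5) by (auto simp: swap8_def)
      then show ?thesis using that(1-4) unfolding same_type_mod8 by metis
    qed
    also have "\<dots> = swap8 s t p" by (simp add: swap8_def)
    finally have *: "\<pi> p mod 8 = swap8 s t p" .
    have "swap8 s t p mod 8 = \<pi> p mod 8" unfolding *[symmetric] by (rule mod_mod_trivial)
    then show ?thesis by (simp only: cong_def)
  qed
  from p4 show ?thesis
  proof (elim disjE)
    assume a: "\<pi> 4 mod 8 = 1"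
    then have b: "\<pi> 1 mod 8 = 4" using invol[of 4 1] t by simp
    have "\<pi> 5 mod 8 = 5"
      using pi_type[OF t(3)] inj[of 5 4] inj[of 5 1] inj[of 5 0] a b p0 t
      unfolding same_type_mod8[of "\<pi> 5"] by auto
    then have "3 dvd m \<and> X = twisted_graph m 8 (swap8 1 4) 0"
      using a b by (intro swap eqI) (auto simp: swap8_def)
    then show ?thesis using Xb1_eq_twisted[OF m_pos] by simp
  next
    assume a: "\<pi> 4 mod 8 = 5"
    then have b: "\<pi> 5 mod 8 = 4" using invol[of 4 5] t by simp
    have "\<pi> 1 mod 8 = 1"
      using pi_type[OF t(2)] inj[of 1 4] inj[of 1 5] inj[of 1 0] a b p0 t
      unfolding same_type_mod8[of "\<pi> 1"] by auto
    then have "3 dvd m \<and> X = twisted_graph m 8 (swap8 4 5) 0"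
      using a b by (intro swap eqI) (auto simp: swap8_def)
    then show ?thesis using Xb2_eq_twisted[OF m_pos] by simp
  next
    assume a: "\<pi> 4 mod 8 = 4"
    have "\<pi> 1 mod 8 = 1 \<or> \<pi> 1 mod 8 = 5"
      using pi_type[OF t(2)] inj[of 1 4] inj[of 1 0] a p0 t unfolding same_type_mod8[of "\<pi> 1"] by auto
    then have "odd (\<pi> 1)" using par[of "\<pi> 1"] by auto
    moreover have "even (\<pi> 4)" using par[of "\<pi> 4"] a by simp
    ultimately show ?thesis using listed_8_of_parity[OF n _ _ m conj[OF t(1)]] by blast
  qed
qed

section \<open>Cycles of length four\<close>

locale square_system = bialternating_system + assumes n4: "n = 4"
begin

text \<open>
  Only two vertices of the next cycle have their outside neighbours on the given one, and these are
  mates.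
\<close>
lemma out_mate:
  assumes v: "v \<in> V"
  shows "out (mate v) = mate (out v)"
proof -
  have "layer (out (mate v)) = layer (out v)"
    using v by (simp add: layer_out mate_in layer_mate sig_mate)
  then obtain k where k: "out (mate v) = walk (out v) k"
    using same_layer_walk[of "out v" "out (mate v)"] v by (auto simp: out_in mate_in)
  have "sig (out (mate v)) = sig (out v)" using v by (simp add: sig_out mate_in sig_mate)
  then have "same_type k" using k v sig_cases[of "out v"] by (auto simp: sig_walk out_in split: if_splits)
  then have "[k = 0] (mod n) \<or> [k = 1] (mod n)" by (auto simp: same_type_def n4 cong_def)
  moreover have "\<not> [k = 0] (mod n)"
  proof
    assume "[k = 0] (mod n)"
    then have "out (mate v) = out v" using k walk_cong[of "out v" k 0] v by (simp add: out_in walk_0)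
    then have "mate v = v" using out_out[OF v] out_out[OF mate_in[OF v]] by metis
    then show False using nbrs_distinct(1)[OF v] by simp
  qed
  ultimately show ?thesis using k walk_cong[of "out v" k 1] v by (simp add: out_in mate_eq_walk)
qed

lemma flip_mate: "v \<in> V \<Longrightarrow> flip (mate v) = mate (flip v)"
  using mate_walk[of v "- 1"] flip_walk[of v 1] walk_eq_iff[of v "1 \<star> - 1" "- 1 \<star> 1"]
  by (simp add: mate_eq_walk[of v] flip_eq_walk[of v] n4) (simp add: dih_mult_def parity_sign_def cong_def)

text \<open>
  All relations hold, because they are congruences modulo \<open>n0 = 1\<close>.
\<close>
lemma factor_auts_transitive:
  "\<exists>G. subgroup G (aut_group \<Gamma>) \<and> transitive_on_vertices \<Gamma> G \<and> preserves G \<C>"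
proof -
  obtain y where y: "same_type y" "(advance ^^ nat m) base = walk base y" using exists_return[OF base(1)] by blast
  have m0: "0 < m" using m_ge by simp
  have di: "dihedral_involution (4 * 1) (affine_pi (4 * 1) (4 * 0 + 1))"
    by (rule affine_dihedral_involution) simp_all
  interpret affine_twist 1 1 0 "affine_pi (4 * 1) (4 * 0 + 1)" by (rule affine_twist_affine_pi)
  have "twist_params 1 1 0 m y"
    using y(1) unfolding twist_params_def by (auto elim!: same_type_cases)
  then have "cayley_twist (4 * 1) (affine_pi (4 * 1) (4 * 0 + 1)) m y"
    using cayley_twist_iff[OF di m0 y(1)] by blast
  then have tw: "cayley_twist n (affine_pi 4 1) m y" by (simp add: n4)
  have "iso_with_factor \<Gamma> \<C> m n (twisted_graph m n (affine_pi 4 1) y)"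
  proof (rule labelling[OF tw base _ y(2)])
    fix i p assume p: "same_type p"
    let ?v = "(advance ^^ nat i) base"
    have v: "?v \<in> V" by (rule advance_pow_in[OF base(1)])
    have "affine_pi 4 1 p = p" by (simp add: affine_pi_def)
    moreover have "[p = 0] (mod n) \<or> [p = 1] (mod n)" using p by (auto simp: same_type_def n4 cong_def)
    then have "out (walk ?v p) = walk (out ?v) p"
    proof
      assume "[p = 0] (mod n)"
      then show ?thesis using walk_cong[of _ p 0] v by (simp add: out_in walk_0)
    next
      assume "[p = 1] (mod n)"
      then show ?thesis using walk_cong[of _ p 1] v out_mate[OF v]
        by (simp add: out_in mate_eq_walk[symmetric])
    qed
    ultimately show "out (walk ?v p) = walk (out ?v) (affine_pi 4 1 p)" by simp
  qed
  then show ?thesis by (rule cayley_twist_imp_group[OF tw _ inner])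
qed

text \<open>
  One side of the ladder, whose rungs are the edges between mates.
\<close>
fun rail :: "nat \<Rightarrow> 'a" where
  "rail 0 = base"
| "rail (Suc k) = (if even k then out (rail k) else flip (rail k))"

lemma rail_in: "rail k \<in> V"
  by (induction k) (auto simp: base out_in flip_in)

lemma rail_sig: "sig (rail k) = (if even k then 1 else - 1)"
  by (induction k) (auto simp: base sig_out sig_flip rail_in)

lemma rail_layer: "layer (rail k) = (int ((k + 1) div 2)) mod m"
proof (induction k)
  case (Suc k)
  show ?case
  proof (cases "even k")
    case True
    then have "(Suc k + 1) div 2 = (k + 1) div 2 + 1" by (auto elim!: evenE)
    then show ?thesis using True Suc by (simp add: layer_out rail_in rail_sig mod_simps add.commute)
  next
    case False
    then have "(Suc k + 1) div 2 = (k + 1) div 2" by (auto elim!: oddE)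
    then show ?thesis using False Suc by (simp add: layer_flip rail_in)
  qed
qed (use base in simp)

lemma same_class:
  assumes "v \<in> V" "w \<in> V" "layer w = layer v" "sig w = sig v"
  shows "w = v \<or> w = mate v"
proof -
  obtain j where j: "w = walk v j" using same_layer_walk[OF assms(1-3)] by blast
  have "same_type j" using assms j sig_cases[OF assms(1)] by (auto simp: sig_walk split: if_splits)
  then have "[j = 0] (mod n) \<or> [j = 1] (mod n)" by (auto simp: same_type_def n4 cong_def)
  then show ?thesis using j walk_cong[OF assms(1)] assms(1) by (auto simp: walk_0 mate_eq_walk)
qed

lemma rail_class:
  assumes "v \<in> V"
  shows "\<exists>k < nat (2 * m). v = rail k \<or> v = mate (rail k)"
proof -
  let ?l = "nat (layer v)"
  note r = layer_range[OF assms]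
  define k where "k = (if sig v = 1 then 2 * ?l else if ?l = 0 then nat (2 * m) - 1 else 2 * ?l - 1)"
  have k: "k < nat (2 * m)" using r m_ge by (auto simp: k_def)
  have "layer v = layer (rail k) \<and> sig v = sig (rail k)"
  proof (cases "sig v = 1")
    case True
    then show ?thesis using r by (simp add: rail_layer rail_sig k_def)
  next
    case False
    then have s: "sig v = - 1" using sig_cases[OF assms] by blast
    show ?thesis
    proof (cases "?l = 0")
      case True
      then have k': "k + 1 = 2 * nat m" using s m_ge by (simp add: k_def)
      have "(k + 1) div 2 = nat m" unfolding k' by simp
      moreover have "even (k + 1)" unfolding k' by simp
      ultimately show ?thesis using s True r m_ge by (simp add: rail_layer rail_sig)
    next
      case F: False
      then have k': "k + 1 = 2 * ?l" using s by (simp add: k_def)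
      have "(k + 1) div 2 = ?l" unfolding k' by simp
      moreover have "even (k + 1)" unfolding k' by simp
      ultimately show ?thesis using s r by (simp add: rail_layer rail_sig)
    qed
  qed
  then show ?thesis using same_class[OF rail_in assms, of k] k by auto
qed

lemma rail_inj:
  assumes "layer (rail k) = layer (rail k')" "sig (rail k) = sig (rail k')"
  shows "[int k = int k'] (mod 2 * m)"
proof -
  have p: "even k \<longleftrightarrow> even k'" using assms(2) by (auto simp: rail_sig split: if_splits)
  have "[int ((k + 1) div 2) = int ((k' + 1) div 2)] (mod m)"
    using assms(1) by (simp add: rail_layer cong_def)
  then have d: "2 * m dvd 2 * (int ((k + 1) div 2) - int ((k' + 1) div 2))"
    unfolding cong_iff_dvd_diff by (rule mult_dvd_mono[OF dvd_refl])
  have half: "2 * int ((i + 1) div 2) = int i + (if even i then 0 else 1)" for i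
  proof -
    have "2 * ((i + 1) div 2) = i + (if even i then 0 else 1)" by (auto elim!: evenE oddE)
    then have "int (2 * ((i + 1) div 2)) = int (i + (if even i then 0 else 1))" by (rule arg_cong)
    then show ?thesis
      by (simp only: of_nat_mult of_nat_add of_nat_numeral if_distrib[of int] of_nat_0 of_nat_1)
  qed
  have "2 * (int ((k + 1) div 2) - int ((k' + 1) div 2)) = int k - int k'"
    using half[of k] half[of k'] p by (simp only: right_diff_distrib)
  then show ?thesis using d by (simp add: cong_iff_dvd_diff)
qed

lemma rail_mate:
  assumes "rail (k + c) = mate (rail k)" "even c"
  shows "rail (k + j + c) = mate (rail (k + j))"
  using assms
  by (induction j) (simp_all add: out_mate flip_mate rail_in)

lemma rail_period:
  assumes "rail c = base" "even c"
  shows "rail (k + c) = rail k" "rail (k mod c) = rail k"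
proof -
  show per: "rail (k + c) = rail k" for k using assms by (induction k) simp_all
  have "rail (k mod c + j * c) = rail (k mod c)" for j
    by (induction j) (simp_all add: per add.assoc[symmetric] add.commute[of c])
  from this[of "k div c"] show "rail (k mod c) = rail k" by (simp add: add.commute)
qed

text \<open>
  The rail with integer indices, if \<open>c\<close> is a period.
\<close>
definition "rail_at c k = rail (nat (k mod int c))"

lemma rail_at_nbrs:
  assumes c: "rail c = base" "even c" "0 < c"
  shows "{out (rail_at c k), flip (rail_at c k)} = {rail_at c (k + 1), rail_at c (k - 1)}"
proof -
  have at: "rail_at c k = rail i" if "[k = int i] (mod int c)" for k i
  proof -
    have "nat (k mod int c) = i mod c"
      using that c(3) by (simp add: cong_def nat_mod_distrib nat_int flip: zmod_int)
    then show ?thesis using rail_period(2)[OF c(1,2)] by (simp add: rail_at_def)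
  qed
  define i where "i = nat (k mod int c) + c"
  have i: "[k = int i] (mod int c)" using c(3) by (simp add: i_def cong_def)
  have i1: "1 \<le> i" using c(3) by (simp add: i_def)
  have "[k + 1 = int (i + 1)] (mod int c)" "[k - 1 = int (i - 1)] (mod int c)"
    using cong_add[OF i cong_refl[of 1]] cong_diff[OF i cong_refl[of 1]] i1
    by (simp_all add: of_nat_diff add.commute)
  then have e: "rail_at c k = rail i" "rail_at c (k + 1) = rail (i + 1)" "rail_at c (k - 1) = rail (i - 1)"
    using at i by blast+
  obtain i' where i': "i = Suc i'" using i1 by (cases i) auto
  show ?thesis
    unfolding e i' by (cases "even i'") (auto simp: out_out flip_flip rail_in)
qed

lemma rail_at_in: "rail_at c k \<in> V" by (simp add: rail_at_def rail_in)

lemma rail_at_cong: "[k = k'] (mod int c) \<Longrightarrow> rail_at c k = rail_at c k'"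
  by (simp add: rail_at_def cong_def)

text \<open>
  The rail takes \<open>2 * m\<close> steps to pass once through all layers. It is then back at the base vertex,
  and the two rails form a prism, or at its mate. In the second case a single closed rail of length
  \<open>4 * m\<close> passes through all vertices and antipodal ones are mates.
\<close>
theorem ladder: "graph_isomorphic \<Gamma> (moebius_ladder m) \<or> graph_isomorphic \<Gamma> (prism m)"
proof -
  define c where "c = nat (2 * m)"
  have ci: "int c = 2 * m" and ev: "even c" and c0: "0 < c" using m_ge by (auto simp: c_def even_nat_iff)
  have cl: "layer (rail c) = layer base" "sig (rail c) = sig base"
  proof -
    have "c = 2 * nat m" by (simp add: c_def nat_mult_distrib)
    then have "(c + 1) div 2 = nat m" by simp
    then show "layer (rail c) = layer base" using base m_ge by (simp add: rail_layer)
    show "sig (rail c) = sig base" using base ev by (simp add: rail_sig)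
  qed
  have nat_lt: "k < nat (2 * m) \<Longrightarrow> k < c" for k by (simp add: c_def)
  from same_class[OF base(1) rail_in cl] show ?thesis
  proof
    assume per: "rail c = base"
    note nb = rail_at_nbrs[OF per ev c0]
    define h where "h = (\<lambda>(k, b). if b then mate (rail_at c k) else rail_at c k)"
    let ?P = "prism m"
    have PV: "pverts ?P = {0..<2 * m} \<times> UNIV"
      by (simp add: prism_def cartesian_product_def cycle_graph_def circulant_def K2_def)
    have hV: "h a \<in> V" for a by (simp add: h_def case_prod_unfold mate_in rail_at_in)
    have cls: "layer (h (k, b)) = layer (rail_at c k)" "sig (h (k, b)) = sig (rail_at c k)" for k b
      by (simp_all add: h_def layer_mate sig_mate rail_at_in)
    have hinj: "k = k' \<and> b = b'" if "h (k, b) = h (k', b')" "k \<in> {0..<2 * m}" "k' \<in> {0..<2 * m}" for k b k' b'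
    proof -
      have "layer (rail_at c k) = layer (rail_at c k')" "sig (rail_at c k) = sig (rail_at c k')"
        using cls that(1) by metis+
      then have "[int (nat (k mod int c)) = int (nat (k' mod int c))] (mod 2 * m)"
        unfolding rail_at_def by (rule rail_inj)
      then have "k = k'" using that(2,3) ci by (simp add: cong_def)
      moreover have "b = b'"
        using that(1) \<open>k = k'\<close> nbrs_distinct(1)[OF rail_at_in[of c k]] by (auto simp: h_def split: if_splits)
      ultimately show ?thesis by simp
    qed
    have bij: "bij_betw h (pverts ?P) V"
    proof (rule bij_betw_imageI)
      show "inj_on h (pverts ?P)"
      proof (rule inj_onI)
        fix x y assume "x \<in> pverts ?P" "y \<in> pverts ?P" "h x = h y"
        then show "x = y" using hinj[of "fst x" "snd x" "fst y" "snd y"] by (auto simp: PV prod_eq_iff)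
      qed
      show "h ` pverts ?P = V"
      proof
        show "h ` pverts ?P \<subseteq> V" using hV by blast
        show "V \<subseteq> h ` pverts ?P"
        proof
          fix v assume "v \<in> V"
          then obtain k where k: "k < c" "v = rail k \<or> v = mate (rail k)" using rail_class nat_lt by blast
          then have "rail_at c (int k) = rail k" by (simp add: rail_at_def)
          then have "v = h (int k, v \<noteq> rail k)" using k by (auto simp: h_def)
          moreover have "(int k, v \<noteq> rail k) \<in> pverts ?P" using k ci by (simp add: PV)
          ultimately show "v \<in> h ` pverts ?P" by blast
        qed
      qed
    qed
    have hm: "mate (h (k, b)) = h (k, \<not> b)" for k b by (simp add: h_def mate_mate rail_at_in)
    have ho: "{out (h (k, b)), flip (h (k, b))} = {h (k + 1, b), h (k - 1, b)}" for k b
    proof (cases b)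
      case True
      have "{out (h (k, b)), flip (h (k, b))} = mate ` {out (rail_at c k), flip (rail_at c k)}"
        using True by (simp add: h_def out_mate flip_mate rail_at_in)
      also have "\<dots> = {h (k + 1, b), h (k - 1, b)}" unfolding nb using True by (simp add: h_def)
      finally show ?thesis .
    next
      case False
      then show ?thesis using nb[of k] by (simp add: h_def)
    qed
    have hc: "h (k, b) = h (k', b)" if "[k = k'] (mod 2 * m)" for k k' b
      using rail_at_cong[of k k' c] that ci by (simp add: h_def)
    have arc: "((k, b), (k', b')) \<in> parcs ?P \<longleftrightarrow> (h (k, b), h (k', b')) \<in> parcs \<Gamma>"
      if k: "k \<in> {0..<2 * m}" "k' \<in> {0..<2 * m}" for k b k' b'
    proof -
      have eq: "h (k', b') = h (j, b'') \<longleftrightarrow> [k' = j] (mod 2 * m) \<and> b' = b''" for j b''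
      proof -
        have "h (j, b'') = h (j mod (2 * m), b'')" by (rule hc) (simp add: cong_def)
        moreover have "j mod (2 * m) \<in> {0..<2 * m}" using m_ge by simp
        moreover have "k' = j mod (2 * m) \<longleftrightarrow> [k' = j] (mod 2 * m)" using k(2) by (simp add: cong_def)
        ultimately show ?thesis using hinj[of k' b' "j mod (2 * m)" b''] k(2) by auto
      qed
      have kk: "[k' = k] (mod 2 * m) \<longleftrightarrow> k = k'" using k by (auto simp: cong_def)
      have "(h (k, b), h (k', b')) \<in> parcs \<Gamma> \<longleftrightarrow>
          h (k', b') = mate (h (k, b)) \<or> h (k', b') \<in> {out (h (k, b)), flip (h (k, b))}"
        using hV by (auto simp: arcs)
      also have "\<dots> \<longleftrightarrow> (k = k' \<and> b' = (\<not> b)) \<or> (([k' = k + 1] (mod 2 * m) \<or> [k' = k - 1] (mod 2 * m)) \<and> b = b')"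
        unfolding ho hm by (auto simp: eq kk)
      also have "\<dots> \<longleftrightarrow> (k = k' \<and> b \<noteq> b') \<or> (([k' - k = 1] (mod 2 * m) \<or> [k' - k = - 1] (mod 2 * m)) \<and> b = b')"
        by (auto simp: cong_iff_dvd_diff algebra_simps)
      also have "\<dots> \<longleftrightarrow> ((k, b), (k', b')) \<in> parcs ?P"
        using k by (auto simp: prism_def cartesian_product_def cycle_graph_def circulant_def K2_def)
      finally show ?thesis by simp
    qed
    have "graph_isomorphism h ?P \<Gamma>"
      using bij arc by (auto simp: graph_isomorphism_def PV)
    from graph_isomorphism_inv[OF this] show ?thesis unfolding graph_isomorphic_def by blast
  next
    assume tw: "rail c = mate base"
    have tw': "rail (k + c) = mate (rail k)" for k using rail_mate[of 0 c k] tw ev by simp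
    have per: "rail (2 * c) = base" using tw'[of c] tw base by (simp add: mult_2 mate_mate)
    have ev2: "even (2 * c)" "0 < 2 * c" using c0 by simp_all
    note nb = rail_at_nbrs[OF per ev2]
    have ci2: "int (2 * c) = 4 * m" using ci by simp
    let ?h = "rail_at (2 * c)" and ?P = "moebius_ladder m"
    have PV: "pverts ?P = {0..<4 * m}" by (simp add: moebius_ladder_def circulant_def)
    have hm: "mate (?h k) = ?h (k + 2 * m)" for k
    proof -
      define i where "i = nat (k mod int (2 * c))"
      have "mate (?h k) = rail (i + c)" using tw' by (simp add: rail_at_def i_def)
      also have "\<dots> = rail ((i + c) mod (2 * c))" using rail_period(2)[OF per ev2(1)] by simp
      also have "int ((i + c) mod (2 * c)) = (k + 2 * m) mod int (2 * c)"
        using c0 ci by (simp add: i_def zmod_int mod_simps)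
      then have "(i + c) mod (2 * c) = nat ((k + 2 * m) mod int (2 * c))" by linarith
      finally show ?thesis by (simp add: rail_at_def)
    qed
    have hinj: "k = k'" if "?h k = ?h k'" "k \<in> {0..<4 * m}" "k' \<in> {0..<4 * m}" for k k'
    proof (rule ccontr)
      assume ne: "k \<noteq> k'"
      have "[k = k'] (mod 2 * m)"
        using rail_inj[of "nat k" "nat k'"] that ci2 by (simp add: rail_at_def)
      then obtain t where t': "k - k' = 2 * m * t" unfolding cong_iff_dvd_diff dvd_def by blast
      then have t: "k = k' + 2 * m * t" by simp
      have "t = 1 \<or> t = - 1"
      proof -
        have "k - k' < 4 * m" "- (4 * m) < k - k'" using that(2,3) by auto
        then have 1: "2 * m * t < 2 * m * 2" and 2: "2 * m * (- 2) < 2 * m * t"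
          unfolding t' by linarith+
        have pos: "0 < 2 * m" using m_ge by simp
        have "t < 2" by (rule mult_less_cancel_left_pos[OF pos, THEN iffD1, OF 1])
        moreover have "- 2 < t" by (rule mult_less_cancel_left_pos[OF pos, THEN iffD1, OF 2])
        ultimately have "t = 1 \<or> t = 0 \<or> t = - 1" by linarith
        then show ?thesis using ne t by auto
      qed
      then have "k = k' + 2 * m \<or> k' = k + 2 * m" using t by (elim disjE) simp_all
      then have "?h k = mate (?h k') \<or> ?h k' = mate (?h k)" unfolding hm by (elim disjE) simp_all
      then show False using that(1) nbrs_distinct(1)[OF rail_at_in] by metis
    qed
    have bij: "bij_betw ?h (pverts ?P) V"
    proof (rule bij_betw_imageI)
      show "inj_on ?h (pverts ?P)" using hinj by (auto simp: PV intro!: inj_onI)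
      show "?h ` pverts ?P = V"
      proof
        show "?h ` pverts ?P \<subseteq> V" using rail_at_in by blast
        show "V \<subseteq> ?h ` pverts ?P"
        proof
          fix v assume "v \<in> V"
          then obtain k where k: "k < c" "v = rail k \<or> v = mate (rail k)" using rail_class nat_lt by blast
          have "?h (int k) = rail k" "?h (int (k + c)) = mate (rail k)"
            using k(1) tw' by (simp_all add: rail_at_def nat_mod_distrib flip: of_nat_add)
          moreover have "int k \<in> pverts ?P" "int (k + c) \<in> pverts ?P" using k(1) ci by (auto simp: PV)
          ultimately show "v \<in> ?h ` pverts ?P" using k(2) by (metis imageI)
        qed
      qed
    qed
    have arc: "(k, k') \<in> parcs ?P \<longleftrightarrow> (?h k, ?h k') \<in> parcs \<Gamma>"
      if k: "k \<in> {0..<4 * m}" "k' \<in> {0..<4 * m}" for k k'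
    proof -
      have eq: "?h k' = ?h j \<longleftrightarrow> [k' = j] (mod 4 * m)" for j
      proof -
        have "?h j = ?h (j mod (4 * m))" by (rule rail_at_cong) (simp add: ci2[simplified] cong_def)
        moreover have "j mod (4 * m) \<in> {0..<4 * m}" using m_ge by simp
        moreover have "k' = j mod (4 * m) \<longleftrightarrow> [k' = j] (mod 4 * m)" using k(2) by (simp add: cong_def)
        ultimately show ?thesis using hinj[of k' "j mod (4 * m)"] k(2) by auto
      qed
      have "(?h k, ?h k') \<in> parcs \<Gamma> \<longleftrightarrow> ?h k' = mate (?h k) \<or> ?h k' \<in> {out (?h k), flip (?h k)}"
        using rail_at_in by (auto simp: arcs)
      also have "\<dots> \<longleftrightarrow> [k' = k + 2 * m] (mod 4 * m) \<or> [k' = k + 1] (mod 4 * m) \<or> [k' = k - 1] (mod 4 * m)"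
        unfolding nb hm by (auto simp: eq)
      also have "\<dots> \<longleftrightarrow> [k' - k = 2 * m] (mod 4 * m) \<or> [k' - k = 1] (mod 4 * m) \<or> [k' - k = - 1] (mod 4 * m)"
        by (auto simp: cong_iff_dvd_diff algebra_simps)
      also have "\<dots> \<longleftrightarrow> (k, k') \<in> parcs ?P"
        using k by (auto simp: moebius_ladder_def circulant_def)
      finally show ?thesis by simp
    qed
    have "graph_isomorphism ?h ?P \<Gamma>"
      using bij arc by (auto simp: graph_isomorphism_def PV)
    from graph_isomorphism_inv[OF this] show ?thesis unfolding graph_isomorphic_def by blast
  qed
qed

end

section \<open>From bialternating graphs to bialternating systems\<close>

lemma cycle_parametrization:
  assumes cyc: "is_cycle_graph C" and wf: "parcs C \<subseteq> pverts C \<times> pverts C"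
    and n: "int (card (pverts C)) = n"
  obtains c :: "int \<Rightarrow> 'a" where "3 \<le> n" "range c = pverts C"
    "\<And>j k. c j = c k \<longleftrightarrow> [j = k] (mod n)"
    "\<And>j w. (c j, w) \<in> parcs C \<longleftrightarrow> w = c (j + 1) \<or> w = c (j - 1)"
proof -
  obtain k f where k: "3 \<le> k" and f: "graph_isomorphism f C (cycle_graph k)"
    using cyc unfolding is_cycle_graph_def graph_isomorphic_def by blast
  have V: "pverts (cycle_graph k) = {0..<k}" by (simp add: cycle_graph_def circulant_def)
  have bij: "bij_betw f (pverts C) {0..<k}" using f V by (simp add: graph_isomorphism_def)
  have "card (pverts C) = card {0..<k}" by (rule bij_betw_same_card[OF bij])
  then have nk: "n = k" using n k by simp
  define c where "c j = inv_into (pverts C) f (j mod k)" for j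
  have mk: "j mod k \<in> {0..<k}" for j using k by simp
  have fc: "f (c j) = j mod k" for j unfolding c_def by (rule bij_betw_inv_into_right[OF bij mk])
  have cV: "c j \<in> pverts C" for j
    unfolding c_def by (rule bij_betw_apply[OF bij_betw_inv_into[OF bij] mk])
  have cf: "c (f v) = v" if "v \<in> pverts C" for v
  proof -
    have "f v \<in> {0..<k}" by (rule bij_betw_apply[OF bij that])
    then have "f v mod k = f v" by simp
    then show ?thesis unfolding c_def using bij_betw_inv_into_left[OF bij that] by simp
  qed
  have inj: "c i = c j \<longleftrightarrow> [i = j] (mod n)" for i j
  proof
    assume "c i = c j"
    then have "i mod k = j mod k" using fc[of i] fc[of j] by simp
    then show "[i = j] (mod n)" by (simp add: nk cong_def)
  next
    assume "[i = j] (mod n)"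
    then have "i mod k = j mod k" by (simp add: nk cong_def)
    then show "c i = c j" unfolding c_def by simp
  qed
  have surj: "range c = pverts C"
  proof
    show "range c \<subseteq> pverts C" using cV by auto
    show "pverts C \<subseteq> range c"
    proof
      fix v assume "v \<in> pverts C"
      then have "v = c (f v)" using cf by simp
      then show "v \<in> range c" by blast
    qed
  qed
  have "(c j, w) \<in> parcs C \<longleftrightarrow> w = c (j + 1) \<or> w = c (j - 1)" for j w
  proof -
    have arc: "(c j, c i) \<in> parcs C \<longleftrightarrow> c i = c (j + 1) \<or> c i = c (j - 1)" for i
    proof -
      have "(c j, c i) \<in> parcs C \<longleftrightarrow> (j mod k, i mod k) \<in> parcs (cycle_graph k)"
        using f cV fc by (simp add: graph_isomorphism_def)
      also have "\<dots> \<longleftrightarrow> [i mod k - j mod k = 1] (mod k) \<or> [i mod k - j mod k = - 1] (mod k)"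
        using mk[of i] mk[of j] by (auto simp: cycle_graph_def circulant_def)
      also have "\<dots> \<longleftrightarrow> [i - j = 1] (mod k) \<or> [i - j = - 1] (mod k)"
        by (simp add: cong_def mod_diff_eq)
      also have "\<dots> \<longleftrightarrow> c i = c (j + 1) \<or> c i = c (j - 1)"
        unfolding inj nk by (simp add: cong_iff_dvd_diff algebra_simps)
      finally show ?thesis .
    qed
    show ?thesis
    proof (cases "w \<in> pverts C")
      case True
      then obtain i where "w = c i" using surj by blast
      then show ?thesis using arc by simp
    next
      case False
      then show ?thesis using wf cV by auto
    qed
  qed
  with surj inj k nk show ?thesis by (intro that[of c]) simp_all
qed

locale bialternating_graph =
  fixes \<Gamma> :: "'a pair_pre_digraph" and \<C> :: "'a pair_pre_digraph set" and m n :: int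
  assumes graph: "pair_graph \<Gamma>" and bialt: "bialternating \<Gamma> \<C>"
    and card_C: "m = int (card \<C>)" and card_cycle: "\<And>C. C \<in> \<C> \<Longrightarrow> int (card (pverts C)) = n"
begin

abbreviation "V \<equiv> pverts \<Gamma>"

lemma cqt: "cycle_quotient_type \<Gamma> \<C>" using bialt by (simp add: bialternating_def)

lemma two_factor: "two_factor \<Gamma> \<C>"
  using cqt by (simp add: cycle_quotient_type_def factor_partition_def)

lemma m_ge: "3 \<le> m" using cqt card_C by (simp add: cycle_quotient_type_def)

lemma cycle_sub:
  assumes "C \<in> \<C>"
  shows "pverts C \<subseteq> V" "parcs C \<subseteq> parcs \<Gamma>" "parcs C \<subseteq> pverts C \<times> pverts C" "is_cycle_graph C"
proof -
  have "subgraph (with_proj C) (with_proj \<Gamma>)" using two_factor assms by (simp add: two_factor_def)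
  then have s: "pverts C \<subseteq> V" "parcs C \<subseteq> parcs \<Gamma>" "wf_digraph (with_proj C)" by (auto simp: subgraph_def)
  then show "pverts C \<subseteq> V" "parcs C \<subseteq> parcs \<Gamma>" by auto
  interpret pair_wf_digraph C using s(3) by (simp add: wf_digraph_wp_iff)
  show "parcs C \<subseteq> pverts C \<times> pverts C" using in_arcsD1 in_arcsD2 by auto
  show "is_cycle_graph C" using two_factor assms by (simp add: two_factor_def)
qed

definition "cyc v = (THE C. C \<in> \<C> \<and> v \<in> pverts C)"

lemma cyc_eq: "C \<in> \<C> \<Longrightarrow> v \<in> pverts C \<Longrightarrow> cyc v = C"
  unfolding cyc_def using two_factor by (intro the_equality) (auto simp: two_factor_def)

lemma cyc: assumes "v \<in> V" shows "cyc v \<in> \<C>" "v \<in> pverts (cyc v)"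
proof -
  have "v \<in> (\<Union>C\<in>\<C>. pverts C)" using two_factor assms unfolding two_factor_def by simp
  then obtain C where "C \<in> \<C>" "v \<in> pverts C" by blast
  then show "cyc v \<in> \<C>" "v \<in> pverts (cyc v)" using cyc_eq by auto
qed

lemma pverts_cyc: "C \<in> \<C> \<Longrightarrow> v \<in> pverts C \<longleftrightarrow> v \<in> V \<and> cyc v = C"
  using cyc_eq cyc cycle_sub(1) by blast

definition "matching = (SOME F. one_factor \<Gamma> F \<and> (\<Union>C\<in>\<C>. parcs C) \<union> F = parcs \<Gamma> \<and> (\<Union>C\<in>\<C>. parcs C) \<inter> F = {})"

lemma matching: "one_factor \<Gamma> matching" "(\<Union>C\<in>\<C>. parcs C) \<union> matching = parcs \<Gamma>"
  "(\<Union>C\<in>\<C>. parcs C) \<inter> matching = {}"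
proof -
  have "\<exists>F. one_factor \<Gamma> F \<and> (\<Union>C\<in>\<C>. parcs C) \<union> F = parcs \<Gamma> \<and> (\<Union>C\<in>\<C>. parcs C) \<inter> F = {}"
    using cqt by (simp add: cycle_quotient_type_def factor_partition_def)
  from someI_ex[OF this] show "one_factor \<Gamma> matching" "(\<Union>C\<in>\<C>. parcs C) \<union> matching = parcs \<Gamma>"
    "(\<Union>C\<in>\<C>. parcs C) \<inter> matching = {}" unfolding matching_def by blast+
qed

lemma arcs_in: "(v, w) \<in> parcs \<Gamma> \<Longrightarrow> v \<in> V \<and> w \<in> V"
proof -
  interpret pair_graph \<Gamma> by (rule graph)
  show "(v, w) \<in> parcs \<Gamma> \<Longrightarrow> v \<in> V \<and> w \<in> V" using in_arcsD1 in_arcsD2 by blast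
qed

definition "out v = (THE w. (v, w) \<in> matching)"

lemma matching_arc: "(v, w) \<in> matching \<Longrightarrow> (v, w) \<in> parcs \<Gamma>"
  and matching_sym: "(v, w) \<in> matching \<Longrightarrow> (w, v) \<in> matching"
  and matching_ex1: "v \<in> V \<Longrightarrow> \<exists>!w. (v, w) \<in> matching"
  using matching(1) by (auto simp: one_factor_def dest: symD)

lemma out_matching: "v \<in> V \<Longrightarrow> (v, out v) \<in> matching"
  unfolding out_def by (rule theI'[OF matching_ex1])

lemma out_unique:
  assumes "(v, w) \<in> matching"
  shows "w = out v"
  using matching_ex1[of v] out_matching[of v] arcs_in[OF matching_arc[OF assms]] assms by auto

lemma out_in: "v \<in> V \<Longrightarrow> out v \<in> V"
  using arcs_in[OF matching_arc[OF out_matching]] by simp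

lemma out_out: "v \<in> V \<Longrightarrow> out (out v) = v"
  using out_unique[OF matching_sym[OF out_matching]] by simp

lemma arc_iff: "(v, w) \<in> parcs \<Gamma> \<longleftrightarrow> v \<in> V \<and> ((v, w) \<in> parcs (cyc v) \<or> w = out v)"
proof
  assume a: "(v, w) \<in> parcs \<Gamma>"
  note v = arcs_in[OF a]
  have "(v, w) \<in> (\<Union>C\<in>\<C>. parcs C) \<union> matching" using a matching(2) by simp
  then consider C where "C \<in> \<C>" "(v, w) \<in> parcs C" | "(v, w) \<in> matching" by blast
  then show "v \<in> V \<and> ((v, w) \<in> parcs (cyc v) \<or> w = out v)"
  proof cases
    case 1
    then have "cyc v = C" using cycle_sub(3)[OF 1(1)] by (intro cyc_eq) auto
    then show ?thesis using 1 v by simp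
  next
    case 2
    then show ?thesis using out_unique v by simp
  qed
next
  assume "v \<in> V \<and> ((v, w) \<in> parcs (cyc v) \<or> w = out v)"
  then show "(v, w) \<in> parcs \<Gamma>"
    using subsetD[OF cycle_sub(2)[OF cyc(1)[of v]]] matching_arc[OF out_matching[of v]] by auto
qed

lemma outside_nbrD:
  assumes "outside_nbr \<Gamma> \<C> v w"
  shows "w = out v" "cyc w \<noteq> cyc v" "v \<in> V"
proof -
  obtain C C' where a: "(v, w) \<in> parcs \<Gamma>" and C: "C \<in> \<C>" "C' \<in> \<C>" "C \<noteq> C'" "v \<in> pverts C" "w \<in> pverts C'"
    using assms unfolding outside_nbr_def by blast
  have c: "cyc v = C" "cyc w = C'" using C cyc_eq by auto
  then show "cyc w \<noteq> cyc v" using C(3) by simp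
  show "v \<in> V" using arcs_in[OF a] by simp
  have "(v, w) \<notin> parcs (cyc v)"
  proof
    assume "(v, w) \<in> parcs (cyc v)"
    then have "w \<in> pverts C" using cycle_sub(3)[OF C(1)] c(1) by blast
    then show False using cyc_eq[OF C(1)] c(2) C(3) by simp
  qed
  then show "w = out v" using a arc_iff by blast
qed

lemma mate_spec:
  assumes "v \<in> V"
  shows "\<exists>!w. (v, w) \<in> parcs (cyc v) \<and> (\<exists>v' w'. outside_nbr \<Gamma> \<C> v v' \<and> outside_nbr \<Gamma> \<C> w w' \<and>
             (\<exists>D\<in>\<C>. v' \<in> pverts D \<and> w' \<in> pverts D))"
  using bialt cyc[OF assms] unfolding bialternating_def by blast

lemma outside: assumes "v \<in> V" shows "outside_nbr \<Gamma> \<C> v (out v)" "cyc (out v) \<noteq> cyc v"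
proof -
  obtain v' where "outside_nbr \<Gamma> \<C> v v'" using mate_spec[OF assms] by blast
  then show "outside_nbr \<Gamma> \<C> v (out v)" "cyc (out v) \<noteq> cyc v" using outside_nbrD by auto
qed

lemma nbr_cyc:
  assumes "v \<in> V" "(v, w) \<in> parcs (cyc v)"
  shows "w \<in> V" "cyc w = cyc v"
proof -
  note C = cyc(1)[OF assms(1)]
  have w: "w \<in> pverts (cyc v)" using subsetD[OF cycle_sub(3)[OF C] assms(2)] by simp
  show "w \<in> V" using subsetD[OF cycle_sub(1)[OF C] w] .
  show "cyc w = cyc v" by (rule cyc_eq[OF C w])
qed

text \<open>
  The bialternation condition in terms of \<open>cyc\<close> and \<open>out\<close>.
\<close>
lemma mate_ex1: 
  assumes v: "v \<in> V"
  shows "\<exists>!w. (v, w) \<in> parcs (cyc v) \<and> cyc (out w) = cyc (out v)"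
proof -
  have "(\<exists>v' w'. outside_nbr \<Gamma> \<C> v v' \<and> outside_nbr \<Gamma> \<C> w w' \<and> (\<exists>D\<in>\<C>. v' \<in> pverts D \<and> w' \<in> pverts D))
      \<longleftrightarrow> cyc (out w) = cyc (out v)" if w: "(v, w) \<in> parcs (cyc v)" for w
  proof
    assume "\<exists>v' w'. outside_nbr \<Gamma> \<C> v v' \<and> outside_nbr \<Gamma> \<C> w w' \<and> (\<exists>D\<in>\<C>. v' \<in> pverts D \<and> w' \<in> pverts D)"
    then show "cyc (out w) = cyc (out v)" using outside_nbrD(1) cyc_eq by metis
  next
    assume "cyc (out w) = cyc (out v)"
    then show "\<exists>v' w'. outside_nbr \<Gamma> \<C> v v' \<and> outside_nbr \<Gamma> \<C> w w' \<and> (\<exists>D\<in>\<C>. v' \<in> pverts D \<and> w' \<in> pverts D)"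
      using outside(1)[OF v] outside(1)[OF nbr_cyc(1)[OF v w]] cyc[OF out_in[OF v]]
        cyc(2)[OF out_in[OF nbr_cyc(1)[OF v w]]] by metis
  qed
  then show ?thesis using mate_spec[OF v] by (simp cong: conj_cong)
qed

definition "mate v = (THE w. (v, w) \<in> parcs (cyc v) \<and> cyc (out w) = cyc (out v))"

lemma mate:
  assumes "v \<in> V"
  shows "(v, mate v) \<in> parcs (cyc v)" "cyc (out (mate v)) = cyc (out v)"
  using theI'[OF mate_ex1[OF assms]] unfolding mate_def[symmetric] by simp_all

lemma mate_unique:
  assumes "v \<in> V" "(v, w) \<in> parcs (cyc v)" "cyc (out w) = cyc (out v)"
  shows "w = mate v"
  unfolding mate_def using assms(2,3) by (intro the1_equality[OF mate_ex1[OF assms(1)], symmetric]) simp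

lemma n_ge: "3 \<le> n"
proof -
  have "\<C> \<noteq> {}" using m_ge card_C by auto
  then obtain C where C: "C \<in> \<C>" by blast
  show ?thesis by (rule cycle_parametrization[OF cycle_sub(4,3)[OF C] card_cycle[OF C]])
qed

lemma parametrization:
  assumes v: "v \<in> V"
  obtains c :: "int \<Rightarrow> 'a" where "range c = pverts (cyc v)" "\<And>j k. c j = c k \<longleftrightarrow> [j = k] (mod n)"
    "\<And>j w. (c j, w) \<in> parcs (cyc v) \<longleftrightarrow> w = c (j + 1) \<or> w = c (j - 1)"
    "c 0 = v" "c 1 = mate v"
proof -
  note C = cyc[OF v]
  obtain c :: "int \<Rightarrow> 'a" where c: "range c = pverts (cyc v)" "\<And>j k. c j = c k \<longleftrightarrow> [j = k] (mod n)"
    "\<And>j w. (c j, w) \<in> parcs (cyc v) \<longleftrightarrow> w = c (j + 1) \<or> w = c (j - 1)"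
    by (rule cycle_parametrization[OF cycle_sub(4,3)[OF C(1)] card_cycle[OF C(1)]]) (rule that; assumption)
  obtain i where i: "v = c i" using c(1) C(2) by blast
  have "mate v = c (i + 1) \<or> mate v = c (i - 1)" using mate(1)[OF v] c(3) i by simp
  then obtain s where s: "s = 1 \<or> s = - 1" "mate v = c (i + s)" by (metis diff_conv_add_uminus)
  define d where "d j = c (i + s * j)" for j
  have "range d = pverts (cyc v)"
  proof -
    have "c j = d (s * (j - i))" for j using s(1) by (auto simp: d_def)
    then have "range c \<subseteq> range d" by (metis image_subsetI rangeI)
    moreover have "range d \<subseteq> range c" unfolding d_def by blast
    ultimately show ?thesis using c(1) by simp
  qed
  moreover have "d j = d k \<longleftrightarrow> [j = k] (mod n)" for j k
    using s(1) dvd_diff_commute[of n j k] by (auto simp: d_def c(2) cong_iff_dvd_diff)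
  moreover have "(d j, w) \<in> parcs (cyc v) \<longleftrightarrow> w = d (j + 1) \<or> w = d (j - 1)" for j w
    using s(1) by (auto simp: d_def c(3) algebra_simps)
  moreover have "d 0 = v" "d 1 = mate v" using i s by (simp_all add: d_def)
  ultimately show ?thesis by (rule that)
qed

lemma arc_sym: "v \<in> V \<Longrightarrow> (v, w) \<in> parcs (cyc v) \<Longrightarrow> (w, v) \<in> parcs (cyc w)"
proof -
  assume v: "v \<in> V" and w: "(v, w) \<in> parcs (cyc v)"
  obtain c where "range c = pverts (cyc v)" "\<And>j k. c j = c k \<longleftrightarrow> [j = k] (mod n)"
    and c: "\<And>j w. (c j, w) \<in> parcs (cyc v) \<longleftrightarrow> w = c (j + 1) \<or> w = c (j - 1)" "c 0 = v" "c 1 = mate v"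
    by (rule parametrization[OF v]) (rule that; assumption)
  have "w = c 1 \<or> w = c (- 1)" using c(1)[of 0 w] c(2) w by simp
  then have "(w, v) \<in> parcs (cyc v)" using c(1)[of 1 v] c(1)[of "- 1" v] c(2) by auto
  then show ?thesis using nbr_cyc(2)[OF v w] by simp
qed

lemma mate_in: "v \<in> V \<Longrightarrow> mate v \<in> V" and cyc_mate: "v \<in> V \<Longrightarrow> cyc (mate v) = cyc v"
  using nbr_cyc[OF _ mate(1), of v] by simp_all

lemma mate_mate: "v \<in> V \<Longrightarrow> mate (mate v) = v"
  by (rule mate_unique[OF mate_in arc_sym[OF _ mate(1)] mate(2)[symmetric], symmetric])

definition "flip v = (THE w. (v, w) \<in> parcs (cyc v) \<and> w \<noteq> mate v)"

lemma flip_ex1: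
  assumes v: "v \<in> V"
  shows "\<exists>!w. (v, w) \<in> parcs (cyc v) \<and> w \<noteq> mate v"
proof -
  obtain c where "range c = pverts (cyc v)" and c: "\<And>j k. c j = c k \<longleftrightarrow> [j = k] (mod n)"
    "\<And>j w. (c j, w) \<in> parcs (cyc v) \<longleftrightarrow> w = c (j + 1) \<or> w = c (j - 1)" "c 0 = v" "c 1 = mate v"
    by (rule parametrization[OF v]) (rule that; assumption)
  have "c (- 1) \<noteq> c 1"
    using n_ge zdvd_imp_le[of n 2] by (auto simp: c(1) cong_iff_dvd_diff)
  then show ?thesis using c(2)[of 0] c(3,4) by auto
qed

lemma flip:
  assumes "v \<in> V"
  shows "(v, flip v) \<in> parcs (cyc v)" "flip v \<noteq> mate v"
  using theI'[OF flip_ex1[OF assms]] unfolding flip_def[symmetric] by simp_all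

lemma flip_unique:
  assumes "v \<in> V" "(v, w) \<in> parcs (cyc v)" "w \<noteq> mate v"
  shows "w = flip v"
  unfolding flip_def using assms(2,3) by (intro the1_equality[OF flip_ex1[OF assms(1)], symmetric]) simp

lemma flip_in: "v \<in> V \<Longrightarrow> flip v \<in> V" and cyc_flip: "v \<in> V \<Longrightarrow> cyc (flip v) = cyc v"
  using nbr_cyc[OF _ flip(1), of v] by simp_all

lemma flip_flip:
  assumes v: "v \<in> V"
  shows "flip (flip v) = v"
proof -
  have "v \<noteq> mate (flip v)" using mate_mate[OF flip_in[OF v]] flip(2)[OF v] by metis
  then show ?thesis using flip_unique[OF flip_in[OF v] arc_sym[OF v flip(1)[OF v]]] by simp
qed

lemma cyc_out_flip:
  assumes "v \<in> V"
  shows "cyc (out (flip v)) \<noteq> cyc (out v)"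
  using mate_unique[OF assms flip(1)[OF assms]] flip(2)[OF assms] by blast

lemma cycle_arcs:
  assumes "v \<in> V"
  shows "(v, w) \<in> parcs (cyc v) \<longleftrightarrow> w = mate v \<or> w = flip v"
  using flip_unique[OF assms, of w] mate(1)[OF assms] flip(1)[OF assms] by blast

text \<open>
  Orient the cycle in such a way that \<open>mate\<close> leads from position 0 to position 1. As \<open>mate\<close> is an
  involution, it pairs every even position with its successor, and \<open>flip\<close> pairs the others.
\<close>
lemma walk_ex:
  assumes v: "v \<in> V"
  shows "\<exists>c. c 0 = v \<and> (\<forall>j. mate (c j) = c (j \<star> 1) \<and> flip (c j) = c (j \<star> - 1)) \<and>
    (\<forall>j k. c j = c k \<longleftrightarrow> [j = k] (mod n)) \<and> range c = {w \<in> V. cyc w = cyc v}"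
proof -
  obtain c where c: "range c = pverts (cyc v)" "\<And>j k. c j = c k \<longleftrightarrow> [j = k] (mod n)"
    "\<And>j w. (c j, w) \<in> parcs (cyc v) \<longleftrightarrow> w = c (j + 1) \<or> w = c (j - 1)" "c 0 = v" "c 1 = mate v"
    by (rule parametrization[OF v]) (rule that; assumption)
  have cV: "c j \<in> V" "cyc (c j) = cyc v" for j
    using c(1) pverts_cyc[OF cyc(1)[OF v]] by blast+
  have nb: "{mate (c j), flip (c j)} = {c (j + 1), c (j - 1)}" for j
  proof -
    have "w \<in> {mate (c j), flip (c j)} \<longleftrightarrow> w \<in> {c (j + 1), c (j - 1)}" for w
      using cycle_arcs[OF cV(1)[of j], of w] cV(2)[of j] c(3)[of j w] by simp
    then show ?thesis by blast
  qed
  have ne: "c (j + 1) \<noteq> c (j - 1)" for j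
    using n_ge zdvd_imp_le[of n 2] by (auto simp: c(2) cong_iff_dvd_diff)
  have other: "mate (c j) = c (j + 1) \<Longrightarrow> flip (c j) = c (j - 1)"
    "mate (c j) = c (j - 1) \<Longrightarrow> flip (c j) = c (j + 1)"
    "flip (c j) = c (j + 1) \<Longrightarrow> mate (c j) = c (j - 1)"
    "flip (c j) = c (j - 1) \<Longrightarrow> mate (c j) = c (j + 1)" for j
    using nb[of j] ne[of j] by (auto simp: doubleton_eq_iff)
  have main: "(even j \<longrightarrow> mate (c j) = c (j + 1)) \<and> (odd j \<longrightarrow> mate (c j) = c (j - 1))" for j
  proof (induction j rule: int_induct[of _ 0])
    case base
    then show ?case using c(4,5) by simp
  next
    case (step1 i)
    show ?case
    proof (cases "even i")
      case True
      then show ?thesis using step1 mate_mate[OF cV(1)[of i]] by simp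
    next
      case False
      then have "flip (c (i + 1)) = c i" using step1 other(2)[of i] flip_flip[OF cV(1)[of i]] by simp
      then show ?thesis using other(4)[of "i + 1"] False by simp
    qed
  next
    case (step2 i)
    show ?case
    proof (cases "even i")
      case True
      then have "flip (c (i - 1)) = c i" using step2 other(1)[of i] flip_flip[OF cV(1)[of i]] by simp
      then show ?thesis using other(3)[of "i - 1"] True by simp
    next
      case False
      then show ?thesis using step2 mate_mate[OF cV(1)[of i]] by simp
    qed
  qed
  have "mate (c j) = c (j \<star> 1) \<and> flip (c j) = c (j \<star> - 1)" for j
  proof (cases "even j")
    case True
    then have "mate (c j) = c (j + 1)" using main by blast
    moreover have "flip (c j) = c (j - 1)" by (rule other(1)[OF \<open>mate (c j) = c (j + 1)\<close>])
    ultimately show ?thesis using True by (simp add: dih_mult_def parity_sign_def)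
  next
    case False
    then have "mate (c j) = c (j - 1)" using main by blast
    moreover have "flip (c j) = c (j + 1)" by (rule other(2)[OF \<open>mate (c j) = c (j - 1)\<close>])
    ultimately show ?thesis using False by (simp add: dih_mult_def parity_sign_def)
  qed
  moreover have "range c = {w \<in> V. cyc w = cyc v}"
    using c(1) pverts_cyc[OF cyc(1)[OF v]] by auto
  ultimately show ?thesis using c(2,4) by blast
qed

definition "walk v = (SOME c. c 0 = v \<and> (\<forall>j. mate (c j) = c (j \<star> 1) \<and> flip (c j) = c (j \<star> - 1)) \<and>
    (\<forall>j k. c j = c k \<longleftrightarrow> [j = k] (mod n)) \<and> range c = {w \<in> V. cyc w = cyc v})"

lemma walk:
  assumes "v \<in> V"
  shows "walk v 0 = v" "mate (walk v j) = walk v (j \<star> 1)" "flip (walk v j) = walk v (j \<star> - 1)"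
    "walk v j = walk v k \<longleftrightarrow> [j = k] (mod n)" "range (walk v) = {w \<in> V. cyc w = cyc v}"
  using someI_ex[OF walk_ex[OF assms]] unfolding walk_def[symmetric] by blast+

definition "position = (SOME f. graph_isomorphism f (quotient_graph \<Gamma> \<C>) (cycle_graph m))"

lemma position: "graph_isomorphism position (quotient_graph \<Gamma> \<C>) (cycle_graph m)"
proof -
  obtain k f where k: "3 \<le> k" "graph_isomorphism f (quotient_graph \<Gamma> \<C>) (cycle_graph k)"
    using cqt unfolding cycle_quotient_type_def is_cycle_graph_def graph_isomorphic_def by blast
  then have "bij_betw f \<C> {0..<k}"
    by (simp add: graph_isomorphism_def quotient_graph_def cycle_graph_def circulant_def)
  then have "card \<C> = card {0..<k}" by (rule bij_betw_same_card)
  then have "k = m" using card_C k(1) by simp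
  then have "\<exists>f. graph_isomorphism f (quotient_graph \<Gamma> \<C>) (cycle_graph m)" using k(2) by blast
  then show ?thesis unfolding position_def by (rule someI_ex)
qed

lemma position_bij: "bij_betw position \<C> {0..<m}"
  using position by (simp add: graph_isomorphism_def quotient_graph_def cycle_graph_def circulant_def)

definition "layer v = position (cyc v)"

lemma layer_eq_iff: "v \<in> V \<Longrightarrow> w \<in> V \<Longrightarrow> layer v = layer w \<longleftrightarrow> cyc v = cyc w"
  using position_bij cyc(1) unfolding layer_def bij_betw_def by (metis inj_onD)

lemma layer_range: "v \<in> V \<Longrightarrow> 0 \<le> layer v \<and> layer v < m"
  using position_bij cyc(1) unfolding layer_def bij_betw_def by force

lemma layer_out_cases:
  assumes v: "v \<in> V"
  shows "[layer (out v) - layer v = 1] (mod m) \<or> [layer (out v) - layer v = - 1] (mod m)"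
proof -
  have "(v, out v) \<in> parcs \<Gamma>" using v arc_iff by blast
  then have "(cyc v, cyc (out v)) \<in> parcs (quotient_graph \<Gamma> \<C>)"
    using cyc[OF v] cyc[OF out_in[OF v]] outside(2)[OF v] unfolding quotient_graph_def by auto
  moreover have "cyc v \<in> pverts (quotient_graph \<Gamma> \<C>)" "cyc (out v) \<in> pverts (quotient_graph \<Gamma> \<C>)"
    using cyc(1) v out_in by (auto simp: quotient_graph_def)
  ultimately have "(layer v, layer (out v)) \<in> parcs (cycle_graph m)"
    using position unfolding graph_isomorphism_def layer_def by blast
  then show ?thesis by (auto simp: cycle_graph_def circulant_def)
qed

definition "sig v = (if [layer (out v) - layer v = 1] (mod m) then 1 else (- 1 :: int))"

text \<open>
  The two directions are different because there are at least three cycles.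
\<close>
lemma one_minus_one: "\<not> ([x = 1] (mod m) \<and> [x = - 1] (mod m))"
proof
  assume "[x = 1] (mod m) \<and> [x = - 1] (mod m)"
  then have "m dvd x - 1" "m dvd x + 1" by (simp_all add: cong_iff_dvd_diff)
  then have "m dvd (x + 1) - (x - 1)" using dvd_diff by blast
  moreover have "(x + 1) - (x - 1) = 2" by simp
  ultimately have "m dvd 2" by (simp only:)
  then show False using m_ge zdvd_imp_le[of m 2] by simp
qed

lemma sig_spec: "v \<in> V \<Longrightarrow> [layer (out v) - layer v = sig v] (mod m)"
  using layer_out_cases[of v] by (auto simp: sig_def)

lemma sig_eqI: "v \<in> V \<Longrightarrow> s = 1 \<or> s = - 1 \<Longrightarrow> [layer (out v) - layer v = s] (mod m) \<Longrightarrow> sig v = s"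
  using one_minus_one[of "layer (out v) - layer v"] by (auto simp: sig_def)

lemma layer_out: "v \<in> V \<Longrightarrow> layer (out v) = (layer v + sig v) mod m"
proof -
  assume v: "v \<in> V"
  have "[layer v + (layer (out v) - layer v) = layer v + sig v] (mod m)"
    by (intro cong_add cong_refl sig_spec v)
  then show ?thesis using layer_range[OF out_in[OF v]] by (simp add: cong_def)
qed

lemma layer_mate: "v \<in> V \<Longrightarrow> layer (mate v) = layer v" and layer_flip: "v \<in> V \<Longrightarrow> layer (flip v) = layer v"
  by (simp_all add: layer_def cyc_mate cyc_flip)

lemma sig_mate:
  assumes v: "v \<in> V"
  shows "sig (mate v) = sig v"
proof -
  have "layer (out (mate v)) = layer (out v)" using mate(2)[OF v] by (simp add: layer_def)
  then show ?thesis using layer_mate[OF v] by (simp add: sig_def)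
qed

lemma sig_cases: "sig v = 1 \<or> sig v = - 1" by (simp add: sig_def)

lemma sig_flip:
  assumes v: "v \<in> V"
  shows "sig (flip v) = - sig v"
proof -
  have "layer (out (flip v)) \<noteq> layer (out v)"
    using cyc_out_flip[OF v] layer_eq_iff[OF out_in[OF flip_in[OF v]] out_in[OF v]] by simp
  then have "sig (flip v) \<noteq> sig v"
    using layer_out[OF v] layer_out[OF flip_in[OF v]] layer_flip[OF v] by auto
  then show ?thesis using sig_cases[of v] sig_cases[of "flip v"] by auto
qed

lemma sig_out:
  assumes v: "v \<in> V"
  shows "sig (out v) = - sig v"
proof (rule sig_eqI[OF out_in[OF v]])
  show "- sig v = 1 \<or> - sig v = - 1" using sig_cases[of v] by auto
  have "m dvd - (layer (out v) - layer v - sig v)"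
    using sig_spec[OF v] unfolding cong_iff_dvd_diff by (rule dvd_minus_iff[THEN iffD2])
  then show "[layer (out (out v)) - layer (out v) = - sig v] (mod m)"
    by (simp add: out_out[OF v] cong_iff_dvd_diff algebra_simps)
qed

lemma bialternating_system: "bialternating_system \<Gamma> \<C> mate flip out layer sig walk m n"
proof
  interpret pair_graph \<Gamma> by (rule graph)
  show "finite V" by (rule pair_finite_verts)
  show "V \<noteq> {}"
  proof -
    have "\<C> \<noteq> {}" using m_ge card_C by auto
    then obtain C where C: "C \<in> \<C>" by blast
    then have "pverts C \<noteq> {}" using card_cycle n_ge by fastforce
    then show ?thesis using cycle_sub(1)[OF C] by blast
  qed
  show "3 \<le> m" by (rule m_ge)
  show "3 \<le> n" by (rule n_ge)
  show "parcs \<Gamma> = {(v, w). v \<in> V \<and> w \<in> {mate v, flip v, out v}}"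
    using arc_iff cycle_arcs by auto
  show "\<C> = (\<lambda>i. \<lparr> pverts = {v \<in> V. layer v = i},
        parcs = {(v, w). v \<in> V \<and> layer v = i \<and> w \<in> {mate v, flip v}} \<rparr>) ` {0..<m}" (is "_ = ?f ` _")
  proof -
    have eq: "C = ?f (position C)" if C: "C \<in> \<C>" for C
    proof -
      have l: "layer v = position C \<longleftrightarrow> cyc v = C" if "v \<in> V" for v
        using position_bij cyc(1)[OF that] C unfolding layer_def bij_betw_def by (metis inj_onD)
      have "pverts C = {v \<in> V. layer v = position C}" using pverts_cyc[OF C] l by blast
      moreover have "parcs C = {(v, w). v \<in> V \<and> layer v = position C \<and> w \<in> {mate v, flip v}}"
      proof -
        have "(v, w) \<in> parcs C \<longleftrightarrow> v \<in> V \<and> cyc v = C \<and> (w = mate v \<or> w = flip v)" for v w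
        proof
          assume a: "(v, w) \<in> parcs C"
          then have "v \<in> pverts C" using subsetD[OF cycle_sub(3)[OF C]] by blast
          then have "v \<in> V \<and> cyc v = C" using pverts_cyc[OF C] by simp
          then show "v \<in> V \<and> cyc v = C \<and> (w = mate v \<or> w = flip v)" using a cycle_arcs[of v w] by simp
        next
          assume "v \<in> V \<and> cyc v = C \<and> (w = mate v \<or> w = flip v)"
          then show "(v, w) \<in> parcs C" using cycle_arcs[of v w] by auto
        qed
        then show ?thesis using l by auto
      qed
      ultimately show ?thesis by simp
    qed
    have im: "position ` \<C> = {0..<m}" using position_bij by (simp add: bij_betw_def)
    have "(\<lambda>C. ?f (position C)) ` \<C> = (\<lambda>C. C) ` \<C>"
      by (rule image_cong[OF refl]) (rule eq[symmetric])
    then show ?thesis unfolding im[symmetric] image_image by simp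
  qed
  show "range (walk v) = {w \<in> V. layer w = layer v}" if "v \<in> V" for v
    using walk(5)[OF that] layer_eq_iff that by auto
qed (simp_all add: mate_in flip_in out_in mate_mate flip_flip out_out layer_range layer_mate layer_flip
    layer_out sig_cases sig_mate sig_flip sig_out walk)

end

section \<open>Groups that permute the cycles\<close>

lemma (in bialternating_system) layer_out_flip:
  assumes v: "v \<in> V"
  shows "layer (out (flip v)) \<noteq> layer (out v)"
proof
  assume "layer (out (flip v)) = layer (out v)"
  then have "(layer v + - sig v) mod m = (layer v + sig v) mod m"
    using v by (simp add: layer_out flip_in layer_flip sig_flip)
  then have "m dvd (layer v + - sig v) - (layer v + sig v)" by (simp only: mod_eq_dvd_iff)
  then have "m dvd 2" using sig_cases[OF v] by auto
  then show False using m_ge zdvd_imp_le[of m 2] by simp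
qed

text \<open>
  An element that permutes the cycles maps the two cycle neighbours of \<open>v\<close> to those of its image
  and hence commutes with \<open>out\<close>. It cannot exchange the roles of \<open>mate\<close> and \<open>flip\<close>, because the
  outside neighbours of \<open>v\<close> and \<open>mate v\<close> lie on the same cycle, but those of \<open>v\<close> and \<open>flip v\<close> do
  not.
\<close>
lemma (in bialternating_system) homogeneous_of_group:
  assumes sub: "subgroup G (aut_group \<Gamma>)" and tr: "transitive_on_vertices \<Gamma> G" and pres: "preserves G \<C>"
  shows "homogeneous_system \<Gamma> \<C> mate flip out layer sig walk m n G"
proof -
  let ?C = "\<lambda>i. \<lparr> pverts = {v \<in> V. layer v = i},
        parcs = {(v, w). v \<in> V \<and> layer v = i \<and> w \<in> {mate v, flip v}} \<rparr>"
  have aut: "graph_isomorphism g \<Gamma> \<Gamma>" if "g \<in> G" for g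
    using subgroup.mem_carrier[OF sub that] by (simp add: carrier_aut_group)
  have bij: "bij_betw g V V" if "g \<in> G" for g using aut[OF that] by (simp add: graph_isomorphism_def)
  have gin: "g v \<in> V" if "g \<in> G" "v \<in> V" for g v using bij_betw_apply[OF bij] that by blast
  have ginj: "v = w" if "g \<in> G" "v \<in> V" "w \<in> V" "g v = g w" for g v w
    using bij[OF that(1)] that(2-4) by (auto simp: bij_betw_def dest: inj_onD)
  have img: "\<exists>j. graph_image g (?C i) = ?C j" if "g \<in> G" "i \<in> {0..<m}" for g i
  proof -
    have "?C i \<in> \<C>" unfolding factor using that(2) by (rule imageI)
    then have "graph_image g (?C i) \<in> \<C>"
      by (rule bij_betw_apply[OF bspec[OF pres[unfolded preserves_def] that(1)]])
    then show ?thesis by (simp only: factor) (erule imageE, erule exI)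
  qed
  have cyc: "g w \<in> {mate (g v), flip (g v)}" if g: "g \<in> G" and v: "v \<in> V" and w: "w \<in> {mate v, flip v}" for g v w
  proof -
    obtain j where j: "graph_image g (?C (layer v)) = ?C j" using img[OF g, of "layer v"] layer_range[OF v] by auto
    have "(v, w) \<in> parcs (?C (layer v))" using v w by simp
    then have "(g v, g w) \<in> parcs (graph_image g (?C (layer v)))" by (force simp: graph_image_def)
    then show ?thesis unfolding j by simp
  qed
  have lay: "layer (g v) = layer (g w)" if g: "g \<in> G" and v: "v \<in> V" "w \<in> V" "layer v = layer w" for g v w
  proof -
    obtain j where j: "graph_image g (?C (layer v)) = ?C j" using img[OF g, of "layer v"] layer_range[OF v(1)] by auto
    have "v \<in> pverts (?C (layer v))" "w \<in> pverts (?C (layer v))" using v by simp_all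
    then have "g v \<in> pverts (?C j)" "g w \<in> pverts (?C j)" unfolding j[symmetric] by (simp_all add: graph_image_def)
    then show ?thesis by simp
  qed
  have mf: "{g (mate v), g (flip v)} = {mate (g v), flip (g v)}" if g: "g \<in> G" and v: "v \<in> V" for g v
    using cyc[OF g v, of "mate v"] cyc[OF g v, of "flip v"] ginj[OF g mate_in[OF v] flip_in[OF v]]
      nbrs_distinct(3)[OF v] by auto
  have go: "g (out v) = out (g v)" if g: "g \<in> G" and v: "v \<in> V" for g v
  proof -
    have "(v, out v) \<in> parcs \<Gamma>" by (rule arc_nbrs(3)[OF v])
    then have "(g v, g (out v)) \<in> parcs \<Gamma>" using aut[OF g] v out_in[OF v] by (simp add: graph_isomorphism_def)
    then have "g (out v) \<in> {mate (g v), flip (g v), out (g v)}" by (simp add: arcs)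
    moreover have "g (out v) \<notin> {g (mate v), g (flip v)}"
      using ginj[OF g out_in[OF v] mate_in[OF v]] ginj[OF g out_in[OF v] flip_in[OF v]]
        nbrs_distinct(5,6)[OF v] by auto
    ultimately show ?thesis unfolding mf[OF g v] by blast
  qed
  have gm: "g (mate v) = mate (g v)" if g: "g \<in> G" and v: "v \<in> V" for g v
  proof (rule ccontr)
    assume "g (mate v) \<noteq> mate (g v)"
    then have f: "g (mate v) = flip (g v)" using cyc[OF g v, of "mate v"] by auto
    have "layer (out (mate v)) = layer (out v)" using v by (simp add: layer_out mate_in layer_mate sig_mate)
    then have "layer (g (out (mate v))) = layer (g (out v))"
      by (intro lay[OF g] out_in mate_in v)
    then have "layer (out (flip (g v))) = layer (out (g v))" using go[OF g] v by (simp add: mate_in f)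
    then show False using layer_out_flip[OF gin[OF g v]] by simp
  qed
  have gf: "g (flip v) = flip (g v)" if g: "g \<in> G" and v: "v \<in> V" for g v
    using mf[OF g v] gm[OF g v] nbrs_distinct(3)[OF gin[OF g v]] by (auto simp: doubleton_eq_iff)
  have "homogeneous_system_axioms \<Gamma> mate flip out G"
    unfolding homogeneous_system_axioms_def using gin gm gf go transitive_on_verticesD[OF tr] by simp
  then show ?thesis by (rule homogeneous_system.intro[OF bialternating_system_axioms])
qed

locale homogeneous_group = homogeneous_system +
  assumes sub: "subgroup G (aut_group \<Gamma>)" and tr: "transitive_on_vertices \<Gamma> G"
begin

lemma G_Bij: "g \<in> G \<Longrightarrow> g \<in> Bij V"
  using subgroup.mem_carrier[OF sub] by (simp add: carrier_aut_group)

text \<open>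
  The fixed points of \<open>g\<close> are closed under the three involutions, and \<open>\<Gamma>\<close> is connected.
\<close>
lemma fixes_all:
  assumes g: "g \<in> G" "v \<in> V" "g v = v"
  shows "g = \<one>\<^bsub>aut_group \<Gamma>\<^esub>"
proof -
  have "V \<subseteq> {w. g w = w}"
    by (rule layer_closed_induct[OF g(2)]) (use g in \<open>simp_all add: G_mate G_flip G_out\<close>)
  then have "g w = w" if "w \<in> V" for w using that by blast
  then show ?thesis
    using Bij_imp_extensional[OF G_Bij[OF g(1)]] unfolding one_aut_group
    by (intro extensionalityI[of g V]) auto
qed

lemma regular: "regular_on_vertices \<Gamma> G"
proof -
  have "stabilizer (aut_group \<Gamma>\<lparr>carrier := G\<rparr>) (\<lambda>g. g) v = {\<one>\<^bsub>aut_group \<Gamma>\<^esub>}" if v: "v \<in> V" for v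
  proof -
    have "\<one>\<^bsub>aut_group \<Gamma>\<^esub> \<in> G" by (rule subgroup.one_closed[OF sub])
    moreover have "\<one>\<^bsub>aut_group \<Gamma>\<^esub> v = v" using v by (simp add: one_aut_group)
    moreover have "g = \<one>\<^bsub>aut_group \<Gamma>\<^esub>" if "g \<in> G" "g v = v" for g by (rule fixes_all[OF that(1) v that(2)])
    ultimately have "{g \<in> G. g v = v} = {\<one>\<^bsub>aut_group \<Gamma>\<^esub>}" by blast
    then show ?thesis unfolding stabilizer_def by simp
  qed
  then show ?thesis using tr by (simp add: regular_on_vertices_def)
qed

lemma mult: "g \<in> G \<Longrightarrow> h \<in> G \<Longrightarrow> g \<otimes>\<^bsub>aut_group \<Gamma>\<lparr>carrier := G\<rparr>\<^esub> h = compose V g h"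
  using mult_aut_group[OF G_Bij G_Bij] by simp

lemma mult_in: "g \<in> G \<Longrightarrow> h \<in> G \<Longrightarrow> compose V g h \<in> G"
  using subgroup.m_closed[OF sub, of g h] mult_aut_group[OF G_Bij G_Bij, of g h] by simp

lemma eq_if_agree:
  assumes "g \<in> G" "h \<in> G" "v \<in> V" "g v = h v"
  shows "g = h"
proof -
  let ?A = "aut_group \<Gamma>"
  interpret A: group ?A by (rule group_aut_group)
  have hi: "inv\<^bsub>?A\<^esub> h \<in> G" by (rule subgroup.m_inv_closed[OF sub assms(2)])
  have c: "g \<in> carrier ?A" "h \<in> carrier ?A" using assms subgroup.mem_carrier[OF sub] by auto
  have "compose V (inv\<^bsub>?A\<^esub> h) h = \<one>\<^bsub>?A\<^esub>"
    using A.l_inv[OF c(2)] mult_aut_group[OF G_Bij[OF hi] G_Bij[OF assms(2)]] by simp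
  then have "(inv\<^bsub>?A\<^esub> h) (h v) = v" using assms(3) by (metis compose_eq one_aut_group restrict_apply')
  then have "compose V (inv\<^bsub>?A\<^esub> h) g v = v" using assms(3,4) by (simp add: compose_eq)
  then have "inv\<^bsub>?A\<^esub> h \<otimes>\<^bsub>?A\<^esub> g = \<one>\<^bsub>?A\<^esub>"
    using fixes_all[OF mult_in[OF hi assms(1)] assms(3)] mult_aut_group[OF G_Bij[OF hi] G_Bij[OF assms(1)]]
    by simp
  then have "inv\<^bsub>?A\<^esub> h = inv\<^bsub>?A\<^esub> g" using A.inv_equality[of "inv\<^bsub>?A\<^esub> h" g] c by simp
  then show ?thesis using c by (metis A.inv_inv)
qed

text \<open>
  The inverse of the orbit map \<open>g \<mapsto> g base\<close>, which identifies the vertices with the elements of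
  \<open>G\<close>.
\<close>
definition "element v = (THE g. g \<in> G \<and> g base = v)"

lemma element:
  assumes "v \<in> V"
  shows "element v \<in> G" "element v base = v"
proof -
  have "\<exists>!g. g \<in> G \<and> g base = v"
    using G_trans[OF base(1) assms] eq_if_agree[OF _ _ base(1)] by metis
  from theI'[OF this] show "element v \<in> G" "element v base = v" unfolding element_def by auto
qed

lemma element_eq: "g \<in> G \<Longrightarrow> element (g base) = g"
  using element[OF G_in[OF _ base(1)]] eq_if_agree[OF _ _ base(1)] by metis

definition "connection = element ` {mate base, flip base, out base}"

text \<open>
  If \<open>c\<close> is one of the three involutions and \<open>s\<close> moves \<open>base\<close> to \<open>c base\<close>, then \<open>g \<circ> s\<close> moves \<open>base\<close> to
  \<open>g (c base) = c (g base)\<close>. So right multiplication by \<open>s\<close> corresponds to \<open>c\<close>.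
\<close>
theorem cayley:
  "card connection = 3 \<and> (\<forall>s\<in>connection. involution (aut_group \<Gamma>\<lparr>carrier := G\<rparr>) s) \<and>
    graph_isomorphic \<Gamma> (cayley_graph (aut_group \<Gamma>\<lparr>carrier := G\<rparr>) connection)"
proof (intro conjI ballI)
  note b = base(1)
  have nV: "mate base \<in> V" "flip base \<in> V" "out base \<in> V" using b by (simp_all add: mate_in flip_in out_in)
  note nd = nbrs_distinct[OF b]
  have inj: "inj_on element V" by (rule inj_on_inverseI[where g = "\<lambda>g. g base"]) (rule element(2))
  have "card connection = card {mate base, flip base, out base}"
    unfolding connection_def by (rule card_image) (rule inj_on_subset[OF inj], use nV in auto)
  then show "card connection = 3" using nd by auto
  have conn: "s \<in> G \<and> s base \<in> V \<and> s base \<noteq> base \<and>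
      (\<exists>c\<in>{mate, flip, out}. s base = c base)" if "s \<in> connection" for s
    using that nV nd element unfolding connection_def by auto
  have col: "g (c v) = c (g v)" if "g \<in> G" "v \<in> V" "c \<in> {mate, flip, out}" for g c v
    using that G_mate G_flip G_out by auto
  have cc: "c (c v) = v" if "v \<in> V" "c \<in> {mate, flip, out}" for c v
    using that mate_mate flip_flip out_out by auto
  show "involution (aut_group \<Gamma>\<lparr>carrier := G\<rparr>) s" if s: "s \<in> connection" for s
  proof -
    obtain c where c: "c \<in> {mate, flip, out}" "s base = c base" using conn[OF s] by blast
    have sG: "s \<in> G" and ne: "s base \<noteq> base" using conn[OF s] by blast+
    have "compose V s s base = base" using b c col[OF sG b c(1)] cc[OF b c(1)] by (simp add: compose_eq)
    then have "compose V s s = \<one>\<^bsub>aut_group \<Gamma>\<^esub>" using fixes_all[OF mult_in[OF sG sG] b] by simp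
    moreover have "s \<noteq> \<one>\<^bsub>aut_group \<Gamma>\<^esub>" using ne b by (auto simp: one_aut_group)
    ultimately show ?thesis using sG mult[OF sG sG] by (simp add: involution_def)
  qed
  let ?K = "cayley_graph (aut_group \<Gamma>\<lparr>carrier := G\<rparr>) connection"
  have "graph_isomorphism element \<Gamma> ?K"
    unfolding graph_isomorphism_def
  proof (intro conjI ballI)
    have "element ` V = G"
    proof
      show "element ` V \<subseteq> G" using element(1) by blast
      show "G \<subseteq> element ` V"
      proof
        fix g assume g: "g \<in> G"
        have "element (g base) \<in> element ` V" by (rule imageI) (rule G_in[OF g b])
        then show "g \<in> element ` V" by (simp only: element_eq[OF g])
      qed
    qed
    then show "bij_betw element V (pverts ?K)" using inj by (simp add: bij_betw_def cayley_graph_def)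
    fix u w assume u: "u \<in> V" and w: "w \<in> V"
    note eu = element[OF u] and ew = element[OF w]
    have "(u, w) \<in> parcs \<Gamma> \<longleftrightarrow> (\<exists>c\<in>{mate, flip, out}. w = c u)" using u by (simp add: arcs)
    also have "\<dots> \<longleftrightarrow> (\<exists>s\<in>connection. element w = compose V (element u) s)"
    proof
      assume "\<exists>c\<in>{mate, flip, out}. w = c u"
      then obtain c where c: "c \<in> {mate, flip, out}" "w = c u" by blast
      have cb: "c base \<in> V" using c(1) nV by auto
      have s: "element (c base) \<in> connection" using c(1) unfolding connection_def by auto
      have "compose V (element u) (element (c base)) base = w"
        using b c(2) element[OF cb] col[OF eu(1) b c(1)] eu(2) by (simp add: compose_eq)
      then have "element w = compose V (element u) (element (c base))"
        by (intro eq_if_agree[OF ew(1) mult_in[OF eu(1) element(1)[OF cb]] b]) (simp add: ew(2))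
      then show "\<exists>s\<in>connection. element w = compose V (element u) s" using s by blast
    next
      assume "\<exists>s\<in>connection. element w = compose V (element u) s"
      then obtain s where s: "s \<in> connection" "element w = compose V (element u) s" by blast
      obtain c where c: "c \<in> {mate, flip, out}" "s base = c base" using conn[OF s(1)] by blast
      have "w = element u (s base)" using ew(2) b unfolding s(2) by (simp add: compose_eq)
      then have "w = c u" using c col[OF eu(1) b c(1)] eu(2) by simp
      then show "\<exists>c\<in>{mate, flip, out}. w = c u" using c(1) by blast
    qed
    also have "\<dots> \<longleftrightarrow> (\<exists>s\<in>connection. element w = element u \<otimes>\<^bsub>aut_group \<Gamma>\<lparr>carrier := G\<rparr>\<^esub> s)"
      using mult[OF eu(1)] conn by auto
    also have "\<dots> \<longleftrightarrow> (element u, element w) \<in> parcs ?K"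
      using eu(1) by (auto simp: cayley_graph_def)
    finally show "(u, w) \<in> parcs \<Gamma> \<longleftrightarrow> (element u, element w) \<in> parcs ?K" .
  qed
  then show "graph_isomorphic \<Gamma> ?K" unfolding graph_isomorphic_def by blast
qed

end

section \<open>The classification\<close>

lemma (in bialternating_system) transitive_group_imp_listed:
  assumes "subgroup G (aut_group \<Gamma>)" "transitive_on_vertices \<Gamma> G" "preserves G \<C>"
  shows "n = 4 \<and> (graph_isomorphic \<Gamma> (moebius_ladder m) \<or> graph_isomorphic \<Gamma> (prism m)) \<or>
    n = 8 \<and> (3 dvd m \<and> (iso_with_factor \<Gamma> \<C> m 8 (Xb1 m) \<or> iso_with_factor \<Gamma> \<C> m 8 (Xb2 m)) \<or>
      (\<exists>a l. listed_8 m a l \<and> iso_with_factor \<Gamma> \<C> m 8 (Xb m 8 a 4 l))) \<or>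
    12 \<le> n \<and> (\<exists>a b l. admissible m n a b l \<and> iso_with_factor \<Gamma> \<C> m n (Xb m n a b l) \<and> listed_12 m n a b l)"
proof -
  interpret H: homogeneous_system \<Gamma> \<C> mate flip out layer sig walk m n G
    by (rule homogeneous_of_group[OF assms])
  obtain y where tw: "cayley_twist n H.twist m y"
    and iso: "iso_with_factor \<Gamma> \<C> m n (twisted_graph m n H.twist y)"
    and conj: "\<And>k. same_type k \<Longrightarrow> [y \<star> (conj_twist H.twist ^^ nat m) k = k \<star> y] (mod n)"
    using H.exists_cayley_twist by blast
  interpret T: cayley_twist n H.twist m y by (rule tw)
  have "n = 4 \<or> n = 8 \<or> 12 \<le> n" using n_dvd_4 n_ge_4 by presburger
  then show ?thesis
  proof (elim disjE)
    assume n: "n = 4"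
    interpret Q: square_system \<Gamma> \<C> mate flip out layer sig walk m n
      by unfold_locales (rule n)
    show ?thesis using Q.ladder n by blast
  next
    assume n: "n = 8"
    show ?thesis using T.period_8_cases[OF n m_ge conj] iso n by auto
  next
    assume n: "12 \<le> n"
    obtain a b l where "admissible m n a b l" "listed_12 m n a b l" "twisted_graph m n H.twist y = Xb m n a b l"
      using T.listed_12_of_parity[OF n H.even_pi_4[OF n] H.odd_pi_1[OF n] m_ge
          conj[OF H.same_type_multiples(1)]] by blast
    then show ?thesis using iso n by metis
  qed
qed

lemma (in bialternating_system) listed_imp_transitive_group:
  assumes "n = 4 \<or>
    n = 8 \<and> (3 dvd m \<and> (iso_with_factor \<Gamma> \<C> m 8 (Xb1 m) \<or> iso_with_factor \<Gamma> \<C> m 8 (Xb2 m)) \<or>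
      (\<exists>a l. listed_8 m a l \<and> iso_with_factor \<Gamma> \<C> m 8 (Xb m 8 a 4 l))) \<or>
    (\<exists>a b l. admissible m n a b l \<and> iso_with_factor \<Gamma> \<C> m n (Xb m n a b l) \<and> listed_12 m n a b l)"
  shows "\<exists>G. subgroup G (aut_group \<Gamma>) \<and> transitive_on_vertices \<Gamma> G \<and> preserves G \<C>"
proof -
  have m0: "0 < m" using m_ge by simp
  have *: ?thesis if "\<exists>\<pi> y. cayley_twist n \<pi> m y \<and> Y = twisted_graph m n \<pi> y" "iso_with_factor \<Gamma> \<C> m n Y" for Y
    using that cayley_twist_imp_group[OF _ _ inner] by blast
  show ?thesis
    using assms
  proof (elim disjE conjE exE)
    assume n: "n = 4"
    interpret Q: square_system \<Gamma> \<C> mate flip out layer sig walk m n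
      by unfold_locales (rule n)
    show ?thesis by (rule Q.factor_auts_transitive)
  next
    assume "n = 8" "3 dvd m" "iso_with_factor \<Gamma> \<C> m 8 (Xb1 m)"
    then show ?thesis using swap8_cayley_twist[of 1 4 m] m0 Xb1_eq_twisted[OF m0] by (intro *[of "Xb1 m"]) auto
  next
    assume "n = 8" "3 dvd m" "iso_with_factor \<Gamma> \<C> m 8 (Xb2 m)"
    then show ?thesis using swap8_cayley_twist[of 4 5 m] m0 Xb2_eq_twisted[OF m0] by (intro *[of "Xb2 m"]) auto
  next
    fix a l assume "n = 8" "listed_8 m a l" "iso_with_factor \<Gamma> \<C> m 8 (Xb m 8 a 4 l)"
    then show ?thesis using listed_8_cayley_twist[OF m0] by (intro *[of "Xb m 8 a 4 l"]) auto
  next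
    fix a b l assume "admissible m n a b l" "listed_12 m n a b l" "iso_with_factor \<Gamma> \<C> m n (Xb m n a b l)"
    then show ?thesis using listed_12_cayley_twist by (intro *[of "Xb m n a b l"]) auto
  qed
qed

lemma (in bialternating_system) transitive_group_consequences:
  assumes graph: "pair_graph \<Gamma>"
    and G: "subgroup G (aut_group \<Gamma>)" "transitive_on_vertices \<Gamma> G" "preserves G \<C>"
  shows "girth \<Gamma> \<le> 10 \<and> regular_on_vertices \<Gamma> G \<and>
    (\<exists>S. card S = 3 \<and> (\<forall>s\<in>S. involution (aut_group \<Gamma> \<lparr>carrier := G\<rparr>) s) \<and>
       graph_isomorphic \<Gamma> (cayley_graph (aut_group \<Gamma> \<lparr>carrier := G\<rparr>) S))"
proof -
  interpret H: homogeneous_system \<Gamma> \<C> mate flip out layer sig walk m n G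
    by (rule homogeneous_of_group[OF G])
  interpret R: homogeneous_group \<Gamma> \<C> mate flip out layer sig walk m n G
    by (rule homogeneous_group.intro[OF H.homogeneous_system_axioms homogeneous_group_axioms.intro[OF G(1,2)]])
  have "girth \<Gamma> \<le> 10"
  proof (cases "12 \<le> n")
    case True
    then show ?thesis using H.girth_le_10[OF graph H.odd_pi_1[OF True]] by simp
  next
    case False
    then have "n \<le> 8" using n_dvd_4 by presburger
    then have "enat (nat n) \<le> enat 10" by simp
    with girth_le_cycle[OF graph] have "girth \<Gamma> \<le> enat 10" by (rule order_trans)
    then show ?thesis by (simp add: numeral_eq_enat)
  qed
  then show ?thesis using R.regular R.cayley by blast
qed

theorem theorem5p6:
  fixes \<Gamma> :: "'a pair_pre_digraph" and \<C> :: "'a pair_pre_digraph set" and m n :: int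
  assumes "pair_graph \<Gamma>" and "cubic \<Gamma>" and "vertex_transitive \<Gamma>"
    and "factor_partition \<Gamma> \<C>" and "bialternating \<Gamma> \<C>"
    and "m = int (card \<C>)" and "\<forall>C\<in>\<C>. int (card (pverts C)) = n"
  shows
    "((\<exists>G. subgroup G (aut_group \<Gamma>) \<and> transitive_on_vertices \<Gamma> G \<and> preserves G \<C>) \<longleftrightarrow>
      (4 dvd n \<and>
       ((n = 4 \<and> (graph_isomorphic \<Gamma> (moebius_ladder m) \<or> graph_isomorphic \<Gamma> (prism m))) \<or>
        (n = 8 \<and>
          ((3 dvd m \<and>
              (iso_with_factor \<Gamma> \<C> m 8 (Xb1 m) \<or> iso_with_factor \<Gamma> \<C> m 8 (Xb2 m))) \<or>
           (odd m \<and> (\<exists>l\<in>{3, 7}. iso_with_factor \<Gamma> \<C> m 8 (Xb m 8 5 4 l))) \<or>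
           (even m \<and> (\<exists>a\<in>{1, 5}. \<exists>l\<in>{2, 6}. iso_with_factor \<Gamma> \<C> m 8 (Xb m 8 a 4 l))))) \<or>
        (n \<ge> 12 \<and>
          (\<exists>a b l. admissible m n a b l \<and> iso_with_factor \<Gamma> \<C> m n (Xb m n a b l) \<and>
            ((odd m \<and> odd l \<and> [b = n - 4] (mod n) \<and> [a = 2 * l - 1] (mod n)) \<or>
             (odd m \<and> even l \<and> a = 1 \<and> b = 4 \<and>
                (\<exists>n0. n = 4 * n0 \<and> odd n0 \<and> n0 \<ge> 3 \<and> [l = 2 * n0 + 2 * m - 2] (mod n))) \<or>
             (even m \<and> even l \<and>
                (\<exists>b0. b = 4 * b0 \<and> [(l + 2) * (b0 - 1) = 0] (mod n) \<and>
                   [2 * (l + 2) = 2 * m * (b0 + 1)] (mod n)))))))))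
     \<and>
     (\<forall>G. subgroup G (aut_group \<Gamma>) \<and> transitive_on_vertices \<Gamma> G \<and> preserves G \<C> \<longrightarrow>
        girth \<Gamma> \<le> 10 \<and>
        regular_on_vertices \<Gamma> G \<and>
        (\<exists>S. card S = 3 \<and> (\<forall>s\<in>S. involution (aut_group \<Gamma> \<lparr>carrier := G\<rparr>) s) \<and>
           graph_isomorphic \<Gamma> (cayley_graph (aut_group \<Gamma> \<lparr>carrier := G\<rparr>) S)))"
proof -
  interpret B: bialternating_graph \<Gamma> \<C> m n
    using assms by (simp add: bialternating_graph_def)
  interpret S: bialternating_system \<Gamma> \<C> B.mate B.flip B.out B.layer B.sig B.walk m n
    by (rule B.bialternating_system)
  have eight: "(\<exists>a l. listed_8 m a l \<and> iso_with_factor \<Gamma> \<C> m 8 (Xb m 8 a 4 l)) \<longleftrightarrow>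
      (odd m \<and> (\<exists>l\<in>{3, 7}. iso_with_factor \<Gamma> \<C> m 8 (Xb m 8 5 4 l))) \<or>
      (even m \<and> (\<exists>a\<in>{1, 5}. \<exists>l\<in>{2, 6}. iso_with_factor \<Gamma> \<C> m 8 (Xb m 8 a 4 l)))"
    unfolding listed_8_def by blast
  note listed = S.transitive_group_imp_listed[unfolded eight listed_12_def]
    and group = S.listed_imp_transitive_group[unfolded eight listed_12_def]
  show ?thesis
    apply (rule conjI)
     apply (rule iffI)
      apply (rule conjI[OF S.n_dvd_4])
      apply (elim exE conjE)
      apply (rule listed; assumption)
     apply (elim conjE)
     apply (rule group)
     apply blast
    apply (intro allI impI)
    apply (elim conjE)
    apply (rule S.transitive_group_consequences[OF assms(1)]; assumption)
    done
qed

end
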